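(* Let $\mathbf{C}$ be a category of $\mathbf{FI}$ type and consider (finitely generated) free $\mathbf{C}$-modules over $\mathbb{C}$. Then: (1) if $M_\bullet,N_\bullet$ are free, the tensor product $(M\otimes N)_\bullet$, $d\mapsto M_d\otimes N_d$ (morphisms acting by $M(f)\otimes N(f)$), is free; moreover if $M_\bullet$ has degree $\leq c_1$ and $N_\bullet$ has degree $\leq c_2$ then $M\otimes N$ has degree $\leq c_1+c_2$. (2) For a free module $M_\bullet=\bigoplus_i\mathrm{Ind}_{c_i}(V_i)$, its dual $M^*_\bullet:=\bigoplus_i\mathrm{Ind}_{c_i}(V_i^* )$ is free of the same degree, and there is a homomorphism of $\mathbf{C}$-modules $M^*\otimes M\to\mathbb{C}_\bullet$ (the constant module with value $\mathbb{C}$ and identity maps) which is a non-degenerate pairing at each object $d$, hence defines a $G_d$-equivariant isomorphism $(M^* )_d\cong (M_d)^*$ for every $d$. (3) If $M_\bullet$ is free of degree $\leq c$, then for all objects $c\leq d\leq e$ the map of coinvariants $M_d/G_d\to M_e/G_e$ induced by any morphism $d\to e$ is an isomorphism.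
   Context: A category $\mathbf{C}$ is of $\mathbf{FI}$ type if: (1) all Hom-sets are finite; (2) every morphism is a monomorphism and every endomorphism is an isomorphism; (3) for all objects $c,d$ the group $G_d=\mathrm{Aut}_{\mathbf{C}}(d)$ acts transitively on $\mathrm{Hom}_{\mathbf{C}}(c,d)$; (4) for every $d$ there are only finitely many isomorphism classes of objects $c$ with $\mathrm{Hom}_{\mathbf{C}}(c,d)\neq\emptyset$; (5) every pair $c_1\to d\leftarrow c_2$ has a pullback, and every pair $f_i:p\to c_i$ has a weak push-out, i.e. a commutative square $g_i:c_i\to d$ ($g_1f_1=g_2f_2$) which is a pullback square and such that for every other pullback square $h_i:c_i\to z$ with $h_1f_1=h_2f_2$ there is a unique $h:d\to z$ with $hg_i=h_i$. Write $c\leq d$ if $\mathrm{Hom}(c,d)\neq\emptyset$; $G_c=\mathrm{Aut}(c)$. A $\mathbf{C}$-module is a functor from $\mathbf{C}$ to complex vector spaces. For a finite-dimensional $G_c$-representation $V$, $\mathrm{Ind}_c(V)$ is $d\mapsto\mathbb{C}[\mathrm{Hom}(c,d)]\otimes_{\mathbb{C}[G_c]}V$. A free module is a finite direct sum of induction modules; it has degree $\leq d$ if every $\mathrm{Ind}_c(V)$ appearing nontrivially has $c\leq d$. For objects $c_1,c_2$, write $d\geq c_1+c_2$ if $w\leq d$ for every weak push-out object $w$ of any pair of morphisms $p\to c_1$, $p\to c_2$; a free module has degree $\leq c_1+c_2$ if it has degree $\leq d$ for every $d\geq c_1+c_2$. Coinvariants: $V/G=V/\langle v-gv\rangle$. 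*)

theory Defs
  imports Complex_Main "HOL-Library.Function_Algebras"
begin

record ('o, 'm) cat =
  Ob  :: "'o set"
  Hom :: "'o \<Rightarrow> 'o \<Rightarrow> 'm set"
  cmp :: "'m \<Rightarrow> 'm \<Rightarrow> 'm"     (* cmp g f = g \<circ> f *)
  idm :: "'o \<Rightarrow> 'm"

definition is_cat :: "('o, 'm) cat \<Rightarrow> bool" where
  "is_cat C \<longleftrightarrow>
     (\<forall>c d. Hom C c d \<noteq> {} \<longrightarrow> c \<in> Ob C \<and> d \<in> Ob C) \<and>
     (\<forall>c d c' d'. Hom C c d \<inter> Hom C c' d' \<noteq> {} \<longrightarrow> c = c' \<and> d = d') \<and>
     (\<forall>c\<in>Ob C. idm C c \<in> Hom C c c) \<and>
     (\<forall>c d e f g. f \<in> Hom C c d \<longrightarrow> g \<in> Hom C d e \<longrightarrow> cmp C g f \<in> Hom C c e) \<and>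
     (\<forall>c d e k f g h. f \<in> Hom C c d \<longrightarrow> g \<in> Hom C d e \<longrightarrow> h \<in> Hom C e k \<longrightarrow>
         cmp C h (cmp C g f) = cmp C (cmp C h g) f) \<and>
     (\<forall>c d f. f \<in> Hom C c d \<longrightarrow> cmp C f (idm C c) = f \<and> cmp C (idm C d) f = f)"

definition iso_mor :: "('o, 'm) cat \<Rightarrow> 'o \<Rightarrow> 'o \<Rightarrow> 'm \<Rightarrow> bool" where
  "iso_mor C c d f \<longleftrightarrow> f \<in> Hom C c d \<and>
     (\<exists>g\<in>Hom C d c. cmp C g f = idm C c \<and> cmp C f g = idm C d)"

definition Aut :: "('o, 'm) cat \<Rightarrow> 'o \<Rightarrow> 'm set" where
  "Aut C c = {f. iso_mor C c c f}"

definition inv_mor :: "('o, 'm) cat \<Rightarrow> 'o \<Rightarrow> 'm \<Rightarrow> 'm" where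
  "inv_mor C c g = (THE h. h \<in> Hom C c c \<and> cmp C h g = idm C c)"

definition mono_mor :: "('o, 'm) cat \<Rightarrow> 'o \<Rightarrow> 'm \<Rightarrow> bool" where
  "mono_mor C c f \<longleftrightarrow> (\<forall>e\<in>Ob C. \<forall>g\<in>Hom C e c. \<forall>h\<in>Hom C e c. cmp C f g = cmp C f h \<longrightarrow> g = h)"

definition is_pullback ::
  "('o, 'm) cat \<Rightarrow> 'o \<Rightarrow> 'o \<Rightarrow> 'o \<Rightarrow> 'm \<Rightarrow> 'm \<Rightarrow> 'o \<Rightarrow> 'm \<Rightarrow> 'm \<Rightarrow> bool" where
  "is_pullback C d c1 c2 g1 g2 p f1 f2 \<longleftrightarrow>
     g1 \<in> Hom C c1 d \<and> g2 \<in> Hom C c2 d \<and> f1 \<in> Hom C p c1 \<and> f2 \<in> Hom C p c2 \<and>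
     cmp C g1 f1 = cmp C g2 f2 \<and>
     (\<forall>q\<in>Ob C. \<forall>h1\<in>Hom C q c1. \<forall>h2\<in>Hom C q c2. cmp C g1 h1 = cmp C g2 h2 \<longrightarrow>
        (\<exists>!h. h \<in> Hom C q p \<and> cmp C f1 h = h1 \<and> cmp C f2 h = h2))"

definition weak_pushout ::
  "('o, 'm) cat \<Rightarrow> 'o \<Rightarrow> 'o \<Rightarrow> 'o \<Rightarrow> 'm \<Rightarrow> 'm \<Rightarrow> 'o \<Rightarrow> 'm \<Rightarrow> 'm \<Rightarrow> bool" where
  "weak_pushout C p c1 c2 f1 f2 d g1 g2 \<longleftrightarrow>
     is_pullback C d c1 c2 g1 g2 p f1 f2 \<and>
     (\<forall>z\<in>Ob C. \<forall>h1\<in>Hom C c1 z. \<forall>h2\<in>Hom C c2 z. is_pullback C z c1 c2 h1 h2 p f1 f2 \<longrightarrow>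
        (\<exists>!h. h \<in> Hom C d z \<and> cmp C h g1 = h1 \<and> cmp C h g2 = h2))"

definition FI_type :: "('o, 'm) cat \<Rightarrow> bool" where
  "FI_type C \<longleftrightarrow> is_cat C \<and>
     (\<forall>c\<in>Ob C. \<forall>d\<in>Ob C. finite (Hom C c d)) \<and>
     (\<forall>c d f. f \<in> Hom C c d \<longrightarrow> mono_mor C c f) \<and>
     (\<forall>d f. f \<in> Hom C d d \<longrightarrow> iso_mor C d d f) \<and>
     (\<forall>c d f f'. f \<in> Hom C c d \<longrightarrow> f' \<in> Hom C c d \<longrightarrow> (\<exists>g\<in>Aut C d. cmp C g f = f')) \<and>
     (\<forall>d\<in>Ob C. \<exists>S. finite S \<and> S \<subseteq> Ob C \<and>
         (\<forall>c\<in>Ob C. Hom C c d \<noteq> {} \<longrightarrow> (\<exists>s\<in>S. \<exists>f. iso_mor C c s f))) \<and>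
     (\<forall>d c1 c2 g1 g2. g1 \<in> Hom C c1 d \<longrightarrow> g2 \<in> Hom C c2 d \<longrightarrow>
         (\<exists>p f1 f2. is_pullback C d c1 c2 g1 g2 p f1 f2)) \<and>
     (\<forall>p c1 c2 f1 f2. f1 \<in> Hom C p c1 \<longrightarrow> f2 \<in> Hom C p c2 \<longrightarrow>
         (\<exists>d g1 g2. weak_pushout C p c1 c2 f1 f2 d g1 g2))"

definition obj_le :: "('o, 'm) cat \<Rightarrow> 'o \<Rightarrow> 'o \<Rightarrow> bool" where
  "obj_le C c d \<longleftrightarrow> Hom C c d \<noteq> {}"

definition geq_sum :: "('o, 'm) cat \<Rightarrow> 'o \<Rightarrow> 'o \<Rightarrow> 'o \<Rightarrow> bool" where
  "geq_sum C c1 c2 d \<longleftrightarrow>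
     (\<forall>p f1 f2 w g1 g2. p \<in> Ob C \<longrightarrow> f1 \<in> Hom C p c1 \<longrightarrow> f2 \<in> Hom C p c2 \<longrightarrow>
        weak_pushout C p c1 c2 f1 f2 w g1 g2 \<longrightarrow> obj_le C w d)"

definition sc :: "complex \<Rightarrow> ('a \<Rightarrow> complex) \<Rightarrow> ('a \<Rightarrow> complex)" where
  "sc c v = (\<lambda>x. c * v x)"

definition subsp :: "('a \<Rightarrow> complex) set \<Rightarrow> bool" where
  "subsp V \<longleftrightarrow> 0 \<in> V \<and> (\<forall>u\<in>V. \<forall>v\<in>V. u + v \<in> V) \<and> (\<forall>c. \<forall>v\<in>V. sc c v \<in> V)"

definition fdim_sp :: "('a \<Rightarrow> complex) set \<Rightarrow> bool" where
  "fdim_sp V \<longleftrightarrow> (\<exists>(k::nat) bs. (\<forall>i<k. bs i \<in> V) \<and>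
      (\<forall>v\<in>V. \<exists>a. v = (\<Sum>i<k. sc (a i) (bs i))))"

definition lin_on :: "('a \<Rightarrow> complex) set \<Rightarrow> ('b \<Rightarrow> complex) set
     \<Rightarrow> (('a \<Rightarrow> complex) \<Rightarrow> ('b \<Rightarrow> complex)) \<Rightarrow> bool" where
  "lin_on V W f \<longleftrightarrow> (\<forall>v\<in>V. f v \<in> W) \<and> (\<forall>u\<in>V. \<forall>v\<in>V. f (u + v) = f u + f v) \<and>
     (\<forall>c. \<forall>v\<in>V. f (sc c v) = sc c (f v))"

definition lin_fun :: "('a \<Rightarrow> complex) set \<Rightarrow> (('a \<Rightarrow> complex) \<Rightarrow> complex) \<Rightarrow> bool" where
  "lin_fun V \<phi> \<longleftrightarrow> (\<forall>u\<in>V. \<forall>v\<in>V. \<phi> (u + v) = \<phi> u + \<phi> v) \<and> (\<forall>c. \<forall>v\<in>V. \<phi> (sc c v) = c * \<phi> v)"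

definition dualV :: "('a \<Rightarrow> complex) set \<Rightarrow> (('a \<Rightarrow> complex) \<Rightarrow> complex) set" where
  "dualV V = {\<phi>. lin_fun V \<phi> \<and> (\<forall>v. v \<notin> V \<longrightarrow> \<phi> v = 0)}"

definition pt :: "('a \<Rightarrow> complex) \<Rightarrow> ('b \<Rightarrow> complex) \<Rightarrow> ('a \<times> 'b \<Rightarrow> complex)" where
  "pt u v = (\<lambda>(a, b). u a * v b)"

definition is_rep :: "('o, 'm) cat \<Rightarrow> 'o \<Rightarrow> ('a \<Rightarrow> complex) set
     \<Rightarrow> ('m \<Rightarrow> ('a \<Rightarrow> complex) \<Rightarrow> ('a \<Rightarrow> complex)) \<Rightarrow> bool" where
  "is_rep C c V \<rho> \<longleftrightarrow> subsp V \<and> fdim_sp V \<and>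
     (\<forall>g\<in>Aut C c. lin_on V V (\<rho> g)) \<and>
     (\<forall>v\<in>V. \<rho> (idm C c) v = v) \<and>
     (\<forall>g\<in>Aut C c. \<forall>h\<in>Aut C c. \<forall>v\<in>V. \<rho> (cmp C g h) v = \<rho> g (\<rho> h v))"

definition dual_act :: "('o, 'm) cat \<Rightarrow> 'o \<Rightarrow> ('a \<Rightarrow> complex) set
     \<Rightarrow> ('m \<Rightarrow> ('a \<Rightarrow> complex) \<Rightarrow> ('a \<Rightarrow> complex))
     \<Rightarrow> 'm \<Rightarrow> (('a \<Rightarrow> complex) \<Rightarrow> complex) \<Rightarrow> (('a \<Rightarrow> complex) \<Rightarrow> complex)" where
  "dual_act C c V \<rho> g \<phi> = (\<lambda>v. if v \<in> V then \<phi> (\<rho> (inv_mor C c g) v) else 0)"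

record ('m, 'o, 'x) cmod =
  sp :: "'o \<Rightarrow> ('x \<Rightarrow> complex) set"
  mp :: "'m \<Rightarrow> ('x \<Rightarrow> complex) \<Rightarrow> ('x \<Rightarrow> complex)"

definition is_module :: "('o, 'm) cat \<Rightarrow> ('m, 'o, 'x) cmod \<Rightarrow> bool" where
  "is_module C M \<longleftrightarrow>
     (\<forall>d\<in>Ob C. subsp (sp M d)) \<and>
     (\<forall>c d f. f \<in> Hom C c d \<longrightarrow> lin_on (sp M c) (sp M d) (mp M f)) \<and>
     (\<forall>c\<in>Ob C. \<forall>v\<in>sp M c. mp M (idm C c) v = v) \<and>
     (\<forall>c d e f g. f \<in> Hom C c d \<longrightarrow> g \<in> Hom C d e \<longrightarrow>
        (\<forall>v\<in>sp M c. mp M (cmp C g f) v = mp M g (mp M f v)))"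

text \<open>Tensor product module d \<mapsto> M_d \<otimes> N_d, morphisms acting by M(f) \<otimes> N(f).
  M_d \<otimes> N_d is realised as the span of the elementary tensors pt u v (all finite
  sums of them, since scalars can be absorbed); M(f) \<otimes> N(f) is the (well-defined)
  linear extension of u \<otimes> v \<mapsto> M(f) u \<otimes> N(f) v.\<close>
definition tensor :: "('o, 'm) cat \<Rightarrow> ('m, 'o, 'x) cmod \<Rightarrow> ('m, 'o, 'z) cmod
     \<Rightarrow> ('m, 'o, 'x \<times> 'z) cmod" where
  "tensor C M N =
    \<lparr> sp = (\<lambda>d. {(\<Sum>i<(k::nat). pt (us i) (vs i)) | k us vs.
                    \<forall>i<k. us i \<in> sp M d \<and> vs i \<in> sp N d}),
      mp = (\<lambda>h w. SOME w'. \<exists>c d k us vs. h \<in> Hom C c d \<and>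
                    (\<forall>i<k. us i \<in> sp M c \<and> vs i \<in> sp N c) \<and>
                    w = (\<Sum>i<(k::nat). pt (us i) (vs i)) \<and>
                    w' = (\<Sum>i<(k::nat). pt (mp M h (us i)) (mp N h (vs i)))) \<rparr>"

text \<open>A presentation M \<cong> \<Oplus>_{i<n} Ind_{c_i}(V_i) is encoded (via the universal property
  of induction) by G_{c_i}-equivariant linear maps \<iota>_i : V_i \<rightarrow> M_{c_i} such that, for
  every object d, the induced map
     \<Oplus>_i C[Hom(c_i,d)] \<otimes>_{C[G_{c_i}]} V_i \<rightarrow> M_d,   f \<otimes> v \<mapsto> M(f)(\<iota>_i v)
  is bijective.  Here C[Hom(c_i,d)] \<otimes> V_i is realised as the space T_d of functions
  \<psi> with \<psi> i f \<in> V_i (zero unless i<n and f \<in> Hom(c_i,d)), \<psi> = \<Sum> \<delta>_{(i,f)} \<otimes> \<psi> i f,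
  and the tensor product over C[G_{c_i}] is T_d modulo the span K_d of the relations
  (f g) \<otimes> v - f \<otimes> (g v).\<close>

definition delta :: "nat \<Rightarrow> 'm \<Rightarrow> ('y \<Rightarrow> complex) \<Rightarrow> (nat \<Rightarrow> 'm \<Rightarrow> 'y \<Rightarrow> complex)" where
  "delta i f v = (\<lambda>j h. if j = i \<and> h = f then v else 0)"

definition Tsp :: "('o, 'm) cat \<Rightarrow> nat \<Rightarrow> (nat \<Rightarrow> 'o) \<Rightarrow> (nat \<Rightarrow> ('y \<Rightarrow> complex) set)
     \<Rightarrow> 'o \<Rightarrow> (nat \<Rightarrow> 'm \<Rightarrow> 'y \<Rightarrow> complex) set" where
  "Tsp C n cs Vs d = {\<psi>. \<forall>i f. \<psi> i f \<in> (if i < n \<and> f \<in> Hom C (cs i) d then Vs i else {0})}"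

definition Rel :: "('o, 'm) cat \<Rightarrow> nat \<Rightarrow> (nat \<Rightarrow> 'o) \<Rightarrow> (nat \<Rightarrow> ('y \<Rightarrow> complex) set)
     \<Rightarrow> (nat \<Rightarrow> 'm \<Rightarrow> ('y \<Rightarrow> complex) \<Rightarrow> ('y \<Rightarrow> complex))
     \<Rightarrow> 'o \<Rightarrow> (nat \<Rightarrow> 'm \<Rightarrow> 'y \<Rightarrow> complex) set" where
  "Rel C n cs Vs \<rho>s d = {(\<Sum>j<(k::nat). delta (is j) (cmp C (fs j) (gs j)) (vs j)
                                 - delta (is j) (fs j) (\<rho>s (is j) (gs j) (vs j)))
       | k is fs gs vs. \<forall>j<k. is j < n \<and> fs j \<in> Hom C (cs (is j)) d \<and>
                              gs j \<in> Aut C (cs (is j)) \<and> vs j \<in> Vs (is j)}"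

definition Phi :: "('o, 'm) cat \<Rightarrow> ('m, 'o, 'x) cmod \<Rightarrow> nat \<Rightarrow> (nat \<Rightarrow> 'o)
     \<Rightarrow> (nat \<Rightarrow> ('y \<Rightarrow> complex) \<Rightarrow> ('x \<Rightarrow> complex))
     \<Rightarrow> 'o \<Rightarrow> (nat \<Rightarrow> 'm \<Rightarrow> 'y \<Rightarrow> complex) \<Rightarrow> ('x \<Rightarrow> complex)" where
  "Phi C M n cs \<iota> d \<psi> = (\<Sum>i<n. \<Sum>f\<in>Hom C (cs i) d. mp M f (\<iota> i (\<psi> i f)))"

definition free_pres :: "('o, 'm) cat \<Rightarrow> ('m, 'o, 'x) cmod \<Rightarrow> nat \<Rightarrow> (nat \<Rightarrow> 'o)
     \<Rightarrow> (nat \<Rightarrow> ('y \<Rightarrow> complex) set) \<Rightarrow> (nat \<Rightarrow> 'm \<Rightarrow> ('y \<Rightarrow> complex) \<Rightarrow> ('y \<Rightarrow> complex))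
     \<Rightarrow> (nat \<Rightarrow> ('y \<Rightarrow> complex) \<Rightarrow> ('x \<Rightarrow> complex)) \<Rightarrow> bool" where
  "free_pres C M n cs Vs \<rho>s \<iota> \<longleftrightarrow> is_module C M \<and>
     (\<forall>i<n. cs i \<in> Ob C \<and> is_rep C (cs i) (Vs i) (\<rho>s i) \<and>
        lin_on (Vs i) (sp M (cs i)) (\<iota> i) \<and>
        (\<forall>g\<in>Aut C (cs i). \<forall>v\<in>Vs i. \<iota> i (\<rho>s i g v) = mp M g (\<iota> i v))) \<and>
     (\<forall>d\<in>Ob C. sp M d = Phi C M n cs \<iota> d ` Tsp C n cs Vs d \<and>
        (\<forall>\<psi>\<in>Tsp C n cs Vs d. Phi C M n cs \<iota> d \<psi> = 0 \<longrightarrow> \<psi> \<in> Rel C n cs Vs \<rho>s d))"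

definition pres_deg_le :: "('o, 'm) cat \<Rightarrow> nat \<Rightarrow> (nat \<Rightarrow> 'o) \<Rightarrow> (nat \<Rightarrow> ('y \<Rightarrow> complex) set)
     \<Rightarrow> 'o \<Rightarrow> bool" where
  "pres_deg_le C n cs Vs d \<longleftrightarrow> (\<forall>i<n. Vs i \<noteq> {0} \<longrightarrow> obj_le C (cs i) d)"

text \<open>Representations are realised inside nat \<Rightarrow> complex (every finite-dimensional
  complex vector space embeds there), so this is no restriction.\<close>
definition is_free :: "('o, 'm) cat \<Rightarrow> ('m, 'o, 'x) cmod \<Rightarrow> bool" where
  "is_free C M \<longleftrightarrow> (\<exists>n cs (Vs :: nat \<Rightarrow> (nat \<Rightarrow> complex) set) \<rho>s \<iota>. free_pres C M n cs Vs \<rho>s \<iota>)"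

definition free_deg_le :: "('o, 'm) cat \<Rightarrow> ('m, 'o, 'x) cmod \<Rightarrow> 'o \<Rightarrow> bool" where
  "free_deg_le C M d \<longleftrightarrow> (\<exists>n cs (Vs :: nat \<Rightarrow> (nat \<Rightarrow> complex) set) \<rho>s \<iota>.
      free_pres C M n cs Vs \<rho>s \<iota> \<and> pres_deg_le C n cs Vs d)"

definition free_deg_le_sum :: "('o, 'm) cat \<Rightarrow> ('m, 'o, 'x) cmod \<Rightarrow> 'o \<Rightarrow> 'o \<Rightarrow> bool" where
  "free_deg_le_sum C M c1 c2 \<longleftrightarrow> is_free C M \<and>
      (\<forall>d\<in>Ob C. geq_sum C c1 c2 d \<longrightarrow> free_deg_le C M d)"

text \<open>The span of {v - g v}: all finite sums (closed under scalars by linearity).\<close>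
definition coinv_rel :: "('o, 'm) cat \<Rightarrow> ('m, 'o, 'x) cmod \<Rightarrow> 'o \<Rightarrow> ('x \<Rightarrow> complex) set" where
  "coinv_rel C M d = {(\<Sum>j<(k::nat). vs j - mp M (gs j) (vs j)) | k vs gs.
       \<forall>j<k. vs j \<in> sp M d \<and> gs j \<in> Aut C d}"

definition coinv :: "('o, 'm) cat \<Rightarrow> ('m, 'o, 'x) cmod \<Rightarrow> 'o \<Rightarrow> ('x \<Rightarrow> complex) set set" where
  "coinv C M d = (\<lambda>v. {v + r | r. r \<in> coinv_rel C M d}) ` sp M d"

definition coinv_map :: "('o, 'm) cat \<Rightarrow> ('m, 'o, 'x) cmod \<Rightarrow> 'o \<Rightarrow> 'm
     \<Rightarrow> ('x \<Rightarrow> complex) set \<Rightarrow> ('x \<Rightarrow> complex) set" where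
  "coinv_map C M e f A = {mp M f a + r | a r. a \<in> A \<and> r \<in> coinv_rel C M e}"

end

theory Submission
  imports Defs
begin

text \<open>
  Since the groups \<open>G\<^sub>c\<close> are finite and the characteristic is 0, coinvariants and invariants agree:
  an element of \<open>M\<^sub>d\<close> for \<open>M = \<Oplus>\<^sub>i Ind V\<^sub>i\<close> has a unique expansion \<open>\<Sum> M(f) v\<^sub>f\<close> whose coefficients
  \<open>v\<^sub>f \<in> V\<^sub>i\<close>, for \<open>f : c\<^sub>i \<rightarrow> d\<close>, form an equivariant family. A morphism \<open>h : d \<rightarrow> e\<close> moves the coefficient
  at \<open>f\<close> to \<open>h f\<close> and creates none off the image, because \<open>h\<close> is mono. Three consequences:
  the sums of all coefficients over \<open>f\<close> detect the coinvariants, and they do not change along \<open>h\<close>;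
  pairing the coefficients of \<open>M\<^sup>*\<close> and \<open>M\<close> index by index is invariant and perfect;
  and \<open>M\<^sub>d \<otimes> N\<^sub>d\<close> splits according to pairs \<open>f : a \<rightarrow> d\<close>, \<open>g : b \<rightarrow> d\<close>. Every such pair factors, uniquely up
  to isomorphism, through the weak push-out \<open>w\<close> of its pullback, so \<open>M \<otimes> N\<close> is induced from the
  representations of \<open>G\<^sub>w\<close> spanned by the pairs that are themselves weak push-outs; up to isomorphism
  there are finitely many such \<open>w\<close>.
\<close>

section \<open>Linear algebra in function spaces\<close>

text \<open>Presentations of free modules are quotients: \<open>Phi\<close> is injective only modulo
  \<open>Rel\<close>. Averaging turns each class into one canonical representative, so equality of
  elements becomes equality of coefficients, and \<open>free_presI\<close> lets freeness itself be
  checked on equivariant families. Uniqueness of the factorisation through a weak push-out rests on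
  one fact: postcomposing a pair with a mono does not change its pullback squares. Two minimal pairs
  with equal composites thus have spans that are pullbacks of the same pair, and each universal
  property applies to the other square. Consequently, with (f, g) minimal over w, the component of
  an expansion at (h0 f, h0 g) receives contributions only from the |G_w| morphisms h0 u with u in
  G_w, all of them equal; dividing by |G_w| gives injectivity. Two matters of encoding add work.
  \<open>tensor\<close> chooses decompositions into elementary tensors, so bilinear maps must be
  shown independent of them. And freeness asks for representations inside
  \<open>nat \<Rightarrow> complex\<close>, whereas those of the tensor product arise inside
  functions on a product and are transported by coordinates.\<close>

lemma sum_fun_apply: "(\<Sum>i\<in>A. F i) x = (\<Sum>i\<in>A. F i x)"
  by (induction A rule: infinite_finite_induct) (auto simp: plus_fun_apply zero_fun_apply)

lemma sc_apply: "sc a v x = a * v x"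
  by (simp add: sc_def)

lemma pt_apply: "pt u v (a, b) = u a * v b"
  by (simp add: pt_def)

text \<open>Rule application leaves eta-expanded functions behind; with the pointwise rules active the
  simplifier would turn these into lambda terms on which no algebraic rule fires.\<close>

declare plus_fun_apply [simp del] zero_fun_apply [simp del] minus_apply [simp del] uminus_apply [simp del]

lemmas fun_arith = fun_eq_iff plus_fun_apply zero_fun_apply minus_apply uminus_apply
  sc_apply pt_apply sum_fun_apply

interpretation cf: vector_space "sc :: complex \<Rightarrow> ('a \<Rightarrow> complex) \<Rightarrow> 'a \<Rightarrow> complex"
  by unfold_locales (auto simp: fun_arith algebra_simps)

lemma subsp_iff_subspace: "subsp V \<longleftrightarrow> cf.subspace V"
  by (auto simp: subsp_def cf.subspace_def)

lemma subspD:
  assumes "subsp V"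
  shows "0 \<in> V" "\<And>u v. u \<in> V \<Longrightarrow> v \<in> V \<Longrightarrow> u + v \<in> V" "\<And>c v. v \<in> V \<Longrightarrow> sc c v \<in> V"
    "\<And>u v. u \<in> V \<Longrightarrow> v \<in> V \<Longrightarrow> u - v \<in> V" "\<And>A w. (\<And>i. i \<in> A \<Longrightarrow> w i \<in> V) \<Longrightarrow> (\<Sum>i\<in>A. w i) \<in> V"
    "\<And>v. v \<in> V \<Longrightarrow> - v \<in> V"
  using assms unfolding subsp_iff_subspace
  by (auto intro: cf.subspace_0 cf.subspace_add cf.subspace_scale cf.subspace_diff cf.subspace_sum cf.subspace_neg)

text \<open>Additivity is only known on \<open>V\<close>, so the induction has to carry membership
  of the partial sums along. It serves \<open>lin_on\<close>, \<open>lin_fun\<close> and the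
  operator \<open>av\<close> on families alike.\<close>

lemma sum_additive_on:
  fixes F :: "'a::comm_monoid_add \<Rightarrow> 'b::comm_monoid_add"
  assumes "0 \<in> V" "\<And>u v. u \<in> V \<Longrightarrow> v \<in> V \<Longrightarrow> u + v \<in> V" "F 0 = 0"
    "\<And>u v. u \<in> V \<Longrightarrow> v \<in> V \<Longrightarrow> F (u + v) = F u + F v" "\<And>i. i \<in> A \<Longrightarrow> v i \<in> V"
  shows "F (\<Sum>i\<in>A. v i) = (\<Sum>i\<in>A. F (v i))"
proof -
  have "F (\<Sum>i\<in>A. v i) = (\<Sum>i\<in>A. F (v i)) \<and> (\<Sum>i\<in>A. v i) \<in> V"
    using assms(5) by (induction A rule: infinite_finite_induct) (auto simp: assms(1-4))
  then show ?thesis ..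
qed

section \<open>Linear maps and functionals given on a subspace\<close>

lemma lin_onD:
  assumes "lin_on V W f"
  shows "\<And>v. v \<in> V \<Longrightarrow> f v \<in> W" "\<And>u v. u \<in> V \<Longrightarrow> v \<in> V \<Longrightarrow> f (u + v) = f u + f v"
    "\<And>c v. v \<in> V \<Longrightarrow> f (sc c v) = sc c (f v)"
  using assms by (auto simp: lin_on_def)

lemma lin_on_0: "lin_on V W f \<Longrightarrow> subsp V \<Longrightarrow> f 0 = 0"
  using subspD(1) unfolding lin_on_def by (metis cf.scale_zero_left)

lemma lin_on_sum:
  assumes "lin_on V W f" "subsp V" "\<And>i. i \<in> A \<Longrightarrow> v i \<in> V"
  shows "f (\<Sum>i\<in>A. v i) = (\<Sum>i\<in>A. f (v i))"
  using assms subspD[OF assms(2)] lin_onD[OF assms(1)] lin_on_0[OF assms(1,2)]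
  by (intro sum_additive_on[where V = V])

lemma lin_on_diff:
  assumes "lin_on V W f" "subsp V" "u \<in> V" "v \<in> V"
  shows "f (u - v) = f u - f v"
  using lin_onD(2)[OF assms(1) subspD(4)[OF assms(2-4)] assms(4)] by simp

lemma lin_on_comp: "lin_on U V f \<Longrightarrow> lin_on V W g \<Longrightarrow> lin_on U W (\<lambda>v. g (f v))"
  by (auto simp: lin_on_def)

lemma lin_on_subset: "lin_on V W f \<Longrightarrow> U \<subseteq> V \<Longrightarrow> lin_on U W f"
  unfolding lin_on_def by blast

lemma lin_on_sum_fun:
  assumes "\<And>a. a \<in> A \<Longrightarrow> lin_on V UNIV (F a)" shows "lin_on V UNIV (\<lambda>v. \<Sum>a\<in>A. F a v)"
  using assms by (simp add: lin_on_def sum.distrib cf.scale_sum_right)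

lemma sum_const_sc: "(\<Sum>g\<in>A. x) = sc (of_nat (card A)) x"
  by (auto simp: fun_arith)

text \<open>The vectors of \<open>V\<close> that \<open>f\<close> sends into \<open>U\<close> form a
  subspace, and it contains \<open>S\<close>. The span is taken in the whole function space, where
  \<open>f\<close> need not be linear.\<close>

lemma lin_on_span:
  assumes "lin_on V W f" "subsp V" "S \<subseteq> V" "v \<in> cf.span S" "cf.subspace U" "f ` S \<subseteq> U"
  shows "f v \<in> U"
proof -
  have "cf.subspace {v \<in> V. f v \<in> U}"
    using lin_on_0[OF assms(1,2)] lin_onD(2,3)[OF assms(1)] assms(2,5)
    unfolding subsp_def cf.subspace_def by auto
  then have "cf.span S \<subseteq> {v \<in> V. f v \<in> U}"
    using assms(3,6) by (intro cf.span_minimal) auto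
  then show ?thesis using assms(4) by blast
qed

lemma lin_fun_0: "lin_fun V \<phi> \<Longrightarrow> subsp V \<Longrightarrow> \<phi> 0 = 0"
  using subspD(1) unfolding lin_fun_def by (metis cf.scale_zero_left mult_zero_left)

lemma lin_fun_sum:
  assumes "lin_fun V \<phi>" "subsp V" "\<And>i. i \<in> A \<Longrightarrow> v i \<in> V"
  shows "\<phi> (\<Sum>i\<in>A. v i) = (\<Sum>i\<in>A. \<phi> (v i))"
  using assms subspD[OF assms(2)] lin_fun_0[OF assms(1,2)]
  by (intro sum_additive_on[where V = V]) (auto simp: lin_fun_def)

section \<open>Finite-dimensional spaces of functions\<close>

lemma fdim_sp_span_finite:
  assumes "fdim_sp V" obtains B where "finite B" "B \<subseteq> V" "V \<subseteq> cf.span B"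
proof -
  obtain k :: nat and bs where b: "\<forall>i<k. bs i \<in> V" "\<forall>v\<in>V. \<exists>a. v = (\<Sum>i<k. sc (a i) (bs i))"
    using assms unfolding fdim_sp_def by blast
  have "v \<in> cf.span (bs ` {..<k})" if v: "v \<in> V" for v
  proof -
    obtain a where "v = (\<Sum>i<k. sc (a i) (bs i))" using b(2) v by blast
    then show ?thesis
      by (simp only:, intro cf.span_sum cf.span_scale[OF cf.span_base]) simp
  qed
  with b show ?thesis by (intro that[of "bs ` {..<k}"]) auto
qed

text \<open>\<open>fdim_sp\<close> wants its spanning vectors inside \<open>V\<close>, while
  \<open>B\<close> need not lie there. A maximal independent subset of \<open>V\<close> is a
  substitute, and it is finite because it lies in the span of \<open>B\<close>.\<close>

lemma fdim_spI:
  assumes "subsp V" "finite B" "V \<subseteq> cf.span B"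
  shows "fdim_sp V"
proof -
  obtain D where D: "D \<subseteq> V" "cf.independent D" "V \<subseteq> cf.span D"
    using cf.maximal_independent_subset by blast
  have fin: "finite D"
    using cf.independent_span_bound[OF assms(2) D(2)] D(1) assms(3) by blast
  obtain h where h: "bij_betw h {0..<card D} D" using ex_bij_betw_nat_finite[OF fin] by blast
  have "\<exists>a. v = (\<Sum>i<card D. sc (a i) (h i))" if v: "v \<in> V" for v
  proof -
    obtain u where "v = (\<Sum>b\<in>D. sc (u b) b)"
      using v D(3) unfolding cf.span_finite[OF fin] by blast
    also have "\<dots> = (\<Sum>i<card D. sc (u (h i)) (h i))"
      using sum.reindex_bij_betw[OF h, of "\<lambda>b. sc (u b) b"] by (simp add: atLeast0LessThan)
    finally show ?thesis by (intro exI[of _ "\<lambda>i. u (h i)"])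
  qed
  moreover have "\<forall>i<card D. h i \<in> V" using bij_betwE[OF h] D(1) by auto
  ultimately show ?thesis unfolding fdim_sp_def by blast
qed

text \<open>One generator \<open>b\<close> raises the dimension by at most one. If points
  \<open>Y\<close> that work for \<open>B\<close> fail for \<open>insert b B\<close>, the functions
  vanishing on \<open>Y\<close> form a line through some \<open>w\<close>, and one further point
  where \<open>w\<close> is nonzero suffices.\<close>

lemma separating_points:
  assumes "finite B"
  shows "\<exists>Y. finite Y \<and> (\<forall>v\<in>cf.span B. (\<forall>y\<in>Y. v y = 0) \<longrightarrow> v = 0)"
  using assms
proof (induction B rule: finite_induct)
  case empty
  show "\<exists>Y. finite Y \<and> (\<forall>v\<in>cf.span {}. (\<forall>y\<in>Y. v y = 0) \<longrightarrow> v = 0)"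
    by (intro exI[of _ "{}"]) simp
next
  case (insert b B)
  then obtain Y where Y: "finite Y" "\<forall>v\<in>cf.span B. (\<forall>y\<in>Y. v y = 0) \<longrightarrow> v = 0" by blast
  show ?case
  proof (cases "\<exists>w\<in>cf.span (insert b B). (\<forall>y\<in>Y. w y = 0) \<and> w \<noteq> 0")
    case True
    then obtain w where w: "w \<in> cf.span (insert b B)" "\<forall>y\<in>Y. w y = 0" "w \<noteq> 0" by blast
    then obtain z where z: "w z \<noteq> 0" by (auto simp: fun_arith)
    obtain \<alpha> where \<alpha>: "w - sc \<alpha> b \<in> cf.span B" using w(1) cf.span_breakdown_eq by blast
    \<comment> \<open>If \<alpha> were 0, \<open>w\<close> would lie in the span of \<open>B\<close>
      and vanish on \<open>Y\<close>, hence be 0.\<close>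
    have "\<alpha> \<noteq> 0" using \<alpha> w Y by auto
    have "v = 0" if v: "v \<in> cf.span (insert b B)" "\<forall>y\<in>insert z Y. v y = 0" for v
    proof -
      obtain \<beta> where \<beta>: "v - sc \<beta> b \<in> cf.span B" using v(1) cf.span_breakdown_eq by blast
      \<comment> \<open>This multiple of \<open>w\<close> cancels the \<open>b\<close>-part of
        \<open>v\<close>; the difference lies in the span of \<open>B\<close> and vanishes on
        \<open>Y\<close>.\<close>
      have "v - sc (\<beta> / \<alpha>) w = (v - sc \<beta> b) - sc (\<beta> / \<alpha>) (w - sc \<alpha> b)"
        using \<open>\<alpha> \<noteq> 0\<close> by (auto simp: fun_arith field_simps)
      also have "\<dots> \<in> cf.span B" using \<alpha> \<beta> by (blast intro: cf.span_diff cf.span_scale)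
      finally have "v - sc (\<beta> / \<alpha>) w = 0" using Y(2) w v by (auto simp: sc_apply minus_apply)
      then have eq: "v = sc (\<beta> / \<alpha>) w" by simp
      then have "\<beta> / \<alpha> * w z = 0" using v by (metis insertI1 sc_apply)
      then have "\<beta> / \<alpha> = 0" using z by (metis mult_eq_0_iff)
      with eq show ?thesis by (metis cf.scale_zero_left)
    qed
    then show ?thesis using Y(1) by (intro exI[of _ "insert z Y"]) auto
  next
    case False
    then show ?thesis using Y by blast
  qed
qed

text \<open>\<open>is_free\<close> asks for representations inside
  \<open>nat \<Rightarrow> complex\<close>. Evaluation at finitely many separating points, numbered
  from 0, is such a coordinate map: linear on all functions and injective on
  \<open>V\<close>.\<close>

lemma nat_coordinates:
  fixes V :: "('y \<Rightarrow> complex) set"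
  assumes "subsp V" "fdim_sp V"
  obtains L :: "('y \<Rightarrow> complex) \<Rightarrow> nat \<Rightarrow> complex" where
    "\<And>u v. L (u + v) = L u + L v" "\<And>c v. L (sc c v) = sc c (L v)" "inj_on L V"
proof -
  obtain B where B: "finite B" "B \<subseteq> V" "V \<subseteq> cf.span B" using fdim_sp_span_finite[OF assms(2)] by blast
  obtain Y where Y: "finite Y" "\<forall>v\<in>cf.span B. (\<forall>y\<in>Y. v y = 0) \<longrightarrow> v = 0"
    using separating_points[OF B(1)] by blast
  obtain h where h: "bij_betw h {0..<card Y} Y" using ex_bij_betw_nat_finite[OF Y(1)] by blast
  define L where "L = (\<lambda>v n. if n < card Y then v (h n) else (0::complex))"
  have "inj_on L V"
  proof (rule inj_onI)
    fix u v assume uv: "u \<in> V" "v \<in> V" "L u = L v"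
    have "(u - v) y = 0" if "y \<in> Y" for y
    proof -
      obtain n where "n < card Y" "h n = y" using h \<open>y \<in> Y\<close> unfolding bij_betw_def by (metis atLeastLessThan_iff imageE)
      then show ?thesis using fun_cong[OF uv(3), of n] by (auto simp: L_def fun_arith)
    qed
    moreover have "u - v \<in> cf.span B" using uv B(3) by (auto intro: cf.span_diff)
    ultimately show "u = v" using Y(2) by auto
  qed
  then show ?thesis by (intro that[of L]) (auto simp: L_def fun_arith)
qed

subsection \<open>Tensor products of function spaces\<close>

text \<open>The object part of \<open>tensor\<close>, stated for arbitrary function spaces so that
  it also covers the tensor products of \<open>Vs i\<close> and \<open>Vs' j\<close>.\<close>

definition tens :: "('a \<Rightarrow> complex) set \<Rightarrow> ('b \<Rightarrow> complex) set \<Rightarrow> ('a \<times> 'b \<Rightarrow> complex) set" where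
  "tens U V = {(\<Sum>i<(k::nat). pt (us i) (vs i)) | k us vs. \<forall>i<k. us i \<in> U \<and> vs i \<in> V}"

definition bilin :: "('a \<Rightarrow> complex) set \<Rightarrow> ('b \<Rightarrow> complex) set
    \<Rightarrow> (('a \<Rightarrow> complex) \<Rightarrow> ('b \<Rightarrow> complex) \<Rightarrow> complex) \<Rightarrow> bool" where
  "bilin U V \<beta> \<longleftrightarrow> (\<forall>u\<in>U. lin_fun V (\<beta> u)) \<and> (\<forall>v\<in>V. lin_fun U (\<lambda>u. \<beta> u v))"

lemma pt_linear [simp]:
  "pt (u + u') v = pt u v + pt u' v" "pt u (v + v') = pt u v + pt u v'"
  "pt (sc a u) v = sc a (pt u v)" "pt u (sc a v) = sc a (pt u v)"
  "pt (u - u') v = pt u v - pt u' v" "pt 0 v = 0" "pt u 0 = 0"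
  by (auto simp: fun_arith algebra_simps)

lemma pt_sum_left: "pt (\<Sum>i\<in>A. u i) v = (\<Sum>i\<in>A. pt (u i) v)"
  by (simp add: fun_arith sum_distrib_right)

lemma pt_sum_right: "pt u (\<Sum>i\<in>A. v i) = (\<Sum>i\<in>A. pt u (v i))"
  by (simp add: fun_arith sum_distrib_left)

lemma bilin_pt:
  assumes "lin_on U U' f" "lin_on V V' g"
  shows "bilin U V (\<lambda>u v. pt (f u) (g v) z)"
  using assms by (cases z) (auto simp: fun_arith bilin_def lin_fun_def lin_on_def algebra_simps)

text \<open>Arbitrary finite index sets replace the initial segments of the definition; a sum of two
  tensors is then indexed by a disjoint union.\<close>

lemma tens_sumI:
  assumes "finite A" "\<And>i. i \<in> A \<Longrightarrow> us i \<in> U" "\<And>i. i \<in> A \<Longrightarrow> vs i \<in> V"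
  shows "(\<Sum>i\<in>A. pt (us i) (vs i)) \<in> tens U V"
proof -
  obtain h where h: "bij_betw h {0..<card A} A" using ex_bij_betw_nat_finite[OF assms(1)] by blast
  have "(\<Sum>i\<in>A. pt (us i) (vs i)) = (\<Sum>i<card A. pt (us (h i)) (vs (h i)))"
    using sum.reindex_bij_betw[OF h, of "\<lambda>i. pt (us i) (vs i)"] by (simp add: atLeast0LessThan)
  moreover have "\<forall>i<card A. us (h i) \<in> U \<and> vs (h i) \<in> V" using bij_betwE[OF h] assms by auto
  ultimately show ?thesis unfolding tens_def
    by (intro CollectI exI[of _ "card A"] exI[of _ "\<lambda>i. us (h i)"] exI[of _ "\<lambda>i. vs (h i)"] conjI)
qed

lemma tensE:
  assumes "t \<in> tens U V"
  obtains k :: nat and us vs where "t = (\<Sum>i<k. pt (us i) (vs i))"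
    "\<And>i. i < k \<Longrightarrow> us i \<in> U" "\<And>i. i < k \<Longrightarrow> vs i \<in> V"
  using assms unfolding tens_def by blast

lemma pt_in_tens: "u \<in> U \<Longrightarrow> v \<in> V \<Longrightarrow> pt u v \<in> tens U V"
  using tens_sumI[of "{()}" "\<lambda>_. u" U "\<lambda>_. v" V] by simp

lemma tens_add:
  assumes "s \<in> tens U V" "t \<in> tens U V" shows "s + t \<in> tens U V"
proof -
  obtain k :: nat and us vs where 1: "s = (\<Sum>i<k. pt (us i) (vs i))"
    "\<And>i. i < k \<Longrightarrow> us i \<in> U" "\<And>i. i < k \<Longrightarrow> vs i \<in> V" by (rule tensE[OF assms(1)]) (rule that)
  obtain l :: nat and us' vs' where 2: "t = (\<Sum>i<l. pt (us' i) (vs' i))"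
    "\<And>i. i < l \<Longrightarrow> us' i \<in> U" "\<And>i. i < l \<Longrightarrow> vs' i \<in> V" by (rule tensE[OF assms(2)]) (rule that)
  have "s + t = (\<Sum>i\<in>{..<k} <+> {..<l}. pt (case_sum us us' i) (case_sum vs vs' i))"
    by (simp add: sum.Plus 1 2)
  also have "\<dots> \<in> tens U V" using 1 2 by (intro tens_sumI) auto
  finally show ?thesis .
qed

text \<open>Scalars need no case of their own, since \<open>pt\<close> absorbs them in a
  factor.\<close>

lemma tens_induct [consumes 1, case_names zero pt add]:
  assumes "t \<in> tens U V" "P 0" "\<And>u v. u \<in> U \<Longrightarrow> v \<in> V \<Longrightarrow> P (pt u v)"
    "\<And>s t. s \<in> tens U V \<Longrightarrow> t \<in> tens U V \<Longrightarrow> P s \<Longrightarrow> P t \<Longrightarrow> P (s + t)"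
  shows "P t"
proof -
  obtain k :: nat and us vs where 1: "t = (\<Sum>i<k. pt (us i) (vs i))"
    "\<And>i. i < k \<Longrightarrow> us i \<in> U" "\<And>i. i < k \<Longrightarrow> vs i \<in> V" by (rule tensE[OF assms(1)]) (rule that)
  have "P (\<Sum>i<l. pt (us i) (vs i))" if "l \<le> k" for l
    using that
  proof (induction l)
    case 0
    show "P (\<Sum>i<0. pt (us i) (vs i))" using assms(2) by simp
  next
    case (Suc l)
    have "P ((\<Sum>i<l. pt (us i) (vs i)) + pt (us l) (vs l))"
      using Suc 1 by (intro assms(3,4) tens_sumI pt_in_tens) auto
    then show "P (\<Sum>i<Suc l. pt (us i) (vs i))" by simp
  qed
  then show ?thesis by (simp add: 1)
qed

lemma subsp_tens: assumes "subsp U" shows "subsp (tens U V)"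
proof -
  have "sc c t \<in> tens U V" if t: "t \<in> tens U V" for c t
  proof -
    obtain k :: nat and us vs where 1: "t = (\<Sum>i<k. pt (us i) (vs i))"
      "\<And>i. i < k \<Longrightarrow> us i \<in> U" "\<And>i. i < k \<Longrightarrow> vs i \<in> V" by (rule tensE[OF t]) (rule that)
    have "sc c t = (\<Sum>i<k. pt (sc c (us i)) (vs i))" by (simp add: 1 cf.scale_sum_right)
    also have "\<dots> \<in> tens U V" using 1 subspD[OF assms] by (intro tens_sumI) auto
    finally show ?thesis .
  qed
  moreover have "0 \<in> tens U V" using tens_sumI[of "{}" _ U _ V] by simp
  ultimately show ?thesis by (auto simp: subsp_def intro: tens_add)
qed

text \<open>Elimination: if \<open>u\<^sub>a\<close> does not vanish at \<open>x\<close>, evaluating the relation there expresses \<open>v\<^sub>a\<close>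
  through the other \<open>v\<^sub>i\<close>, which gives a relation with one term less.\<close>

lemma bilin_sum_eq_0:
  assumes "finite A" "bilin U V \<beta>" "subsp U" "subsp V"
    "\<And>i. i \<in> A \<Longrightarrow> us i \<in> U" "\<And>i. i \<in> A \<Longrightarrow> vs i \<in> V" "(\<Sum>i\<in>A. pt (us i) (vs i)) = 0"
  shows "(\<Sum>i\<in>A. \<beta> (us i) (vs i)) = 0"
  using assms(1,5-)
\<comment> \<open>The family \<open>us\<close> must vary: elimination changes the left factors and
  keeps the right ones.\<close>
proof (induction A arbitrary: us rule: finite_induct)
  case empty
  then show ?case by simp
next
  case (insert a A)
  have rel: "(\<Sum>i\<in>insert a A. pt (us i) (vs i)) = 0" by (rule insert.prems(3))
  have lf1: "lin_fun V (\<beta> u)" if "u \<in> U" for u using assms(2) that by (simp add: bilin_def)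
  have lf2: "lin_fun U (\<lambda>u. \<beta> u v)" if "v \<in> V" for v using assms(2) that by (simp add: bilin_def)
  show ?case
  proof (cases "us a = 0")
    case True
    then have "\<beta> (us a) (vs a) = 0" using lin_fun_0[OF lf2 assms(3)] insert.prems by simp
    moreover have "(\<Sum>i\<in>A. \<beta> (us i) (vs i)) = 0"
      using rel insert.hyps insert.prems(1,2) True by (intro insert.IH) auto
    ultimately show ?thesis using insert.hyps by simp
  next
    case False
    then obtain x where x: "us a x \<noteq> 0" by (auto simp: fun_arith)
    define c where "c i = us i x / us a x" for i
    have va: "vs a y = - (\<Sum>i\<in>A. c i * vs i y)" for y
    proof -
      have "us a x * vs a y + (\<Sum>i\<in>A. us i x * vs i y) = 0"
        using fun_cong[OF rel, of "(x, y)"] insert.hyps by (simp add: fun_arith)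
      then have "us a x * vs a y = - (\<Sum>i\<in>A. us i x * vs i y)" by (simp only: eq_neg_iff_add_eq_0)
      then have "vs a y = - (\<Sum>i\<in>A. us i x * vs i y) / us a x" using x by (metis nonzero_mult_div_cancel_left)
      then show ?thesis by (simp add: c_def sum_divide_distrib)
    qed
    have va': "vs a = (\<Sum>i\<in>A. sc (- c i) (vs i))"
      by (rule ext) (simp add: sum_fun_apply sc_apply sum_negf va del: cf.scale_minus_left)
    \<comment> \<open>The correction terms add up to \<open>pt (us a) (vs a)\<close>, because
      \<open>vs a\<close> is minus the sum of the \<open>sc (c i) (vs i)\<close>; so the shortened
      family satisfies the same relation.\<close>
    have "(\<Sum>i\<in>A. pt (us i - sc (c i) (us a)) (vs i)) = (\<Sum>i\<in>A. pt (us i) (vs i)) + pt (us a) (vs a)"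
    proof (rule ext, clarify)
      fix x' y'
      have "(\<Sum>i\<in>A. (us i x' - c i * us a x') * vs i y')
          = (\<Sum>i\<in>A. us i x' * vs i y') - us a x' * (\<Sum>i\<in>A. c i * vs i y')"
        by (simp add: left_diff_distrib sum_subtractf sum_distrib_left mult.assoc mult.left_commute)
      then show "(\<Sum>i\<in>A. pt (us i - sc (c i) (us a)) (vs i)) (x', y')
          = ((\<Sum>i\<in>A. pt (us i) (vs i)) + pt (us a) (vs a)) (x', y')"
        by (simp add: sum_fun_apply pt_apply minus_apply plus_fun_apply sc_apply va del: pt_linear)
    qed
    also have "\<dots> = 0" using rel insert.hyps by (simp add: add.commute)
    finally have rel': "(\<Sum>i\<in>A. pt (us i - sc (c i) (us a)) (vs i)) = 0" .
    have "(\<Sum>i\<in>A. \<beta> (us i - sc (c i) (us a)) (vs i)) = 0"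
      by (rule insert.IH[OF _ _ rel'])
         (use insert.prems(1,2) in \<open>auto intro!: subspD(3,4)[OF assms(3)]\<close>)
    moreover have "\<beta> (us i - sc (c i) (us a)) (vs i) = \<beta> (us i) (vs i) - c i * \<beta> (us a) (vs i)"
      if "i \<in> A" for i
    proof -
      have eq: "us i - sc (c i) (us a) = us i + sc (- c i) (us a)" by (auto simp: fun_arith)
      have *: "us i \<in> U" "us a \<in> U" "sc (- c i) (us a) \<in> U" "vs i \<in> V"
        using insert.prems(1,2) that by (auto intro!: subspD(3,6)[OF assms(3)])
      have "\<beta> (us i + sc (- c i) (us a)) (vs i) = \<beta> (us i) (vs i) + \<beta> (sc (- c i) (us a)) (vs i)"
        using lf2[OF *(4)] *(1,3) unfolding lin_fun_def by blast
      moreover have "\<beta> (sc (- c i) (us a)) (vs i) = - c i * \<beta> (us a) (vs i)"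
        using lf2[OF *(4)] *(2) unfolding lin_fun_def by blast
      ultimately show ?thesis unfolding eq by simp
    qed
    moreover have "\<beta> (us a) (vs a) = (\<Sum>i\<in>A. - c i * \<beta> (us a) (vs i))"
    proof -
      have ua: "us a \<in> U" and vi: "\<And>i. i \<in> A \<Longrightarrow> vs i \<in> V" using insert.prems(1,2) by blast+
      have "\<beta> (us a) (vs a) = (\<Sum>i\<in>A. \<beta> (us a) (sc (- c i) (vs i)))"
        unfolding va' using vi subspD(3)[OF assms(4)] by (intro lin_fun_sum[OF lf1[OF ua] assms(4)]) blast
      also have "\<dots> = (\<Sum>i\<in>A. - c i * \<beta> (us a) (vs i))"
        using lf1[OF ua] vi unfolding lin_fun_def by (intro sum.cong) blast+
      finally show ?thesis .
    qed
    ultimately show ?thesis using insert.hyps by (simp add: sum_subtractf sum_negf)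
  qed
qed

text \<open>Two decompositions of one tensor become a vanishing sum over the disjoint union, the
  sign going into the left factors of the second. This is what makes every definition by a chosen
  decomposition sound.\<close>

lemma bilin_sum_cong:
  assumes "finite A" "finite A'" "bilin U V \<beta>" "subsp U" "subsp V"
    "\<And>i. i \<in> A \<Longrightarrow> us i \<in> U" "\<And>i. i \<in> A \<Longrightarrow> vs i \<in> V"
    "\<And>i. i \<in> A' \<Longrightarrow> us' i \<in> U" "\<And>i. i \<in> A' \<Longrightarrow> vs' i \<in> V"
    "(\<Sum>i\<in>A. pt (us i) (vs i)) = (\<Sum>i\<in>A'. pt (us' i) (vs' i))"
  shows "(\<Sum>i\<in>A. \<beta> (us i) (vs i)) = (\<Sum>i\<in>A'. \<beta> (us' i) (vs' i))"
proof -
  define us2 where "us2 = case_sum us (\<lambda>i. sc (-1) (us' i))"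
  define vs2 where "vs2 = case_sum vs vs'"
  have "(\<Sum>i\<in>A <+> A'. pt (us2 i) (vs2 i)) = 0"
    using assms(1,2,10)
    by (simp add: sum.Plus us2_def vs2_def) (auto simp: fun_arith sum_negf)
  then have "(\<Sum>i\<in>A <+> A'. \<beta> (us2 i) (vs2 i)) = 0"
    using assms(1,2,6-9) subspD[OF assms(4)]
    by (intro bilin_sum_eq_0[OF _ assms(3-5)]) (auto simp: us2_def vs2_def)
  moreover have "\<beta> (sc (- 1) (us' i)) (vs' i) = - \<beta> (us' i) (vs' i)" if "i \<in> A'" for i
  proof -
    have "lin_fun U (\<lambda>u. \<beta> u (vs' i))" using assms(3,9) that by (simp add: bilin_def)
    then have "\<beta> (sc (- 1) (us' i)) (vs' i) = - 1 * \<beta> (us' i) (vs' i)"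
      using assms(8)[OF that] by (simp only: lin_fun_def)
    then show ?thesis by simp
  qed
  ultimately show ?thesis
    using assms(1,2) by (simp add: sum.Plus us2_def vs2_def sum_negf)
qed

section \<open>Linear extension of bilinear maps to the tensor product\<close>

definition tlift :: "('a \<Rightarrow> complex) set \<Rightarrow> ('b \<Rightarrow> complex) set
    \<Rightarrow> (('a \<Rightarrow> complex) \<Rightarrow> ('b \<Rightarrow> complex) \<Rightarrow> complex) \<Rightarrow> ('a \<times> 'b \<Rightarrow> complex) \<Rightarrow> complex" where
  "tlift U V \<beta> t = (SOME z. \<exists>k us vs. (\<forall>i<(k::nat). us i \<in> U \<and> vs i \<in> V) \<and>
      t = (\<Sum>i<k. pt (us i) (vs i)) \<and> z = (\<Sum>i<k. \<beta> (us i) (vs i)))"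

lemma tlift_sum:
  assumes "finite A" "bilin U V \<beta>" "subsp U" "subsp V"
    "\<And>i. i \<in> A \<Longrightarrow> us i \<in> U" "\<And>i. i \<in> A \<Longrightarrow> vs i \<in> V"
  shows "tlift U V \<beta> (\<Sum>i\<in>A. pt (us i) (vs i)) = (\<Sum>i\<in>A. \<beta> (us i) (vs i))"
proof -
  have t: "(\<Sum>i\<in>A. pt (us i) (vs i)) \<in> tens U V" using assms by (intro tens_sumI) auto
  obtain k :: nat and us' vs' where 1: "(\<Sum>i\<in>A. pt (us i) (vs i)) = (\<Sum>i<k. pt (us' i) (vs' i))"
    "\<And>i. i < k \<Longrightarrow> us' i \<in> U" "\<And>i. i < k \<Longrightarrow> vs' i \<in> V" by (rule tensE[OF t]) (rule that)
  show ?thesis unfolding tlift_def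
  proof (rule someI2)
    show "\<exists>l us'' vs''. (\<forall>i<(l::nat). us'' i \<in> U \<and> vs'' i \<in> V) \<and>
      (\<Sum>i\<in>A. pt (us i) (vs i)) = (\<Sum>i<l. pt (us'' i) (vs'' i)) \<and>
      (\<Sum>i<k. \<beta> (us' i) (vs' i)) = (\<Sum>i<l. \<beta> (us'' i) (vs'' i))"
      using 1(2,3) by (intro exI[of _ k] exI[of _ us'] exI[of _ vs'] conjI 1(1)) simp_all
  next
    fix z assume "\<exists>l us'' vs''. (\<forall>i<(l::nat). us'' i \<in> U \<and> vs'' i \<in> V) \<and>
      (\<Sum>i\<in>A. pt (us i) (vs i)) = (\<Sum>i<l. pt (us'' i) (vs'' i)) \<and>
      z = (\<Sum>i<l. \<beta> (us'' i) (vs'' i))"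
    then obtain l :: nat and us'' vs'' where 2: "\<forall>i<l. us'' i \<in> U \<and> vs'' i \<in> V"
      "(\<Sum>i\<in>A. pt (us i) (vs i)) = (\<Sum>i<l. pt (us'' i) (vs'' i))"
      "z = (\<Sum>i<l. \<beta> (us'' i) (vs'' i))" by (elim exE conjE) (rule that)
    show "z = (\<Sum>i\<in>A. \<beta> (us i) (vs i))"
      unfolding 2(3)
      by (rule bilin_sum_cong[OF _ assms(1) assms(2-4) _ _ _ _ 2(2)[symmetric]])
         (simp_all add: 2(1) assms(5,6))
  qed
qed

lemma tlift_pt:
  assumes "bilin U V \<beta>" "subsp U" "subsp V" "u \<in> U" "v \<in> V"
  shows "tlift U V \<beta> (pt u v) = \<beta> u v"
  using tlift_sum[of "{()}" U V \<beta> "\<lambda>_. u" "\<lambda>_. v"] assms by simp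

lemma lin_fun_tlift:
  assumes "bilin U V \<beta>" "subsp U" "subsp V"
  shows "lin_fun (tens U V) (tlift U V \<beta>)"
  unfolding lin_fun_def
proof (intro conjI ballI allI)
  fix s t assume "s \<in> tens U V" "t \<in> tens U V"
  obtain k :: nat and us vs where 1: "s = (\<Sum>i<k. pt (us i) (vs i))"
    "\<And>i. i < k \<Longrightarrow> us i \<in> U" "\<And>i. i < k \<Longrightarrow> vs i \<in> V" by (rule tensE[OF \<open>s \<in> _\<close>]) (rule that)
  obtain l :: nat and us' vs' where 2: "t = (\<Sum>i<l. pt (us' i) (vs' i))"
    "\<And>i. i < l \<Longrightarrow> us' i \<in> U" "\<And>i. i < l \<Longrightarrow> vs' i \<in> V" by (rule tensE[OF \<open>t \<in> _\<close>]) (rule that)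
  have "s + t = (\<Sum>i\<in>{..<k} <+> {..<l}. pt (case_sum us us' i) (case_sum vs vs' i))"
    by (simp add: sum.Plus 1 2)
  then have "tlift U V \<beta> (s + t) = tlift U V \<beta> (\<Sum>i\<in>{..<k} <+> {..<l}. pt (case_sum us us' i) (case_sum vs vs' i))"
    by simp
  also have "\<dots> = (\<Sum>i\<in>{..<k} <+> {..<l}. \<beta> (case_sum us us' i) (case_sum vs vs' i))"
    using 1 2 by (intro tlift_sum[OF _ assms]) auto
  also have "\<dots> = tlift U V \<beta> s + tlift U V \<beta> t"
    unfolding 1(1) 2(1) using 1(2,3) 2(2,3)
    by (subst (1 2) tlift_sum[OF _ assms]) (auto simp: sum.Plus)
  finally show "tlift U V \<beta> (s + t) = tlift U V \<beta> s + tlift U V \<beta> t" .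
next
  fix c s assume "s \<in> tens U V"
  obtain k :: nat and us vs where 1: "s = (\<Sum>i<k. pt (us i) (vs i))"
    "\<And>i. i < k \<Longrightarrow> us i \<in> U" "\<And>i. i < k \<Longrightarrow> vs i \<in> V" by (rule tensE[OF \<open>s \<in> _\<close>]) (rule that)
  have "sc c s = (\<Sum>i<k. pt (sc c (us i)) (vs i))" by (simp add: 1 cf.scale_sum_right)
  then have "tlift U V \<beta> (sc c s) = tlift U V \<beta> (\<Sum>i<k. pt (sc c (us i)) (vs i))" by simp
  also have "\<dots> = (\<Sum>i<k. \<beta> (sc c (us i)) (vs i))"
    using 1 subspD[OF assms(2)] by (intro tlift_sum[OF _ assms]) auto
  also have "\<dots> = c * tlift U V \<beta> s"
    unfolding 1(1) using assms(1) 1(2,3)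
    by (subst tlift_sum[OF _ assms]) (auto simp: sum_distrib_left bilin_def lin_fun_def intro!: sum.cong)
  finally show "tlift U V \<beta> (sc c s) = c * tlift U V \<beta> s" .
qed

text \<open>The vector-valued extension is taken coordinate by coordinate, so that well-definedness
  is only needed for scalar-valued maps. The underlying \<open>tlift\<close> chooses a decomposition
  and carries no information outside \<open>tens U V\<close>.\<close>

definition Tlift :: "('a \<Rightarrow> complex) set \<Rightarrow> ('b \<Rightarrow> complex) set
    \<Rightarrow> (('a \<Rightarrow> complex) \<Rightarrow> ('b \<Rightarrow> complex) \<Rightarrow> ('c \<Rightarrow> complex)) \<Rightarrow> ('a \<times> 'b \<Rightarrow> complex) \<Rightarrow> ('c \<Rightarrow> complex)" where
  "Tlift U V \<beta> t = (\<lambda>x. tlift U V (\<lambda>u v. \<beta> u v x) t)"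

lemma Tlift_pt:
  assumes "\<And>x. bilin U V (\<lambda>u v. \<beta> u v x)" "subsp U" "subsp V" "u \<in> U" "v \<in> V"
  shows "Tlift U V \<beta> (pt u v) = \<beta> u v"
  using tlift_pt[OF assms] by (simp add: Tlift_def)

lemma lin_on_Tlift:
  assumes "\<And>x. bilin U V (\<lambda>u v. \<beta> u v x)" "subsp U" "subsp V"
  shows "lin_on (tens U V) UNIV (Tlift U V \<beta>)"
  using lin_fun_tlift[OF assms] by (auto simp: lin_on_def Tlift_def lin_fun_def fun_arith)

text \<open>For fixed \<open>x\<close> the vectors \<open>v\<close> with \<open>pt x v\<close> in
  the target span form a subspace, and likewise in the left slot; so minimality of the span is used
  once in each slot.\<close>

lemma span_pt:
  assumes "u \<in> cf.span X" "v \<in> cf.span Y"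
  shows "pt u v \<in> cf.span ((\<lambda>(x, y). pt x y) ` (X \<times> Y))" (is "_ \<in> ?S")
proof -
  have 1: "pt x v \<in> ?S" if x: "x \<in> X" for x
  proof -
    have "cf.subspace {v. pt x v \<in> ?S}"
      by (simp add: cf.subspace_def cf.span_add cf.span_scale cf.span_zero)
    then have "cf.span Y \<subseteq> {v. pt x v \<in> ?S}"
      using x by (intro cf.span_minimal) (auto intro!: cf.span_base)
    then show ?thesis using assms(2) by blast
  qed
  have "cf.subspace {u. pt u v \<in> ?S}"
    by (simp add: cf.subspace_def cf.span_add cf.span_scale cf.span_zero)
  then have "cf.span X \<subseteq> {u. pt u v \<in> ?S}"
    using 1 by (intro cf.span_minimal) auto
  then show ?thesis using assms(1) by blast
qed

lemma lin_on_tens_eq: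
  assumes F: "lin_on (tens U V) W F" and F': "lin_on (tens U V) W' F'" and U: "subsp U"
    and eq: "\<And>u v. u \<in> U \<Longrightarrow> v \<in> V \<Longrightarrow> F (pt u v) = F' (pt u v)" and t: "t \<in> tens U V"
  shows "F t = F' t"
  using t
proof (induction rule: tens_induct)
  case zero
  show "F 0 = F' 0" using lin_on_0[OF F subsp_tens[OF U]] lin_on_0[OF F' subsp_tens[OF U]] by simp
next
  case (pt u v)
  then show "F (pt u v) = F' (pt u v)" by (rule eq)
next
  case (add s t)
  show "F (s + t) = F' (s + t)" using lin_onD(2)[OF F add(1,2)] lin_onD(2)[OF F' add(1,2)] add(3,4) by simp
qed

lemma lin_on_tens_range:
  assumes F: "lin_on (tens U V) UNIV F" and U: "subsp U" and W: "subsp W"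
    and mem: "\<And>u v. u \<in> U \<Longrightarrow> v \<in> V \<Longrightarrow> F (pt u v) \<in> W"
  shows "lin_on (tens U V) W F"
proof -
  have "F t \<in> W" if "t \<in> tens U V" for t
    using that
  proof (induction rule: tens_induct)
    case zero
    show "F 0 \<in> W" using lin_on_0[OF F subsp_tens[OF U]] subspD(1)[OF W] by simp
  next
    case (pt u v)
    then show "F (pt u v) \<in> W" by (rule mem)
  next
    case (add s t)
    show "F (s + t) \<in> W" using lin_onD(2)[OF F add(1,2)] subspD(2)[OF W add(3,4)] by simp
  qed
  then show ?thesis using F by (simp add: lin_on_def)
qed

section \<open>Categories of FI type\<close>

locale FI_category =
  fixes C :: "('o, 'm) cat"
  assumes FI: "FI_type C"
begin

abbreviation cmpC (infixl "\<bullet>" 70) where "g \<bullet> f \<equiv> cmp C g f"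

section \<open>Axioms in rule form, inverses and changes of variables\<close>

lemmas FI_cond = FI[unfolded FI_type_def]
lemmas cat_cond = FI_cond[THEN conjunct1, unfolded is_cat_def]

lemma Hom_Ob:
  assumes "f \<in> Hom C c d" shows "c \<in> Ob C" "d \<in> Ob C"
  using assms cat_cond[THEN conjunct1] by blast+

lemma Hom_disjoint: "f \<in> Hom C c d \<Longrightarrow> f \<in> Hom C c' d' \<Longrightarrow> c = c' \<and> d = d'"
  using cat_cond[THEN conjunct2, THEN conjunct1] by blast

lemma id_Hom: "c \<in> Ob C \<Longrightarrow> idm C c \<in> Hom C c c"
  using cat_cond[THEN conjunct2, THEN conjunct2, THEN conjunct1] by blast

lemma cmp_Hom: "f \<in> Hom C c d \<Longrightarrow> g \<in> Hom C d e \<Longrightarrow> g \<bullet> f \<in> Hom C c e"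
  using cat_cond[THEN conjunct2, THEN conjunct2, THEN conjunct2, THEN conjunct1] by blast

lemma cmp_assoc:
  "f \<in> Hom C c d \<Longrightarrow> g \<in> Hom C d e \<Longrightarrow> h \<in> Hom C e k \<Longrightarrow> h \<bullet> (g \<bullet> f) = h \<bullet> g \<bullet> f"
  using cat_cond[THEN conjunct2, THEN conjunct2, THEN conjunct2, THEN conjunct2, THEN conjunct1] by blast

lemma cmp_id:
  assumes "f \<in> Hom C c d" shows "f \<bullet> idm C c = f" "idm C d \<bullet> f = f"
  using assms cat_cond[THEN conjunct2, THEN conjunct2, THEN conjunct2, THEN conjunct2, THEN conjunct2] by blast+

lemma finite_Hom: "finite (Hom C c d)"
proof (cases "Hom C c d = {}")
  case False
  then show ?thesis using Hom_Ob FI_cond[THEN conjunct2, THEN conjunct1] by blast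
qed simp

lemma mono: "f \<in> Hom C c d \<Longrightarrow> g \<in> Hom C e c \<Longrightarrow> h \<in> Hom C e c \<Longrightarrow> f \<bullet> g = f \<bullet> h \<Longrightarrow> g = h"
  using FI_cond[THEN conjunct2, THEN conjunct2, THEN conjunct1] Hom_Ob(1) unfolding mono_mor_def by blast

lemma endo_iso: "f \<in> Hom C d d \<Longrightarrow> iso_mor C d d f"
  using FI_cond[THEN conjunct2, THEN conjunct2, THEN conjunct2, THEN conjunct1] by blast

text \<open>Every endomorphism is an isomorphism; from here on G_c is written
  \<open>Hom C c c\<close>.\<close>

lemma Aut_eq: "Aut C c = Hom C c c"
  using endo_iso by (auto simp: Aut_def iso_mor_def)

lemma transitive: "f \<in> Hom C c d \<Longrightarrow> f' \<in> Hom C c d \<Longrightarrow> \<exists>g\<in>Hom C d d. g \<bullet> f = f'"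
  using FI_cond[THEN conjunct2, THEN conjunct2, THEN conjunct2, THEN conjunct2, THEN conjunct1] unfolding Aut_eq by blast

lemma finite_iso_classes_below:
  "d \<in> Ob C \<Longrightarrow> \<exists>S. finite S \<and> S \<subseteq> Ob C \<and>
      (\<forall>c\<in>Ob C. Hom C c d \<noteq> {} \<longrightarrow> (\<exists>s\<in>S. \<exists>f. iso_mor C c s f))"
  using FI_cond[THEN conjunct2, THEN conjunct2, THEN conjunct2, THEN conjunct2, THEN conjunct2, THEN conjunct1] by blast

lemma pullback_ex:
  "g1 \<in> Hom C c1 d \<Longrightarrow> g2 \<in> Hom C c2 d \<Longrightarrow> \<exists>p f1 f2. is_pullback C d c1 c2 g1 g2 p f1 f2"
  using FI_cond[THEN conjunct2, THEN conjunct2, THEN conjunct2, THEN conjunct2, THEN conjunct2, THEN conjunct2, THEN conjunct1] by blast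

lemma weak_pushout_ex:
  "f1 \<in> Hom C p c1 \<Longrightarrow> f2 \<in> Hom C p c2 \<Longrightarrow> \<exists>d g1 g2. weak_pushout C p c1 c2 f1 f2 d g1 g2"
  using FI_cond[THEN conjunct2, THEN conjunct2, THEN conjunct2, THEN conjunct2, THEN conjunct2, THEN conjunct2, THEN conjunct2] by blast

lemma inv_mor:
  assumes "g \<in> Hom C c c"
  shows "inv_mor C c g \<in> Hom C c c" "inv_mor C c g \<bullet> g = idm C c" "g \<bullet> inv_mor C c g = idm C c"
proof -
  obtain h where h: "h \<in> Hom C c c" "h \<bullet> g = idm C c" "g \<bullet> h = idm C c"
    using endo_iso[OF assms] unfolding iso_mor_def by blast
  have "inv_mor C c g = h" unfolding inv_mor_def
  proof (rule the_equality)
    \<comment> \<open>A left inverse of an element with a two-sided inverse \<open>h\<close> equals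
      \<open>h\<close>, which gives the uniqueness behind \<open>THE\<close>.\<close>
    fix k assume k: "k \<in> Hom C c c \<and> k \<bullet> g = idm C c"
    have "k = k \<bullet> (g \<bullet> h)" using k h cmp_id by auto
    also have "\<dots> = k \<bullet> g \<bullet> h" using cmp_assoc[OF h(1) assms] k by blast
    also have "\<dots> = h" using k h cmp_id by auto
    finally show "k = h" .
  qed (use h in auto)
  with h show "inv_mor C c g \<in> Hom C c c" "inv_mor C c g \<bullet> g = idm C c" "g \<bullet> inv_mor C c g = idm C c"
    by auto
qed

lemma inv_mor_cancel:
  assumes "g \<in> Hom C c c"
  shows "f \<in> Hom C c d \<Longrightarrow> f \<bullet> g \<bullet> inv_mor C c g = f"
    "f \<in> Hom C c d \<Longrightarrow> f \<bullet> inv_mor C c g \<bullet> g = f"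
    "f \<in> Hom C b c \<Longrightarrow> inv_mor C c g \<bullet> (g \<bullet> f) = f"
    "f \<in> Hom C b c \<Longrightarrow> g \<bullet> (inv_mor C c g \<bullet> f) = f"
  using cmp_assoc[OF inv_mor(1)[OF assms] assms, of f d] cmp_assoc[OF assms inv_mor(1)[OF assms], of f d]
    cmp_assoc[OF _ assms inv_mor(1)[OF assms], of f b] cmp_assoc[OF _ inv_mor(1)[OF assms] assms, of f b]
    inv_mor(2,3)[OF assms] cmp_id[of f]
  by simp_all

text \<open>This bijection and the next are the changes of variables in all averaging arguments over
  G_c.\<close>

lemma bij_precomp:
  assumes "g \<in> Hom C c c" shows "bij_betw (\<lambda>f. f \<bullet> g) (Hom C c d) (Hom C c d)"
  using inv_mor[OF assms] inv_mor_cancel[OF assms] assms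
  by (intro bij_betw_byWitness[where f' = "\<lambda>f. f \<bullet> inv_mor C c g"]) (auto intro: cmp_Hom)

lemma bij_postcomp:
  assumes "g \<in> Hom C c c" shows "bij_betw (\<lambda>f. g \<bullet> f) (Hom C b c) (Hom C b c)"
  using inv_mor[OF assms] inv_mor_cancel[OF assms] assms
  by (intro bij_betw_byWitness[where f' = "\<lambda>f. inv_mor C c g \<bullet> f"]) (auto intro: cmp_Hom)

lemma card_Aut: "c \<in> Ob C \<Longrightarrow> card (Hom C c c) \<noteq> 0"
  using id_Hom finite_Hom by (metis card_0_eq empty_iff)

subsection \<open>Pullback squares and minimal pairs\<close>

lemma pullbackD:
  assumes "is_pullback C d a b f g p f1 f2"
  shows "f \<in> Hom C a d" "g \<in> Hom C b d" "f1 \<in> Hom C p a" "f2 \<in> Hom C p b" "f \<bullet> f1 = g \<bullet> f2"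
    "\<And>q h1 h2. h1 \<in> Hom C q a \<Longrightarrow> h2 \<in> Hom C q b \<Longrightarrow> f \<bullet> h1 = g \<bullet> h2 \<Longrightarrow>
        \<exists>h\<in>Hom C q p. f1 \<bullet> h = h1 \<and> f2 \<bullet> h = h2"
  using assms Hom_Ob unfolding is_pullback_def by blast+

text \<open>Uniqueness of the mediating morphism is automatic, as \<open>f1\<close> is mono.\<close>

lemma pullbackI:
  assumes "f \<in> Hom C a d" "g \<in> Hom C b d" "f1 \<in> Hom C p a" "f2 \<in> Hom C p b" "f \<bullet> f1 = g \<bullet> f2"
    "\<And>q h1 h2. h1 \<in> Hom C q a \<Longrightarrow> h2 \<in> Hom C q b \<Longrightarrow> f \<bullet> h1 = g \<bullet> h2 \<Longrightarrow>
        \<exists>h\<in>Hom C q p. f1 \<bullet> h = h1 \<and> f2 \<bullet> h = h2"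
  shows "is_pullback C d a b f g p f1 f2"
  unfolding is_pullback_def
proof (intro conjI ballI impI assms(1-5))
  fix q h1 h2
  assume h: "q \<in> Ob C" "h1 \<in> Hom C q a" "h2 \<in> Hom C q b" "f \<bullet> h1 = g \<bullet> h2"
  show "\<exists>!h. h \<in> Hom C q p \<and> f1 \<bullet> h = h1 \<and> f2 \<bullet> h = h2"
    using assms(6)[OF h(2-4)] mono[OF assms(3)] by metis
qed

text \<open>Since \<open>h\<close> is mono, two morphisms agree after composition with
  \<open>h\<close> exactly if they agreed before, so both squares have the same cones.\<close>

lemma pullback_postcomp_iff:
  assumes "f \<in> Hom C a w" "g \<in> Hom C b w" "h \<in> Hom C w d"
  shows "is_pullback C d a b (h \<bullet> f) (h \<bullet> g) p f1 f2 \<longleftrightarrow> is_pullback C w a b f g p f1 f2"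
proof -
  have *: "h \<bullet> f \<bullet> k1 = h \<bullet> g \<bullet> k2 \<longleftrightarrow> f \<bullet> k1 = g \<bullet> k2" if "k1 \<in> Hom C q a" "k2 \<in> Hom C q b" for q k1 k2
  proof -
    have "h \<bullet> f \<bullet> k1 = h \<bullet> (f \<bullet> k1)" "h \<bullet> g \<bullet> k2 = h \<bullet> (g \<bullet> k2)"
      using cmp_assoc[OF that(1) assms(1,3)] cmp_assoc[OF that(2) assms(2,3)] by simp_all
    then show ?thesis using mono[OF assms(3) cmp_Hom[OF that(1) assms(1)] cmp_Hom[OF that(2) assms(2)]]
      by metis
  qed
  show ?thesis
  proof
    assume P: "is_pullback C d a b (h \<bullet> f) (h \<bullet> g) p f1 f2"
    note D = pullbackD[OF P]
    show "is_pullback C w a b f g p f1 f2"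
    proof (rule pullbackI[OF assms(1,2) D(3,4)])
      show "f \<bullet> f1 = g \<bullet> f2" using D(5) *[OF D(3,4)] by simp
      fix q k1 k2 assume k: "k1 \<in> Hom C q a" "k2 \<in> Hom C q b" "f \<bullet> k1 = g \<bullet> k2"
      show "\<exists>h\<in>Hom C q p. f1 \<bullet> h = k1 \<and> f2 \<bullet> h = k2"
        by (rule D(6)[OF k(1,2)]) (use *[OF k(1,2)] k(3) in simp)
    qed
  next
    assume P: "is_pullback C w a b f g p f1 f2"
    note D = pullbackD[OF P]
    show "is_pullback C d a b (h \<bullet> f) (h \<bullet> g) p f1 f2"
    proof (rule pullbackI[OF cmp_Hom[OF assms(1,3)] cmp_Hom[OF assms(2,3)] D(3,4)])
      show "h \<bullet> f \<bullet> f1 = h \<bullet> g \<bullet> f2" using D(5) *[OF D(3,4)] by simp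
      fix q k1 k2 assume k: "k1 \<in> Hom C q a" "k2 \<in> Hom C q b" "h \<bullet> f \<bullet> k1 = h \<bullet> g \<bullet> k2"
      show "\<exists>h\<in>Hom C q p. f1 \<bullet> h = k1 \<and> f2 \<bullet> h = k2"
        by (rule D(6)[OF k(1,2)]) (use *[OF k(1,2)] k(3) in simp)
    qed
  qed
qed

lemma weak_pushoutD:
  assumes "weak_pushout C p a b f1 f2 w f g"
  shows "is_pullback C w a b f g p f1 f2"
    "\<And>z h1 h2. is_pullback C z a b h1 h2 p f1 f2 \<Longrightarrow> \<exists>!h. h \<in> Hom C w z \<and> h \<bullet> f = h1 \<and> h \<bullet> g = h2"
proof -
  show "is_pullback C w a b f g p f1 f2" using assms unfolding weak_pushout_def by (rule conjunct1)
  fix z h1 h2 assume P: "is_pullback C z a b h1 h2 p f1 f2"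
  note D = pullbackD(1,2)[OF P]
  show "\<exists>!h. h \<in> Hom C w z \<and> h \<bullet> f = h1 \<and> h \<bullet> g = h2"
    using assms[unfolded weak_pushout_def, THEN conjunct2, rule_format, OF Hom_Ob(2)[OF D(1)] D P] .
qed

text \<open>Minimal pairs are the jointly covering ones: in the category of finite sets and injections,
  they are the pairs of injections whose images cover \<open>w\<close>.\<close>

definition minpair :: "'o \<Rightarrow> 'o \<Rightarrow> 'o \<Rightarrow> 'm \<Rightarrow> 'm \<Rightarrow> bool" where
  "minpair a b w f g \<longleftrightarrow> (\<exists>p f1 f2. weak_pushout C p a b f1 f2 w f g)"

lemma minpair_Hom:
  assumes "minpair a b w f g" shows "f \<in> Hom C a w" "g \<in> Hom C b w"
  using assms pullbackD(1,2)[OF weak_pushoutD(1)] unfolding minpair_def by blast+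

text \<open>Form the pullback of the pair and the weak push-out of the resulting span: the original
  square is a pullback square over that span, hence the push-out maps to \<open>d\<close>.\<close>

lemma minpair_factor:
  assumes "f \<in> Hom C a d" "g \<in> Hom C b d"
  obtains w f0 g0 h where "minpair a b w f0 g0" "h \<in> Hom C w d" "f = h \<bullet> f0" "g = h \<bullet> g0"
proof -
  obtain p f1 f2 where P: "is_pullback C d a b f g p f1 f2" using pullback_ex[OF assms] by blast
  obtain w f0 g0 where W: "weak_pushout C p a b f1 f2 w f0 g0"
    using weak_pushout_ex pullbackD[OF P] by blast
  obtain h where "h \<in> Hom C w d" "h \<bullet> f0 = f" "h \<bullet> g0 = g" using weak_pushoutD(2)[OF W P] by blast
  moreover have "minpair a b w f0 g0" using W unfolding minpair_def by blast
  ultimately show ?thesis using that by blast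
qed

text \<open>Seen in the common target \<open>d\<close>, both spans are pullbacks of one and the same
  pair. Each of the two squares is therefore admissible for the universal property of the other
  push-out, which yields morphisms in both directions.\<close>

lemma minpair_unique:
  assumes "minpair a b w f g" "minpair a b w' f' g'" "h \<in> Hom C w d" "h' \<in> Hom C w' d"
    "h \<bullet> f = h' \<bullet> f'" "h \<bullet> g = h' \<bullet> g'"
  obtains u where "iso_mor C w' w u" "u \<bullet> f' = f" "u \<bullet> g' = g" "h' = h \<bullet> u"
proof -
  obtain p f1 f2 where W: "weak_pushout C p a b f1 f2 w f g" using assms(1) minpair_def by blast
  obtain p' f1' f2' where W': "weak_pushout C p' a b f1' f2' w' f' g'" using assms(2) minpair_def by blast
  note fg = minpair_Hom[OF assms(1)] minpair_Hom[OF assms(2)]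
  note D = weak_pushoutD[OF W] and D' = weak_pushoutD[OF W']
  have P: "is_pullback C d a b (h \<bullet> f) (h \<bullet> g) p f1 f2"
    using D(1) pullback_postcomp_iff fg assms(3) by blast
  have P': "is_pullback C d a b (h \<bullet> f) (h \<bullet> g) p' f1' f2'"
    unfolding assms(5,6) using D'(1) pullback_postcomp_iff fg assms(4) by blast
  \<comment> \<open>Cancelling the mono \<open>h\<close> moves the pullback property from
    \<open>d\<close> down to \<open>w\<close>.\<close>
  have Q: "is_pullback C w a b f g p' f1' f2'" using P' pullback_postcomp_iff fg assms(3) by blast
  have Q': "is_pullback C w' a b f' g' p f1 f2"
    using P unfolding assms(5,6) using pullback_postcomp_iff fg assms(4) by blast
  obtain u where u: "u \<in> Hom C w' w" "u \<bullet> f' = f" "u \<bullet> g' = g" using D'(2)[OF Q] by blast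
  obtain v where v: "v \<in> Hom C w w'" "v \<bullet> f = f'" "v \<bullet> g = g'" using D(2)[OF Q'] by blast
  have "u \<bullet> v \<in> Hom C w w" "v \<bullet> u \<in> Hom C w' w'" using u v cmp_Hom by blast+
  moreover have "u \<bullet> v \<bullet> f = f" "u \<bullet> v \<bullet> g = g" "v \<bullet> u \<bullet> f' = f'" "v \<bullet> u \<bullet> g' = g'"
    using cmp_assoc[OF fg(1) v(1) u(1)] cmp_assoc[OF fg(2) v(1) u(1)]
      cmp_assoc[OF fg(3) u(1) v(1)] cmp_assoc[OF fg(4) u(1) v(1)] u v by simp_all
  moreover have "idm C w \<in> Hom C w w" "idm C w \<bullet> f = f" "idm C w \<bullet> g = g"
    "idm C w' \<in> Hom C w' w'" "idm C w' \<bullet> f' = f'" "idm C w' \<bullet> g' = g'"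
    using cmp_id(2)[OF fg(1)] cmp_id(2)[OF fg(2)] cmp_id(2)[OF fg(3)] cmp_id(2)[OF fg(4)]
      id_Hom[OF Hom_Ob(2)[OF fg(1)]] id_Hom[OF Hom_Ob(2)[OF fg(3)]] by simp_all
  \<comment> \<open>Composite and identity are both mediating morphisms from a push-out square to
    itself.\<close>
  ultimately have "u \<bullet> v = idm C w" "v \<bullet> u = idm C w'" using D(2)[OF D(1)] D'(2)[OF D'(1)] by blast+
  then have "iso_mor C w' w u" using u v unfolding iso_mor_def by blast
  moreover have "h \<bullet> u \<in> Hom C w' d" "h \<bullet> u \<bullet> f' = h \<bullet> f" "h \<bullet> u \<bullet> g' = h \<bullet> g"
    using cmp_assoc[OF fg(3) u(1) assms(3)] cmp_assoc[OF fg(4) u(1) assms(3)] cmp_Hom[OF u(1) assms(3)] u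
    by simp_all
  then have "h' = h \<bullet> u" using D'(2)[OF P'] assms(4) assms(5,6)[symmetric] by blast
  ultimately show ?thesis using that u by blast
qed

lemma minpair_iso:
  assumes "minpair a b w f g" "iso_mor C w w' u"
  shows "minpair a b w' (u \<bullet> f) (u \<bullet> g)"
proof -
  note fg = minpair_Hom[OF assms(1)]
  have uH: "u \<in> Hom C w w'" using assms(2) iso_mor_def by metis
  obtain p f1 f2 where W: "weak_pushout C p a b f1 f2 w f g" using assms(1) minpair_def by blast
  obtain v where v: "v \<in> Hom C w' w" "v \<bullet> u = idm C w" "u \<bullet> v = idm C w'"
    using assms(2) iso_mor_def by metis
  have "weak_pushout C p a b f1 f2 w' (u \<bullet> f) (u \<bullet> g)" unfolding weak_pushout_def
  proof (intro conjI ballI impI)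
    show "is_pullback C w' a b (u \<bullet> f) (u \<bullet> g) p f1 f2"
      using weak_pushoutD(1)[OF W] pullback_postcomp_iff fg uH by blast
    fix z h1 h2 assume "is_pullback C z a b h1 h2 p f1 f2"
    from weak_pushoutD(2)[OF W this] obtain k where
      k: "k \<in> Hom C w z" "k \<bullet> f = h1" "k \<bullet> g = h2"
      and uniq: "\<And>k'. k' \<in> Hom C w z \<Longrightarrow> k' \<bullet> f = h1 \<Longrightarrow> k' \<bullet> g = h2 \<Longrightarrow> k' = k" by metis
    have vu: "v \<bullet> (u \<bullet> f) = f" "v \<bullet> (u \<bullet> g) = g"
      using cmp_assoc[OF fg(1) uH v(1)] cmp_assoc[OF fg(2) uH v(1)] v(2) cmp_id(2)[OF fg(1)] cmp_id(2)[OF fg(2)]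
      by simp_all
    show "\<exists>!h. h \<in> Hom C w' z \<and> h \<bullet> (u \<bullet> f) = h1 \<and> h \<bullet> (u \<bullet> g) = h2"
    proof (rule ex1I[of _ "k \<bullet> v"])
      have "k \<bullet> v \<bullet> (u \<bullet> f) = k \<bullet> (v \<bullet> (u \<bullet> f))" "k \<bullet> v \<bullet> (u \<bullet> g) = k \<bullet> (v \<bullet> (u \<bullet> g))"
        using cmp_assoc[OF cmp_Hom[OF fg(1) uH] v(1) k(1)] cmp_assoc[OF cmp_Hom[OF fg(2) uH] v(1) k(1)] by simp_all
      then show "k \<bullet> v \<in> Hom C w' z \<and> k \<bullet> v \<bullet> (u \<bullet> f) = h1 \<and> k \<bullet> v \<bullet> (u \<bullet> g) = h2"
        using k vu cmp_Hom[OF v(1) k(1)] by simp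
    next
      fix l assume l: "l \<in> Hom C w' z \<and> l \<bullet> (u \<bullet> f) = h1 \<and> l \<bullet> (u \<bullet> g) = h2"
      then have lH: "l \<in> Hom C w' z" by blast
      have "l \<bullet> u = k"
        using l cmp_Hom[OF uH lH] cmp_assoc[OF fg(1) uH lH] cmp_assoc[OF fg(2) uH lH] by (intro uniq) simp_all
      moreover have "l \<bullet> u \<bullet> v = l" using cmp_assoc[OF v(1) uH lH] v(3) cmp_id(1)[OF lH] by simp
      ultimately show "l = k \<bullet> v" by simp
    qed
  qed
  then show ?thesis unfolding minpair_def by blast
qed

text \<open>Cones over the two spans correspond by composing with \<open>i\<close> and its inverse,
  so both spans have the same pullback squares, and a weak push-out refers to nothing else. This
  allows the source of a span to be replaced by a representative of its isomorphism class.\<close>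

lemma weak_pushout_iso_source:
  assumes "weak_pushout C p a b f1 f2 w f g" "iso_mor C s p i"
  shows "weak_pushout C s a b (f1 \<bullet> i) (f2 \<bullet> i) w f g"
proof -
  note D = weak_pushoutD[OF assms(1)]
  note P = pullbackD[OF D(1)]
  obtain j where i: "i \<in> Hom C s p" and j: "j \<in> Hom C p s" "j \<bullet> i = idm C s" "i \<bullet> j = idm C p"
    using assms(2) iso_mor_def by metis
  have fi: "f1 \<bullet> i \<in> Hom C s a" "f2 \<bullet> i \<in> Hom C s b" using P i cmp_Hom by blast+
  have fij: "f1 \<bullet> i \<bullet> j = f1" "f2 \<bullet> i \<bullet> j = f2" 
    using cmp_assoc[OF j(1) i P(3)] cmp_assoc[OF j(1) i P(4)] j(3) cmp_id(1)[OF P(3)] cmp_id(1)[OF P(4)] by simp_all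
  have pb: "is_pullback C z a b h1 h2 s (f1 \<bullet> i) (f2 \<bullet> i) \<longleftrightarrow> is_pullback C z a b h1 h2 p f1 f2" for z h1 h2
  proof
    assume A: "is_pullback C z a b h1 h2 s (f1 \<bullet> i) (f2 \<bullet> i)"
    note A = pullbackD[OF A]
    show "is_pullback C z a b h1 h2 p f1 f2"
    proof (rule pullbackI[OF A(1,2) P(3,4)])
      have "h1 \<bullet> f1 = h1 \<bullet> (f1 \<bullet> i) \<bullet> j" "h2 \<bullet> f2 = h2 \<bullet> (f2 \<bullet> i) \<bullet> j"
        using cmp_assoc[OF j(1) A(3) A(1)] cmp_assoc[OF j(1) A(4) A(2)] fij by simp_all
      then show "h1 \<bullet> f1 = h2 \<bullet> f2" using A(5) by simp
      fix q k1 k2 assume "k1 \<in> Hom C q a" "k2 \<in> Hom C q b" "h1 \<bullet> k1 = h2 \<bullet> k2"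
      from A(6)[OF this] obtain k where k: "k \<in> Hom C q s" "f1 \<bullet> i \<bullet> k = k1" "f2 \<bullet> i \<bullet> k = k2" by blast
      then have "i \<bullet> k \<in> Hom C q p" "f1 \<bullet> (i \<bullet> k) = k1" "f2 \<bullet> (i \<bullet> k) = k2"
        using cmp_Hom[OF k(1) i] cmp_assoc[OF k(1) i P(3)] cmp_assoc[OF k(1) i P(4)] by simp_all
      then show "\<exists>h\<in>Hom C q p. f1 \<bullet> h = k1 \<and> f2 \<bullet> h = k2" by blast
    qed
  next
    assume A: "is_pullback C z a b h1 h2 p f1 f2"
    note A = pullbackD[OF A]
    show "is_pullback C z a b h1 h2 s (f1 \<bullet> i) (f2 \<bullet> i)"
    proof (rule pullbackI[OF A(1,2) fi])
      show "h1 \<bullet> (f1 \<bullet> i) = h2 \<bullet> (f2 \<bullet> i)"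
        using cmp_assoc[OF i A(3) A(1)] cmp_assoc[OF i A(4) A(2)] A(5) by simp
      fix q k1 k2 assume "k1 \<in> Hom C q a" "k2 \<in> Hom C q b" "h1 \<bullet> k1 = h2 \<bullet> k2"
      from A(6)[OF this] obtain k where k: "k \<in> Hom C q p" "f1 \<bullet> k = k1" "f2 \<bullet> k = k2" by blast
      have "f1 \<bullet> i \<bullet> (j \<bullet> k) = f1 \<bullet> i \<bullet> j \<bullet> k" "f2 \<bullet> i \<bullet> (j \<bullet> k) = f2 \<bullet> i \<bullet> j \<bullet> k"
        using cmp_assoc[OF k(1) j(1) fi(1)] cmp_assoc[OF k(1) j(1) fi(2)] by simp_all
      then show "\<exists>h\<in>Hom C q s. f1 \<bullet> i \<bullet> h = k1 \<and> f2 \<bullet> i \<bullet> h = k2"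
        using fij k cmp_Hom[OF k(1) j(1)] by (intro bexI[of _ "j \<bullet> k"]) simp_all
    qed
  qed
  show ?thesis using assms(1) unfolding weak_pushout_def pb .
qed

lemma iso_mor_id: "c \<in> Ob C \<Longrightarrow> iso_mor C c c (idm C c)"
  using endo_iso id_Hom by blast

lemma iso_mor_sym: "iso_mor C c d f \<Longrightarrow> \<exists>g. iso_mor C d c g"
  unfolding iso_mor_def by metis

lemma iso_mor_trans:
  assumes "iso_mor C c d f" "iso_mor C d e g" shows "iso_mor C c e (g \<bullet> f)"
proof -
  obtain f' where f: "f \<in> Hom C c d" "f' \<in> Hom C d c" "f' \<bullet> f = idm C c" "f \<bullet> f' = idm C d"
    using assms(1) iso_mor_def by metis
  obtain g' where g: "g \<in> Hom C d e" "g' \<in> Hom C e d" "g' \<bullet> g = idm C d" "g \<bullet> g' = idm C e"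
    using assms(2) iso_mor_def by metis
  have "f' \<bullet> g' \<bullet> (g \<bullet> f) = f' \<bullet> (g' \<bullet> (g \<bullet> f))"
    using cmp_assoc[OF cmp_Hom[OF f(1) g(1)] g(2) f(2)] by simp
  also have "\<dots> = idm C c" using cmp_assoc[OF f(1) g(1,2)] g(3) cmp_id(2)[OF f(1)] f(3) by simp
  finally have 1: "f' \<bullet> g' \<bullet> (g \<bullet> f) = idm C c" .
  have "g \<bullet> f \<bullet> (f' \<bullet> g') = g \<bullet> (f \<bullet> (f' \<bullet> g'))"
    using cmp_assoc[OF cmp_Hom[OF g(2) f(2)] f(1) g(1)] by simp
  also have "\<dots> = idm C e" using cmp_assoc[OF g(2) f(2,1)] f(4) cmp_id(2)[OF g(2)] g(4) by simp
  finally show ?thesis using 1 f g cmp_Hom unfolding iso_mor_def by blast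
qed

text \<open>The source \<open>p\<close> of the span maps to \<open>a\<close>, which leaves finitely
  many \<open>p\<close> up to isomorphism. Each is the source of finitely many spans to
  \<open>a\<close> and \<open>b\<close>, and a span determines its weak push-out up to
  isomorphism.\<close>

lemma finite_minpair_targets:
  assumes "a \<in> Ob C"
  shows "\<exists>S. finite S \<and> S \<subseteq> Ob C \<and> (\<forall>w f g. minpair a b w f g \<longrightarrow> (\<exists>s\<in>S. \<exists>u. iso_mor C w s u))"
proof -
  obtain P where P: "finite P" "P \<subseteq> Ob C"
    "\<forall>c\<in>Ob C. Hom C c a \<noteq> {} \<longrightarrow> (\<exists>s\<in>P. \<exists>f. iso_mor C c s f)"
    using finite_iso_classes_below[OF assms] by blast
  \<comment> \<open>One weak push-out is chosen for each span whose source is a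
    representative.\<close>
  define wp where "wp = (\<lambda>(s, f1, f2). SOME w. \<exists>f g. weak_pushout C s a b f1 f2 w f g)"
  define S where "S = wp ` (SIGMA s:P. Hom C s a \<times> Hom C s b)"
  have wp: "\<exists>f g. weak_pushout C s a b f1 f2 (wp (s, f1, f2)) f g"
    if "f1 \<in> Hom C s a" "f2 \<in> Hom C s b" for s f1 f2
    unfolding wp_def split using weak_pushout_ex[OF that] by (rule someI_ex)
  have "finite S" unfolding S_def using P(1) finite_Hom by blast
  moreover have "S \<subseteq> Ob C"
  proof
    fix w assume "w \<in> S"
    then obtain s f1 f2 where "w = wp (s, f1, f2)" "f1 \<in> Hom C s a" "f2 \<in> Hom C s b"
      unfolding S_def by blast
    then obtain f g where "weak_pushout C s a b f1 f2 w f g" using wp by metis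
    then show "w \<in> Ob C" using weak_pushoutD(1) pullbackD(1) Hom_Ob(2) by metis
  qed
  moreover have "\<exists>s\<in>S. \<exists>u. iso_mor C w s u" if m: "minpair a b w f g" for w f g
  proof -
    obtain p f1 f2 where W: "weak_pushout C p a b f1 f2 w f g" using m minpair_def by blast
    note D = pullbackD[OF weak_pushoutD(1)[OF W]]
    obtain s i where "s \<in> P" "iso_mor C p s i" using P(3) D(3) Hom_Ob by blast
    then obtain j where s: "s \<in> P" "iso_mor C s p j" using iso_mor_sym by blast
    have W2: "weak_pushout C s a b (f1 \<bullet> j) (f2 \<bullet> j) w f g" by (rule weak_pushout_iso_source[OF W s(2)])
    note D2 = pullbackD[OF weak_pushoutD(1)[OF W2]]
    define w' where "w' = wp (s, f1 \<bullet> j, f2 \<bullet> j)"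
    obtain f' g' where W': "weak_pushout C s a b (f1 \<bullet> j) (f2 \<bullet> j) w' f' g'"
      unfolding w'_def using wp[OF D2(3,4)] by blast
    have "w' \<in> S" unfolding S_def w'_def using s(1) D2(3,4) by blast
    obtain h where h: "h \<in> Hom C w' w" "h \<bullet> f' = f" "h \<bullet> g' = g"
      using weak_pushoutD(2)[OF W' weak_pushoutD(1)[OF W2]] by blast
    have m': "minpair a b w' f' g'" using W' minpair_def by blast
    \<comment> \<open>In \<open>minpair_unique\<close> the common target is \<open>w\<close> itself:
      the pair (f, g) factors through the identity, and through the chosen push-out by
      \<open>h\<close>.\<close>
    have "idm C w \<bullet> f = f" "idm C w \<bullet> g = g" using minpair_Hom[OF m] cmp_id by auto
    then obtain u where "iso_mor C w w' u"
      using minpair_unique[OF m' m h(1) id_Hom[OF Hom_Ob(2)[OF h(1)]]] h(2,3) by metis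
    with \<open>w' \<in> S\<close> show ?thesis by blast
  qed
  ultimately show ?thesis by blast
qed

text \<open>Let the twisted pair factor through a minimal pair by \<open>h\<close> into
  \<open>w\<close>. Undoing the twist shows that (f, g) factors through \<open>h\<close> too, and
  minimality of (f, g) forces \<open>h\<close> to be an isomorphism.\<close>

lemma minpair_precomp:
  assumes "minpair a b w f g" "s \<in> Hom C a a" "t \<in> Hom C b b"
  shows "minpair a b w (f \<bullet> s) (g \<bullet> t)"
proof -
  obtain w0 f0 g0 h where h: "minpair a b w0 f0 g0" "h \<in> Hom C w0 w" "f \<bullet> s = h \<bullet> f0" "g \<bullet> t = h \<bullet> g0"
    using minpair_factor[OF cmp_Hom[OF assms(2) minpair_Hom(1)[OF assms(1)]] cmp_Hom[OF assms(3) minpair_Hom(2)[OF assms(1)]]]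
    by blast
  let ?s = "inv_mor C a s" and ?t = "inv_mor C b t"
  note fg0 = minpair_Hom[OF h(1)] and st = inv_mor(1)[OF assms(2)] inv_mor(1)[OF assms(3)]
  have "f = h \<bullet> (f0 \<bullet> ?s)" "g = h \<bullet> (g0 \<bullet> ?t)"
    using inv_mor_cancel(1)[OF assms(2) minpair_Hom(1)[OF assms(1)]]
      inv_mor_cancel(1)[OF assms(3) minpair_Hom(2)[OF assms(1)]] h(3,4)
      cmp_assoc[OF st(1) fg0(1) h(2)] cmp_assoc[OF st(2) fg0(2) h(2)] by simp_all
  \<comment> \<open>The untwisted pair in \<open>w0\<close> is not yet known to be minimal, hence a
    second factorisation, through \<open>k\<close>.\<close>
  moreover obtain w1 f1 g1 k where k: "minpair a b w1 f1 g1" "k \<in> Hom C w1 w0"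
    "f0 \<bullet> ?s = k \<bullet> f1" "g0 \<bullet> ?t = k \<bullet> g1"
    using minpair_factor[OF cmp_Hom[OF st(1) fg0(1)] cmp_Hom[OF st(2) fg0(2)]] by blast
  ultimately have e: "idm C w \<bullet> f = h \<bullet> k \<bullet> f1" "idm C w \<bullet> g = h \<bullet> k \<bullet> g1"
    using cmp_assoc[OF minpair_Hom(1)[OF k(1)] k(2) h(2)] cmp_assoc[OF minpair_Hom(2)[OF k(1)] k(2) h(2)]
      cmp_id minpair_Hom[OF assms(1)] by simp_all
  have wO: "w \<in> Ob C" using Hom_Ob(2)[OF h(2)] .
  obtain u where u: "iso_mor C w1 w u" "h \<bullet> k = idm C w \<bullet> u"
    using minpair_unique[OF assms(1) k(1) id_Hom[OF wO] cmp_Hom[OF k(2) h(2)] e] by metis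
  obtain u' where u': "u' \<in> Hom C w w1" "u \<bullet> u' = idm C w" "u \<in> Hom C w1 w" using u(1) iso_mor_def by metis
  have hk: "h \<bullet> (k \<bullet> u') = idm C w"
    using cmp_assoc[OF u'(1) k(2) h(2)] u(2) u'(2) cmp_id(2)[OF u'(3)] by simp
  have ku: "k \<bullet> u' \<in> Hom C w w0" using cmp_Hom[OF u'(1) k(2)] .
  \<comment> \<open>A mono with a right inverse is an isomorphism.\<close>
  have "k \<bullet> u' \<bullet> h = idm C w0"
  proof (rule mono[OF h(2) cmp_Hom[OF h(2) ku] id_Hom[OF Hom_Ob(1)[OF h(2)]]])
    show "h \<bullet> (k \<bullet> u' \<bullet> h) = h \<bullet> idm C w0"
      using cmp_assoc[OF h(2) ku h(2)] hk cmp_id[OF h(2)] by simp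
  qed
  then have "iso_mor C w0 w h" using h(2) ku hk unfolding iso_mor_def by blast
  from minpair_iso[OF h(1) this] show ?thesis using h by simp
qed

text \<open>The condition on \<open>d\<close> concerns pairs into \<open>c1\<close> and
  \<open>c2\<close>, so the span is prolonged along \<open>s\<close> and \<open>t\<close>.
  Restricting its push-out \<open>w'\<close> back to \<open>a\<close> and \<open>b\<close> gives a
  pullback square over the original span, as \<open>s\<close> and \<open>t\<close> are mono; hence
  \<open>w\<close> maps to \<open>w'\<close>, and \<open>w'\<close> maps to
  \<open>d\<close>.\<close>

lemma minpair_target_le:
  assumes "minpair a b w f g" "obj_le C a c1" "obj_le C b c2" "geq_sum C c1 c2 d"
  shows "obj_le C w d"
proof -
  obtain p f1 f2 where W: "weak_pushout C p a b f1 f2 w f g" using assms(1) minpair_def by blast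
  note D = pullbackD[OF weak_pushoutD(1)[OF W]]
  obtain s t where st: "s \<in> Hom C a c1" "t \<in> Hom C b c2" using assms(2,3) unfolding obj_le_def by blast
  have sf: "s \<bullet> f1 \<in> Hom C p c1" "t \<bullet> f2 \<in> Hom C p c2" using cmp_Hom D(3,4) st by blast+
  obtain w' f' g' where W': "weak_pushout C p c1 c2 (s \<bullet> f1) (t \<bullet> f2) w' f' g'"
    using weak_pushout_ex[OF sf] by blast
  note D' = pullbackD[OF weak_pushoutD(1)[OF W']]
  have "is_pullback C w' a b (f' \<bullet> s) (g' \<bullet> t) p f1 f2"
  proof (rule pullbackI[OF cmp_Hom[OF st(1) D'(1)] cmp_Hom[OF st(2) D'(2)] D(3,4)])
    show "f' \<bullet> s \<bullet> f1 = g' \<bullet> t \<bullet> f2"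
      using cmp_assoc[OF D(3) st(1) D'(1)] cmp_assoc[OF D(4) st(2) D'(2)] D'(5) by simp
    fix q h1 h2 assume h: "h1 \<in> Hom C q a" "h2 \<in> Hom C q b" "f' \<bullet> s \<bullet> h1 = g' \<bullet> t \<bullet> h2"
    then have "f' \<bullet> (s \<bullet> h1) = g' \<bullet> (t \<bullet> h2)"
      using cmp_assoc[OF h(1) st(1) D'(1)] cmp_assoc[OF h(2) st(2) D'(2)] by simp
    then obtain k where k: "k \<in> Hom C q p" "s \<bullet> f1 \<bullet> k = s \<bullet> h1" "t \<bullet> f2 \<bullet> k = t \<bullet> h2"
      using D'(6)[OF cmp_Hom[OF h(1) st(1)] cmp_Hom[OF h(2) st(2)]] by blast
    have "f1 \<bullet> k = h1" by (rule mono[OF st(1) cmp_Hom[OF k(1) D(3)] h(1)])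
        (use cmp_assoc[OF k(1) D(3) st(1)] k(2) in simp)
    moreover have "f2 \<bullet> k = h2" by (rule mono[OF st(2) cmp_Hom[OF k(1) D(4)] h(2)])
        (use cmp_assoc[OF k(1) D(4) st(2)] k(3) in simp)
    ultimately show "\<exists>h\<in>Hom C q p. f1 \<bullet> h = h1 \<and> f2 \<bullet> h = h2" using k(1) by blast
  qed
  then obtain h where h: "h \<in> Hom C w w'" using weak_pushoutD(2)[OF W] by blast
  have "obj_le C w' d" using assms(4) W' sf Hom_Ob(1)[OF sf(1)] unfolding geq_sum_def by blast
  then show ?thesis using h cmp_Hom unfolding obj_le_def by blast
qed

end

section \<open>Induced modules\<close>

text \<open>As the automorphism groups are finite and the coefficients have characteristic 0, averaging
  identifies the quotient of \<open>Tsp\<close> by \<open>Rel\<close> with the space \<open>Teq\<close> of equivariant families.\<close>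

locale rep_family = FI_category C for C :: "('o, 'm) cat" +
  fixes n :: nat and cs :: "nat \<Rightarrow> 'o" and Vs :: "nat \<Rightarrow> ('y \<Rightarrow> complex) set"
    and \<rho>s :: "nat \<Rightarrow> 'm \<Rightarrow> ('y \<Rightarrow> complex) \<Rightarrow> ('y \<Rightarrow> complex)"
  assumes cs_Ob: "i < n \<Longrightarrow> cs i \<in> Ob C"
    and rep: "i < n \<Longrightarrow> is_rep C (cs i) (Vs i) (\<rho>s i)"
begin

abbreviation G :: "nat \<Rightarrow> 'm set" where "G i \<equiv> Hom C (cs i) (cs i)"

abbreviation T :: "'o \<Rightarrow> (nat \<Rightarrow> 'm \<Rightarrow> 'y \<Rightarrow> complex) set" where "T d \<equiv> Tsp C n cs Vs d"

lemma repD: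
  assumes "i < n"
  shows "subsp (Vs i)" "fdim_sp (Vs i)" "\<And>g. g \<in> G i \<Longrightarrow> lin_on (Vs i) (Vs i) (\<rho>s i g)"
    "\<And>v. v \<in> Vs i \<Longrightarrow> \<rho>s i (idm C (cs i)) v = v"
    "\<And>g h v. g \<in> G i \<Longrightarrow> h \<in> G i \<Longrightarrow> v \<in> Vs i \<Longrightarrow> \<rho>s i (g \<bullet> h) v = \<rho>s i g (\<rho>s i h v)"
  using rep[OF assms] unfolding is_rep_def Aut_eq by blast+

lemma TD:
  assumes "\<psi> \<in> T d"
  shows "i < n \<Longrightarrow> f \<in> Hom C (cs i) d \<Longrightarrow> \<psi> i f \<in> Vs i" "\<not> (i < n \<and> f \<in> Hom C (cs i) d) \<Longrightarrow> \<psi> i f = 0"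
  using assms[unfolded Tsp_def, THEN CollectD, rule_format, of i f] by (auto split: if_splits)

lemma TI:
  assumes "\<And>i f. i < n \<Longrightarrow> f \<in> Hom C (cs i) d \<Longrightarrow> \<psi> i f \<in> Vs i"
    "\<And>i f. \<not> (i < n \<and> f \<in> Hom C (cs i) d) \<Longrightarrow> \<psi> i f = 0"
  shows "\<psi> \<in> T d"
  using assms unfolding Tsp_def by simp

text \<open>The Reynolds operator for the action that sends \<psi> to the family with value
  \<open>\<rho>s i g (\<psi> i (f \<bullet> g))\<close> at f: a projector of \<open>T d\<close> with
  image \<open>Teq d\<close> and kernel \<open>Rel\<close>.\<close>

definition av :: "'o \<Rightarrow> (nat \<Rightarrow> 'm \<Rightarrow> 'y \<Rightarrow> complex) \<Rightarrow> nat \<Rightarrow> 'm \<Rightarrow> 'y \<Rightarrow> complex" where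
  "av d \<psi> = (\<lambda>i f. if i < n \<and> f \<in> Hom C (cs i) d
      then sc (1 / of_nat (card (G i))) (\<Sum>g\<in>G i. \<rho>s i g (\<psi> i (f \<bullet> g))) else 0)"

text \<open>The action behind this condition moves (f g) \<otimes> v to f \<otimes> g v, that is, it
  exchanges the two sides of a relation in \<open>Rel\<close>.\<close>

definition Teq :: "'o \<Rightarrow> (nat \<Rightarrow> 'm \<Rightarrow> 'y \<Rightarrow> complex) set" where
  "Teq d = {\<psi> \<in> T d. \<forall>i<n. \<forall>f\<in>Hom C (cs i) d. \<forall>g\<in>G i. \<rho>s i g (\<psi> i (f \<bullet> g)) = \<psi> i f}"

text \<open>\<open>sc\<close> scales functions of one argument; families are curried over index and
  morphism.\<close>

definition scT :: "complex \<Rightarrow> (nat \<Rightarrow> 'm \<Rightarrow> 'y \<Rightarrow> complex) \<Rightarrow> nat \<Rightarrow> 'm \<Rightarrow> 'y \<Rightarrow> complex" where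
  "scT a \<psi> = (\<lambda>i f. sc a (\<psi> i f))"

lemma T_0: "0 \<in> T d"
  using subspD(1) repD(1) by (intro TI) (auto simp: zero_fun_apply)

lemma T_add:
  assumes "\<psi> \<in> T d" "\<chi> \<in> T d" shows "\<psi> + \<chi> \<in> T d"
  using subspD(2)[OF repD(1)] TD[OF assms(1)] TD[OF assms(2)] by (intro TI) (simp_all add: plus_fun_apply)

lemma T_scale:
  assumes "\<psi> \<in> T d" shows "scT a \<psi> \<in> T d"
  using subspD(3)[OF repD(1)] TD[OF assms] by (intro TI) (simp_all add: scT_def)

lemma T_diff:
  assumes "\<psi> \<in> T d" "\<chi> \<in> T d" shows "\<psi> - \<chi> \<in> T d"
  using subspD(4)[OF repD(1)] TD[OF assms(1)] TD[OF assms(2)] by (intro TI) (simp_all add: minus_apply)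

lemma delta_T: "i < n \<Longrightarrow> f \<in> Hom C (cs i) d \<Longrightarrow> v \<in> Vs i \<Longrightarrow> delta i f v \<in> T d"
  using subspD(1) repD(1) by (intro TI) (auto simp: delta_def)

lemma card_G: "i < n \<Longrightarrow> of_nat (card (G i)) \<noteq> (0::complex)"
  using card_Aut cs_Ob by simp

lemma av_in_Teq:
  assumes "\<psi> \<in> T d" shows "av d \<psi> \<in> Teq d"
proof -
  have mem: "\<rho>s i g (\<psi> i (f \<bullet> g)) \<in> Vs i" if "i < n" "f \<in> Hom C (cs i) d" "g \<in> G i" for i f g
    using TD(1)[OF assms that(1) cmp_Hom[OF that(3,2)]] lin_onD(1)[OF repD(3)[OF that(1,3)]] by blast
  have "av d \<psi> \<in> T d"
    using mem by (intro TI) (auto simp: av_def intro!: subspD(3,5)[OF repD(1)])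
  moreover have "\<rho>s i g (av d \<psi> i (f \<bullet> g)) = av d \<psi> i f"
    if i: "i < n" and f: "f \<in> Hom C (cs i) d" and g: "g \<in> G i" for i f g
  proof -
    let ?a = "1 / of_nat (card (G i)) :: complex"
    note fg = cmp_Hom[OF g f]
    have mem': "\<rho>s i h (\<psi> i (f \<bullet> g \<bullet> h)) \<in> Vs i" if "h \<in> G i" for h using mem[OF i fg that] .
    have "\<rho>s i g (av d \<psi> i (f \<bullet> g)) = \<rho>s i g (sc ?a (\<Sum>h\<in>G i. \<rho>s i h (\<psi> i (f \<bullet> g \<bullet> h))))"
      using i fg by (simp add: av_def)
    also have "\<dots> = sc ?a (\<rho>s i g (\<Sum>h\<in>G i. \<rho>s i h (\<psi> i (f \<bullet> g \<bullet> h))))"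
      by (rule lin_onD(3)[OF repD(3)[OF i g]]) (rule subspD(5)[OF repD(1)[OF i] mem'])
    also have "\<rho>s i g (\<Sum>h\<in>G i. \<rho>s i h (\<psi> i (f \<bullet> g \<bullet> h))) = (\<Sum>h\<in>G i. \<rho>s i g (\<rho>s i h (\<psi> i (f \<bullet> g \<bullet> h))))"
      by (rule lin_on_sum[OF repD(3)[OF i g] repD(1)[OF i] mem'])
    also have "\<dots> = (\<Sum>h\<in>G i. \<rho>s i (g \<bullet> h) (\<psi> i (f \<bullet> (g \<bullet> h))))"
    proof (rule sum.cong[OF refl])
      fix h assume h: "h \<in> G i"
      have "f \<bullet> (g \<bullet> h) = f \<bullet> g \<bullet> h" by (rule cmp_assoc[OF h g f])
      moreover have "\<psi> i (f \<bullet> g \<bullet> h) \<in> Vs i" by (rule TD(1)[OF assms i cmp_Hom[OF h fg]])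
      ultimately show "\<rho>s i g (\<rho>s i h (\<psi> i (f \<bullet> g \<bullet> h))) = \<rho>s i (g \<bullet> h) (\<psi> i (f \<bullet> (g \<bullet> h)))"
        using repD(5)[OF i g h] by simp
    qed
    \<comment> \<open>Substituting \<open>h\<close> for \<open>g \<bullet> h\<close> absorbs
      \<open>g\<close>.\<close>
    also have "\<dots> = (\<Sum>h\<in>G i. \<rho>s i h (\<psi> i (f \<bullet> h)))"
      by (rule sum.reindex_bij_betw[OF bij_postcomp[OF g]])
    finally show ?thesis using i f by (simp add: av_def)
  qed
  ultimately show ?thesis unfolding Teq_def by blast
qed

lemma TeqD:
  assumes "\<psi> \<in> Teq d"
  shows "\<psi> \<in> T d" "i < n \<Longrightarrow> f \<in> Hom C (cs i) d \<Longrightarrow> g \<in> G i \<Longrightarrow> \<rho>s i g (\<psi> i (f \<bullet> g)) = \<psi> i f"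
  using assms unfolding Teq_def by blast+

lemma av_Teq:
  assumes "\<psi> \<in> Teq d" shows "av d \<psi> = \<psi>"
proof (intro ext)
  fix i f x
  have "av d \<psi> i f = \<psi> i f"
  proof (cases "i < n \<and> f \<in> Hom C (cs i) d")
    case True
    then have "(\<Sum>g\<in>G i. \<rho>s i g (\<psi> i (f \<bullet> g))) = (\<Sum>g\<in>G i. \<psi> i f)"
      using TeqD(2)[OF assms] by (intro sum.cong) auto
    also have "\<dots> = sc (of_nat (card (G i))) (\<psi> i f)" by (rule sum_const_sc)
    finally show ?thesis using True card_G[of i] by (simp add: av_def)
  next
    case False
    then show ?thesis using TD(2)[OF TeqD(1)[OF assms]] by (auto simp: av_def)
  qed
  then show "av d \<psi> i f x = \<psi> i f x" by simp
qed

lemma av_add: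
  assumes "\<psi> \<in> T d" "\<chi> \<in> T d" shows "av d (\<psi> + \<chi>) = av d \<psi> + av d \<chi>"
proof (intro ext)
  fix i f x
  have "av d (\<psi> + \<chi>) i f = av d \<psi> i f + av d \<chi> i f"
  proof (cases "i < n \<and> f \<in> Hom C (cs i) d")
    case True
    then have "(\<Sum>g\<in>G i. \<rho>s i g ((\<psi> + \<chi>) i (f \<bullet> g)))
        = (\<Sum>g\<in>G i. \<rho>s i g (\<psi> i (f \<bullet> g)) + \<rho>s i g (\<chi> i (f \<bullet> g)))"
      using TD(1)[OF assms(1)] TD(1)[OF assms(2)] cmp_Hom[of _ "cs i" "cs i" f d] lin_onD(2)[OF repD(3)[of i]]
      by (intro sum.cong) (simp_all add: plus_fun_apply)
    then show ?thesis using True by (simp add: av_def sum.distrib cf.scale_right_distrib)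
  next
    case False
    then have "av d \<xi> i f = 0" for \<xi> by (auto simp: av_def)
    then show ?thesis by simp
  qed
  then show "av d (\<psi> + \<chi>) i f x = (av d \<psi> + av d \<chi>) i f x" by (simp add: plus_fun_apply)
qed

lemma av_0: "av d 0 = 0"
  using av_Teq[of 0 d] T_0 lin_on_0[OF repD(3) repD(1)] by (simp add: Teq_def zero_fun_apply)

lemma av_diff:
  assumes "\<psi> \<in> T d" "\<chi> \<in> T d" shows "av d (\<psi> - \<chi>) = av d \<psi> - av d \<chi>"
  using av_add[OF T_diff[OF assms] assms(2)] by (simp add: eq_diff_eq)

lemma Teq_0: "0 \<in> Teq d"
  using av_in_Teq[OF T_0, of d] by (simp add: av_0)

lemma Teq_add: "\<psi> \<in> Teq d \<Longrightarrow> \<chi> \<in> Teq d \<Longrightarrow> \<psi> + \<chi> \<in> Teq d"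
  using av_in_Teq[OF T_add] av_add av_Teq TeqD(1) by metis

lemma Teq_scale:
  assumes "\<psi> \<in> Teq d" shows "scT a \<psi> \<in> Teq d"
  unfolding Teq_def
proof (intro CollectI conjI allI impI ballI T_scale[OF TeqD(1)[OF assms]])
  fix i f g assume i: "i < n" and f: "f \<in> Hom C (cs i) d" and g: "g \<in> G i"
  show "\<rho>s i g (scT a \<psi> i (f \<bullet> g)) = scT a \<psi> i f"
    using lin_onD(3)[OF repD(3)[OF i g] TD(1)[OF TeqD(1)[OF assms] i cmp_Hom[OF g f]]] TeqD(2)[OF assms i f g]
    by (simp add: scT_def)
qed

text \<open>The two families differ by the action of \<open>g\<close>, which averaging absorbs: the
  substitution of \<open>k \<bullet> g\<close> for \<open>k\<close> turns one sum into the
  other.\<close>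

lemma av_delta_rel:
  assumes i: "i < n" and f: "f \<in> Hom C (cs i) d" and g: "g \<in> G i" and v: "v \<in> Vs i"
  shows "av d (delta i (f \<bullet> g) v) = av d (delta i f (\<rho>s i g v))"
proof (intro ext)
  fix j h x
  have "av d (delta i (f \<bullet> g) v) j h = av d (delta i f (\<rho>s i g v)) j h"
  proof (cases "j = i \<and> h \<in> Hom C (cs i) d")
    case True
    then have h: "h \<in> Hom C (cs i) d" by blast
    have z: "\<rho>s i k 0 = 0" if "k \<in> G i" for k using lin_on_0[OF repD(3)[OF i that] repD(1)[OF i]] .
    have "(\<Sum>k\<in>G i. \<rho>s i k (delta i (f \<bullet> g) v i (h \<bullet> k)))
        = (\<Sum>k\<in>G i. \<rho>s i (k \<bullet> g) (delta i (f \<bullet> g) v i (h \<bullet> (k \<bullet> g))))"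
      by (rule sum.reindex_bij_betw[OF bij_precomp[OF g], symmetric])
    also have "\<dots> = (\<Sum>k\<in>G i. \<rho>s i k (delta i f (\<rho>s i g v) i (h \<bullet> k)))"
    proof (rule sum.cong[OF refl])
      fix k assume k: "k \<in> G i"
      have a: "h \<bullet> (k \<bullet> g) = h \<bullet> k \<bullet> g" by (rule cmp_assoc[OF g k h])
      \<comment> \<open>Right cancellation of \<open>g\<close> matches the supports of the two
        deltas.\<close>
      have "h \<bullet> k \<bullet> g = f \<bullet> g \<longleftrightarrow> h \<bullet> k = f"
        using inj_on_eq_iff[OF bij_betw_imp_inj_on[OF bij_precomp[OF g]] cmp_Hom[OF k h] f] .
      then show "\<rho>s i (k \<bullet> g) (delta i (f \<bullet> g) v i (h \<bullet> (k \<bullet> g))) = \<rho>s i k (delta i f (\<rho>s i g v) i (h \<bullet> k))"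
        using repD(5)[OF i k g v] z[OF k] z[OF cmp_Hom[OF g k]] by (simp add: delta_def a)
    qed
    finally show ?thesis using True i by (simp add: av_def)
  next
    case False
    then have "(delta i (f \<bullet> g) v) j (h \<bullet> k) = 0" "(delta i f (\<rho>s i g v)) j (h \<bullet> k) = 0"
      if "j < n" "h \<in> Hom C (cs j) d" for k
      using that by (auto simp: delta_def)
    then show ?thesis by (simp add: av_def)
  qed
  then show "av d (delta i (f \<bullet> g) v) j h x = av d (delta i f (\<rho>s i g v)) j h x" by simp
qed

lemma av_Rel:
  assumes "\<psi> \<in> Rel C n cs Vs \<rho>s d" shows "av d \<psi> = 0"
proof -
  obtain k "is" fs gs vs where \<psi>: "\<psi> = (\<Sum>j<(k::nat). delta (is j) (fs j \<bullet> gs j) (vs j)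
          - delta (is j) (fs j) (\<rho>s (is j) (gs j) (vs j)))"
    and c: "\<forall>j<k. is j < n \<and> fs j \<in> Hom C (cs (is j)) d \<and> gs j \<in> G (is j) \<and> vs j \<in> Vs (is j)"
    using assms[unfolded Rel_def Aut_eq mem_Collect_eq] by (elim exE conjE) (rule that)
  have 1: "delta (is j) (fs j \<bullet> gs j) (vs j) \<in> T d" "delta (is j) (fs j) (\<rho>s (is j) (gs j) (vs j)) \<in> T d"
    if "j < k" for j
    using c[rule_format, OF that] cmp_Hom lin_onD(1)[OF repD(3)] by (auto intro!: delta_T)
  have "av d \<psi> = (\<Sum>j<k. av d (delta (is j) (fs j \<bullet> gs j) (vs j)
          - delta (is j) (fs j) (\<rho>s (is j) (gs j) (vs j))))"
    unfolding \<psi>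
    by (rule sum_additive_on[where V = "T d" and F = "av d"])
       (use 1 in \<open>auto simp: av_add av_0 T_0 intro: T_add T_diff\<close>)
  also have "\<dots> = 0"
    using 1 c by (intro sum.neutral) (simp add: av_diff av_delta_rel)
  finally show ?thesis .
qed

lemma Rel_sumI:
  assumes "finite A" "\<And>a. a \<in> A \<Longrightarrow> is a < n" "\<And>a. a \<in> A \<Longrightarrow> fs a \<in> Hom C (cs (is a)) d"
    "\<And>a. a \<in> A \<Longrightarrow> gs a \<in> G (is a)" "\<And>a. a \<in> A \<Longrightarrow> vs a \<in> Vs (is a)"
  shows "(\<Sum>a\<in>A. delta (is a) (fs a \<bullet> gs a) (vs a) - delta (is a) (fs a) (\<rho>s (is a) (gs a) (vs a)))
    \<in> Rel C n cs Vs \<rho>s d"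
proof -
  obtain h where h: "bij_betw h {0..<card A} A" using ex_bij_betw_nat_finite[OF assms(1)] by blast
  have "(\<Sum>a\<in>A. delta (is a) (fs a \<bullet> gs a) (vs a) - delta (is a) (fs a) (\<rho>s (is a) (gs a) (vs a)))
    = (\<Sum>j<card A. delta (is (h j)) (fs (h j) \<bullet> gs (h j)) (vs (h j))
        - delta (is (h j)) (fs (h j)) (\<rho>s (is (h j)) (gs (h j)) (vs (h j))))"
    by (subst sum.reindex_bij_betw[OF h, symmetric]) (simp add: atLeast0LessThan)
  then show ?thesis unfolding Rel_def Aut_eq
    by (intro CollectI exI[of _ "card A"] exI[of _ "\<lambda>j. is (h j)"] exI[of _ "\<lambda>j. fs (h j)"]
        exI[of _ "\<lambda>j. gs (h j)"] exI[of _ "\<lambda>j. vs (h j)"] conjI)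
       (use bij_betwE[OF h] assms in auto)
qed

text \<open>If the average vanishes, \<psi> equals \<psi> minus its average, which is 1/|G_i| times
  the sum over f and g of \<psi>(f) placed at f minus g \<psi>(f) placed at f g^{-1}. Each such
  difference is a relation with base morphism f g^{-1} and group element g.\<close>

lemma Rel_if_av_0:
  assumes "\<psi> \<in> T d" "av d \<psi> = 0" shows "\<psi> \<in> Rel C n cs Vs \<rho>s d"
proof -
  define A where "A = (SIGMA i:{..<n}. Hom C (cs i) d \<times> G i)"
  define c where "c i = (1 / of_nat (card (G i)) :: complex)" for i
  have fin: "finite A" unfolding A_def using finite_Hom by auto
  have inH: "f \<bullet> inv_mor C (cs i) g \<in> Hom C (cs i) d" if "f \<in> Hom C (cs i) d" "g \<in> G i" for i f g
    using cmp_Hom[OF inv_mor(1)[OF that(2)] that(1)] .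
  have "(\<Sum>(i, f, g)\<in>A. delta i (f \<bullet> inv_mor C (cs i) g \<bullet> g) (sc (c i) (\<psi> i f))
      - delta i (f \<bullet> inv_mor C (cs i) g) (\<rho>s i g (sc (c i) (\<psi> i f)))) \<in> Rel C n cs Vs \<rho>s d"
    using Rel_sumI[OF fin, of fst "\<lambda>(i, f, g). f \<bullet> inv_mor C (cs i) g" d "\<lambda>(i, f, g). g"
        "\<lambda>(i, f, g). sc (c i) (\<psi> i f)"]
      inH TD(1)[OF assms(1)] subspD(3)[OF repD(1)]
    by (auto simp: A_def case_prod_unfold)
  moreover have "(\<Sum>(i, f, g)\<in>A. delta i (f \<bullet> inv_mor C (cs i) g \<bullet> g) (sc (c i) (\<psi> i f))
      - delta i (f \<bullet> inv_mor C (cs i) g) (\<rho>s i g (sc (c i) (\<psi> i f)))) = \<psi>" (is "?S = \<psi>")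
  proof (intro ext)
    fix j h x
    have S: "?S j h = (\<Sum>i<n. \<Sum>f\<in>Hom C (cs i) d. \<Sum>g\<in>G i. delta i f (sc (c i) (\<psi> i f)) j h
        - delta i (f \<bullet> inv_mor C (cs i) g) (\<rho>s i g (sc (c i) (\<psi> i f))) j h)"
      unfolding A_def using finite_Hom inv_mor_cancel
      by (simp add: sum.Sigma[symmetric] sum.cartesian_product[symmetric] sum_fun_apply minus_apply
          )
    have "?S j h = \<psi> j h"
    proof (cases "j < n \<and> h \<in> Hom C (cs j) d")
      case True
      then have j: "j < n" and h: "h \<in> Hom C (cs j) d" by auto
      have mem: "\<psi> j f \<in> Vs j" if "f \<in> Hom C (cs j) d" for f using TD(1)[OF assms(1) j that] .
      have "?S j h = (\<Sum>f\<in>Hom C (cs j) d. \<Sum>g\<in>G j. delta j f (sc (c j) (\<psi> j f)) j h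
          - delta j (f \<bullet> inv_mor C (cs j) g) (\<rho>s j g (sc (c j) (\<psi> j f))) j h)"
        unfolding S using j by (subst sum.remove[of _ j]) (auto intro!: sum.neutral simp: delta_def)
      also have "\<dots> = (\<Sum>g\<in>G j. \<Sum>f\<in>Hom C (cs j) d. delta j f (sc (c j) (\<psi> j f)) j h)
         - (\<Sum>g\<in>G j. \<Sum>f\<in>Hom C (cs j) d. delta j (f \<bullet> inv_mor C (cs j) g) (\<rho>s j g (sc (c j) (\<psi> j f))) j h)"
        by (simp add: sum_subtractf sum.swap[of _ "Hom C (cs j) d" "G j"] del: sum_constant)
      also have "(\<Sum>g\<in>G j. \<Sum>f\<in>Hom C (cs j) d. delta j f (sc (c j) (\<psi> j f)) j h) = (\<Sum>g\<in>G j. sc (c j) (\<psi> j h))"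
        using h finite_Hom by (simp add: delta_def)
      also have "\<dots> = \<psi> j h" using card_G[OF j] by (simp add: sum_const_sc c_def del: sum_constant)
      also have "(\<Sum>g\<in>G j. \<Sum>f\<in>Hom C (cs j) d. delta j (f \<bullet> inv_mor C (cs j) g) (\<rho>s j g (sc (c j) (\<psi> j f))) j h)
          = (\<Sum>g\<in>G j. sc (c j) (\<rho>s j g (\<psi> j (h \<bullet> g))))"
      proof (rule sum.cong[OF refl])
        fix g assume g: "g \<in> G j"
        \<comment> \<open>Substituting \<open>f \<bullet> g\<close> for \<open>f\<close> puts the
          delta at \<open>f\<close> itself, so that only \<open>f = h\<close> survives.\<close>
        have "(\<Sum>f\<in>Hom C (cs j) d. delta j (f \<bullet> inv_mor C (cs j) g) (\<rho>s j g (sc (c j) (\<psi> j f))) j h)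
          = (\<Sum>f\<in>Hom C (cs j) d. delta j (f \<bullet> g \<bullet> inv_mor C (cs j) g) (\<rho>s j g (sc (c j) (\<psi> j (f \<bullet> g)))) j h)"
          by (rule sum.reindex_bij_betw[OF bij_precomp[OF g], symmetric])
        also have "\<dots> = (\<Sum>f\<in>Hom C (cs j) d. if h = f then \<rho>s j g (sc (c j) (\<psi> j (f \<bullet> g))) else 0)"
          by (rule sum.cong[OF refl]) (simp add: inv_mor_cancel[OF g] delta_def)
        also have "\<dots> = \<rho>s j g (sc (c j) (\<psi> j (h \<bullet> g)))" using h finite_Hom by simp
        also have "\<dots> = sc (c j) (\<rho>s j g (\<psi> j (h \<bullet> g)))"
          by (rule lin_onD(3)[OF repD(3)[OF j g] mem[OF cmp_Hom[OF g h]]])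
        finally show "(\<Sum>f\<in>Hom C (cs j) d. delta j (f \<bullet> inv_mor C (cs j) g) (\<rho>s j g (sc (c j) (\<psi> j f))) j h)
          = sc (c j) (\<rho>s j g (\<psi> j (h \<bullet> g)))" .
      qed
      also have "\<dots> = av d \<psi> j h" using j h by (simp add: av_def c_def cf.scale_sum_right)
      also have "\<dots> = 0" by (simp add: assms(2) zero_fun_apply)
      finally show ?thesis by simp
    next
      case False
      then have "\<psi> j h = 0" using TD(2)[OF assms(1)] by blast
      moreover have "?S j h = 0" unfolding S
      proof (intro sum.neutral ballI)
        fix i f g assume i: "i \<in> {..<n}" and f: "f \<in> Hom C (cs i) d" and g: "g \<in> G i"
        have "f \<bullet> inv_mor C (cs i) g \<in> Hom C (cs i) d" using cmp_Hom[OF inv_mor(1)[OF g] f] .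
        then show "delta i f (sc (c i) (\<psi> i f)) j h
          - delta i (f \<bullet> inv_mor C (cs i) g) (\<rho>s i g (sc (c i) (\<psi> i f))) j h = 0"
          using False i f by (auto simp: delta_def)
      qed
      ultimately show ?thesis by simp
    qed
    then show "?S j h x = \<psi> j h x" by simp
  qed
  ultimately show ?thesis by simp
qed

end

section \<open>Modules with equivariant generators\<close>

lemma (in FI_category) moduleD:
  assumes "is_module C M"
  shows "d \<in> Ob C \<Longrightarrow> subsp (sp M d)" "f \<in> Hom C c d \<Longrightarrow> lin_on (sp M c) (sp M d) (mp M f)"
    "c \<in> Ob C \<Longrightarrow> v \<in> sp M c \<Longrightarrow> mp M (idm C c) v = v"
    "f \<in> Hom C c d \<Longrightarrow> g \<in> Hom C d e \<Longrightarrow> v \<in> sp M c \<Longrightarrow> mp M (g \<bullet> f) v = mp M g (mp M f v)"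
  using assms unfolding is_module_def by blast+

text \<open>Bijectivity of \<open>Phi\<close> is left out on purpose, so that the same facts are
  available in proofs of freeness.\<close>

locale gen_module = rep_family C n cs Vs \<rho>s
  for C :: "('o, 'm) cat" and n :: nat and cs :: "nat \<Rightarrow> 'o" and Vs :: "nat \<Rightarrow> ('y \<Rightarrow> complex) set"
    and \<rho>s :: "nat \<Rightarrow> 'm \<Rightarrow> ('y \<Rightarrow> complex) \<Rightarrow> ('y \<Rightarrow> complex)" +
  fixes M :: "('m, 'o, 'x) cmod" and \<iota> :: "nat \<Rightarrow> ('y \<Rightarrow> complex) \<Rightarrow> ('x \<Rightarrow> complex)"
  assumes module: "is_module C M"
    and gen_lin: "i < n \<Longrightarrow> lin_on (Vs i) (sp M (cs i)) (\<iota> i)"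
    and gen_equiv: "i < n \<Longrightarrow> g \<in> Hom C (cs i) (cs i) \<Longrightarrow> v \<in> Vs i \<Longrightarrow> \<iota> i (\<rho>s i g v) = mp M g (\<iota> i v)"
begin

abbreviation P :: "'o \<Rightarrow> (nat \<Rightarrow> 'm \<Rightarrow> 'y \<Rightarrow> complex) \<Rightarrow> ('x \<Rightarrow> complex)" where
  "P d \<psi> \<equiv> Phi C M n cs \<iota> d \<psi>"

lemmas modD = moduleD[OF module]

lemma gen_map_lin: "i < n \<Longrightarrow> f \<in> Hom C (cs i) d \<Longrightarrow> lin_on (Vs i) (sp M d) (\<lambda>v. mp M f (\<iota> i v))"
  using lin_on_comp[OF gen_lin modD(2)] .

lemma gen_map_equiv:
  assumes "i < n" "f \<in> Hom C (cs i) d" "g \<in> G i" "v \<in> Vs i"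
  shows "mp M f (\<iota> i (\<rho>s i g v)) = mp M (f \<bullet> g) (\<iota> i v)"
  using modD(4)[OF assms(3,2) lin_onD(1)[OF gen_lin[OF assms(1)] assms(4)]] gen_equiv[OF assms(1,3,4)] by simp

lemma P_in:
  assumes "d \<in> Ob C" "\<psi> \<in> T d" shows "P d \<psi> \<in> sp M d"
  unfolding Phi_def
  by (intro subspD(5)[OF modD(1)[OF assms(1)]]) (use lin_onD(1)[OF gen_map_lin TD(1)[OF assms(2)]] in simp)

lemma P_add:
  assumes "\<psi> \<in> T d" "\<chi> \<in> T d" shows "P d (\<psi> + \<chi>) = P d \<psi> + P d \<chi>"
proof -
  have "P d (\<psi> + \<chi>) = (\<Sum>i<n. \<Sum>f\<in>Hom C (cs i) d. mp M f (\<iota> i (\<psi> i f)) + mp M f (\<iota> i (\<chi> i f)))"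
    unfolding Phi_def
    using lin_onD(2)[OF gen_map_lin TD(1)[OF assms(1)] TD(1)[OF assms(2)]]
    by (intro sum.cong refl) (simp add: plus_fun_apply)
  then show ?thesis by (simp add: Phi_def sum.distrib)
qed

lemma P_scale:
  assumes "\<psi> \<in> T d" shows "P d (scT a \<psi>) = sc a (P d \<psi>)"
proof -
  have "P d (scT a \<psi>) = (\<Sum>i<n. \<Sum>f\<in>Hom C (cs i) d. sc a (mp M f (\<iota> i (\<psi> i f))))"
    unfolding Phi_def using lin_onD(3)[OF gen_map_lin TD(1)[OF assms(1)]]
    by (intro sum.cong refl) (simp add: scT_def)
  then show ?thesis by (simp add: Phi_def cf.scale_sum_right)
qed

lemma P_delta:
  assumes i: "i < n" and f: "f \<in> Hom C (cs i) d" and v: "v \<in> Vs i"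
  shows "P d (delta i f v) = mp M f (\<iota> i v)"
proof -
  have z: "mp M h (\<iota> j 0) = 0" if "j < n" "h \<in> Hom C (cs j) d" for j h
    using lin_on_0[OF gen_map_lin[OF that] repD(1)[OF that(1)]] .
  have "P d (delta i f v) = (\<Sum>j<n. \<Sum>h\<in>Hom C (cs j) d. if j = i then if h = f then mp M f (\<iota> i v) else 0 else 0)"
    unfolding Phi_def by (intro sum.cong refl) (auto simp: delta_def z)
  also have "\<dots> = (\<Sum>j<n. if j = i then \<Sum>h\<in>Hom C (cs j) d. if h = f then mp M f (\<iota> i v) else 0 else 0)"
    by (intro sum.cong refl) simp
  also have "\<dots> = mp M f (\<iota> i v)" using i f finite_Hom by simp
  finally show ?thesis .
qed

text \<open>Generators absorb the action: M(f) at \<open>\<iota> i (\<rho>s i g v)\<close> is M(f g)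
  at \<open>\<iota> i v\<close>. For each g, the substitution of f for f g then recovers the sum
  without averaging.\<close>

lemma P_av:
  assumes "\<psi> \<in> T d" shows "P d (av d \<psi>) = P d \<psi>"
  unfolding Phi_def
proof (rule sum.cong[OF refl])
  fix i assume "i \<in> {..<n}"
  then have i: "i < n" by simp
  let ?a = "1 / of_nat (card (G i)) :: complex"
  have mem: "\<psi> i (f \<bullet> g) \<in> Vs i" if "f \<in> Hom C (cs i) d" "g \<in> G i" for f g
    using TD(1)[OF assms i cmp_Hom[OF that(2,1)]] .
  have mem': "\<rho>s i g (\<psi> i (f \<bullet> g)) \<in> Vs i" if "f \<in> Hom C (cs i) d" "g \<in> G i" for f g
    using lin_onD(1)[OF repD(3)[OF i that(2)] mem[OF that]] .
  have "(\<Sum>f\<in>Hom C (cs i) d. mp M f (\<iota> i (av d \<psi> i f)))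
      = (\<Sum>f\<in>Hom C (cs i) d. \<Sum>g\<in>G i. sc ?a (mp M (f \<bullet> g) (\<iota> i (\<psi> i (f \<bullet> g)))))"
  proof (rule sum.cong[OF refl])
    fix f assume f: "f \<in> Hom C (cs i) d"
    have "mp M f (\<iota> i (av d \<psi> i f)) = sc ?a (mp M f (\<iota> i (\<Sum>g\<in>G i. \<rho>s i g (\<psi> i (f \<bullet> g)))))"
      using i f lin_onD(3)[OF gen_map_lin[OF i f] subspD(5)[OF repD(1)[OF i] mem'[OF f]]] by (simp add: av_def)
    also have "mp M f (\<iota> i (\<Sum>g\<in>G i. \<rho>s i g (\<psi> i (f \<bullet> g)))) = (\<Sum>g\<in>G i. mp M f (\<iota> i (\<rho>s i g (\<psi> i (f \<bullet> g)))))"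
      by (rule lin_on_sum[OF gen_map_lin[OF i f] repD(1)[OF i] mem'[OF f]])
    also have "\<dots> = (\<Sum>g\<in>G i. mp M (f \<bullet> g) (\<iota> i (\<psi> i (f \<bullet> g))))"
      by (intro sum.cong refl gen_map_equiv[OF i f _ mem[OF f]])
    finally show "mp M f (\<iota> i (av d \<psi> i f)) = (\<Sum>g\<in>G i. sc ?a (mp M (f \<bullet> g) (\<iota> i (\<psi> i (f \<bullet> g)))))"
      by (simp add: cf.scale_sum_right)
  qed
  also have "\<dots> = (\<Sum>g\<in>G i. \<Sum>f\<in>Hom C (cs i) d. sc ?a (mp M (f \<bullet> g) (\<iota> i (\<psi> i (f \<bullet> g)))))"
    by (rule sum.swap)
  also have "\<dots> = (\<Sum>g\<in>G i. \<Sum>f\<in>Hom C (cs i) d. sc ?a (mp M f (\<iota> i (\<psi> i f))))"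
    by (intro sum.cong refl sum.reindex_bij_betw[OF bij_precomp])
  also have "\<dots> = (\<Sum>f\<in>Hom C (cs i) d. mp M f (\<iota> i (\<psi> i f)))"
    using card_G[OF i] by (simp add: sum_const_sc cf.scale_sum_right[symmetric] del: sum_constant)
  finally show "(\<Sum>f\<in>Hom C (cs i) d. mp M f (\<iota> i (av d \<psi> i f))) = (\<Sum>f\<in>Hom C (cs i) d. mp M f (\<iota> i (\<psi> i f)))" .
qed

lemma subspace_P_image:
  "cf.subspace (P d ` T d)"
  unfolding cf.subspace_def
proof (intro conjI ballI allI)
  show "0 \<in> P d ` T d"
    by (rule image_eqI[OF _ T_scale[OF T_0, of 0 d]]) (simp add: P_scale[OF T_0])
  fix x y assume "x \<in> P d ` T d" "y \<in> P d ` T d"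
  then obtain \<psi> \<chi> where *: "x = P d \<psi>" "y = P d \<chi>" "\<psi> \<in> T d" "\<chi> \<in> T d" by (elim imageE)
  show "x + y \<in> P d ` T d"
    by (rule image_eqI[OF _ T_add[OF *(3,4)]]) (simp add: * P_add)
next
  fix a x assume "x \<in> P d ` T d"
  then obtain \<psi> where *: "x = P d \<psi>" "\<psi> \<in> T d" by (rule imageE)
  show "sc a x \<in> P d ` T d"
    by (rule image_eqI[OF _ T_scale[OF *(2), of a]]) (simp add: * P_scale)
qed

text \<open>Relations disappear from the criterion: if \<open>P d \<psi> = 0\<close>, the average of
  \<psi> is an equivariant family with the same value, hence 0, and a family with average 0 lies in
  \<open>Rel\<close>.\<close>

lemma free_presI:
  assumes "\<And>d. d \<in> Ob C \<Longrightarrow>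
      sp M d \<subseteq> cf.span {mp M f (\<iota> i v) | i f v. i < n \<and> f \<in> Hom C (cs i) d \<and> v \<in> Vs i}"
    and "\<And>d \<psi>. d \<in> Ob C \<Longrightarrow> \<psi> \<in> Teq d \<Longrightarrow> P d \<psi> = 0 \<Longrightarrow> \<psi> = 0"
  shows "free_pres C M n cs Vs \<rho>s \<iota>"
  unfolding free_pres_def
proof (intro conjI ballI allI impI module)
  fix d assume d: "d \<in> Ob C"
  have "{mp M f (\<iota> i v) | i f v. i < n \<and> f \<in> Hom C (cs i) d \<and> v \<in> Vs i} \<subseteq> P d ` T d"
  proof clarify
    fix i f v assume A: "i < n" "f \<in> Hom C (cs i) d" "v \<in> Vs i"
    show "mp M f (\<iota> i v) \<in> P d ` T d"
      by (rule image_eqI[OF _ delta_T[OF A]]) (simp add: P_delta[OF A])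
  qed
  then have "sp M d \<subseteq> P d ` T d"
    using assms(1)[OF d] cf.span_minimal[OF _ subspace_P_image] by blast
  then show "sp M d = P d ` T d" using P_in[OF d] by blast
  fix \<psi> assume \<psi>: "\<psi> \<in> T d" "P d \<psi> = 0"
  have "av d \<psi> = 0" using assms(2)[OF d av_in_Teq[OF \<psi>(1)]] P_av[OF \<psi>(1)] \<psi>(2) by simp
  then show "\<psi> \<in> Rel C n cs Vs \<rho>s d" by (rule Rel_if_av_0[OF \<psi>(1)])
qed (use cs_Ob rep gen_lin gen_equiv Aut_eq in auto)

end

section \<open>Coefficients of elements of a free module\<close>

locale free_module = FI_category C for C :: "('o, 'm) cat" +
  fixes M :: "('m, 'o, 'x) cmod" and n :: nat and cs :: "nat \<Rightarrow> 'o"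
    and Vs :: "nat \<Rightarrow> ('y \<Rightarrow> complex) set"
    and \<rho>s :: "nat \<Rightarrow> 'm \<Rightarrow> ('y \<Rightarrow> complex) \<Rightarrow> ('y \<Rightarrow> complex)"
    and \<iota> :: "nat \<Rightarrow> ('y \<Rightarrow> complex) \<Rightarrow> ('x \<Rightarrow> complex)"
  assumes pres: "free_pres C M n cs Vs \<rho>s \<iota>"

sublocale free_module \<subseteq> gen_module C n cs Vs \<rho>s M \<iota>
  using pres unfolding free_pres_def Aut_eq by unfold_locales blast+

context free_module
begin

lemma P_surj: "d \<in> Ob C \<Longrightarrow> sp M d = P d ` T d"
  and P_kernel: "d \<in> Ob C \<Longrightarrow> \<psi> \<in> T d \<Longrightarrow> P d \<psi> = 0 \<Longrightarrow> \<psi> \<in> Rel C n cs Vs \<rho>s d"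
  using pres[unfolded free_pres_def, THEN conjunct2, THEN conjunct2] by blast+

text \<open>The difference lies in \<open>Rel\<close>, which averaging kills, while averaging fixes
  equivariant families.\<close>

lemma P_inj:
  assumes "d \<in> Ob C" "\<psi> \<in> Teq d" "\<chi> \<in> Teq d" "P d \<psi> = P d \<chi>" shows "\<psi> = \<chi>"
proof -
  note T = TeqD(1)[OF assms(2)] TeqD(1)[OF assms(3)]
  have "P d (\<psi> - \<chi>) + P d \<chi> = P d \<psi>" using P_add[OF T_diff[OF T] T(2)] by simp
  then have "P d (\<psi> - \<chi>) = 0" using assms(4) by simp
  then have "av d (\<psi> - \<chi>) = 0" using av_Rel[OF P_kernel[OF assms(1) T_diff[OF T]]] by blast
  then show ?thesis using av_diff[OF T] av_Teq assms(2,3) by simp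
qed

text \<open>\<open>P d\<close> restricts to a bijection from \<open>Teq d\<close> to
  \<open>sp M d\<close>; this is its inverse.\<close>

definition coef :: "'o \<Rightarrow> ('x \<Rightarrow> complex) \<Rightarrow> nat \<Rightarrow> 'm \<Rightarrow> 'y \<Rightarrow> complex" where
  "coef d m = (THE \<psi>. \<psi> \<in> Teq d \<and> P d \<psi> = m)"

lemma coef_eqI: "d \<in> Ob C \<Longrightarrow> \<psi> \<in> Teq d \<Longrightarrow> P d \<psi> = m \<Longrightarrow> coef d m = \<psi>"
  unfolding coef_def by (rule the_equality) (use P_inj in blast)+

lemma coef_P: "d \<in> Ob C \<Longrightarrow> \<psi> \<in> T d \<Longrightarrow> coef d (P d \<psi>) = av d \<psi>"
  by (intro coef_eqI av_in_Teq P_av)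

lemma coef:
  assumes "d \<in> Ob C" "m \<in> sp M d" shows "coef d m \<in> Teq d" "P d (coef d m) = m"
proof -
  obtain \<psi> where \<psi>: "\<psi> \<in> T d" "m = P d \<psi>" using P_surj[OF assms(1)] assms(2) by blast
  show "coef d m \<in> Teq d" "P d (coef d m) = m"
    unfolding \<psi>(2) coef_P[OF assms(1) \<psi>(1)] using av_in_Teq[OF \<psi>(1)] P_av[OF \<psi>(1)] by simp_all
qed

lemma coef_mem:
  "d \<in> Ob C \<Longrightarrow> m \<in> sp M d \<Longrightarrow> i < n \<Longrightarrow> f \<in> Hom C (cs i) d \<Longrightarrow> coef d m i f \<in> Vs i"
  using TD(1)[OF TeqD(1)[OF coef(1)]] .

lemma expand:
  assumes "d \<in> Ob C" "m \<in> sp M d"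
  shows "m = (\<Sum>i<n. \<Sum>f\<in>Hom C (cs i) d. mp M f (\<iota> i (coef d m i f)))"
  using coef(2)[OF assms] by (simp add: Phi_def)

lemma coef_add:
  assumes "d \<in> Ob C" "m \<in> sp M d" "m' \<in> sp M d"
  shows "coef d (m + m') = coef d m + coef d m'"
  by (rule coef_eqI[OF assms(1)])
     (use coef[OF assms(1,2)] coef[OF assms(1,3)] P_add TeqD(1) in \<open>auto intro: Teq_add\<close>)

lemma coef_scale:
  assumes "d \<in> Ob C" "m \<in> sp M d"
  shows "coef d (sc a m) = scT a (coef d m)"
  by (rule coef_eqI[OF assms(1)])
     (use coef[OF assms(1,2)] P_scale[OF TeqD(1)] in \<open>auto intro: Teq_scale\<close>)

lemma coef_lin:
  assumes "d \<in> Ob C" "i < n" "f \<in> Hom C (cs i) d"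
  shows "lin_on (sp M d) (Vs i) (\<lambda>m. coef d m i f)"
  using coef_add[OF assms(1)] coef_scale[OF assms(1)] coef_mem[OF assms(1) _ assms(2,3)]
  by (simp add: lin_on_def plus_fun_apply scT_def)

text \<open>The family pushed forward along postcomposition with \<open>h\<close> is equivariant and
  represents \<open>mp M h m\<close>, so uniqueness of coefficients identifies it.\<close>

lemma coef_map:
  assumes h: "h \<in> Hom C d e" and m: "m \<in> sp M d" and i: "i < n"
  shows "f \<in> Hom C (cs i) d \<Longrightarrow> coef e (mp M h m) i (h \<bullet> f) = coef d m i f"
    and "f' \<notin> (\<lambda>f. h \<bullet> f) ` Hom C (cs i) d \<Longrightarrow> coef e (mp M h m) i f' = 0"
proof -
  note de = Hom_Ob[OF h]
  define \<psi> where "\<psi> = coef d m"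
  have \<psi>: "\<psi> \<in> Teq d" "P d \<psi> = m" "\<psi> \<in> T d" using coef[OF de(1) m] TeqD(1) by (auto simp: \<psi>_def)
  \<comment> \<open>The sum has at most one nonzero term, as \<open>h\<close> is mono; in this form
    no preimage has to be chosen.\<close>
  define \<chi> where "\<chi> = (\<lambda>i f'. \<Sum>f\<in>Hom C (cs i) d. if h \<bullet> f = f' then \<psi> i f else 0)"
  have \<chi>1: "\<chi> i (h \<bullet> f) = \<psi> i f" if "f \<in> Hom C (cs i) d" for i f
  proof -
    have "\<chi> i (h \<bullet> f) = (\<Sum>k\<in>Hom C (cs i) d. if k = f then \<psi> i k else 0)"
      unfolding \<chi>_def using mono[OF h _ that] by (intro sum.cong refl) auto
    then show ?thesis using that finite_Hom by simp
  qed
  have \<chi>2: "\<chi> i f' = 0" if "f' \<notin> (\<lambda>f. h \<bullet> f) ` Hom C (cs i) d" for i f'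
    unfolding \<chi>_def using that by (intro sum.neutral) auto
  have \<chi>T: "\<chi> \<in> T e"
  proof (rule TI)
    fix i f' assume i: "i < n" "f' \<in> Hom C (cs i) e"
    show "\<chi> i f' \<in> Vs i" unfolding \<chi>_def
      using TD(1)[OF \<psi>(3) i(1)] subspD(1)[OF repD(1)[OF i(1)]] by (intro subspD(5)[OF repD(1)[OF i(1)]]) simp
  next
    fix i f' assume "\<not> (i < n \<and> f' \<in> Hom C (cs i) e)"
    then show "\<chi> i f' = 0" unfolding \<chi>_def using TD(2)[OF \<psi>(3)] cmp_Hom[OF _ h]
      by (intro sum.neutral) auto
  qed
  have \<chi>: "\<chi> \<in> Teq e" unfolding Teq_def
  proof (intro CollectI conjI \<chi>T allI impI ballI)
    fix i f' g assume i: "i < n" and f': "f' \<in> Hom C (cs i) e" and g: "g \<in> G i"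
    show "\<rho>s i g (\<chi> i (f' \<bullet> g)) = \<chi> i f'"
    proof (cases "f' \<in> (\<lambda>f. h \<bullet> f) ` Hom C (cs i) d")
      case True
      then obtain f where f: "f \<in> Hom C (cs i) d" "f' = h \<bullet> f" by blast
      have "f' \<bullet> g = h \<bullet> (f \<bullet> g)" using cmp_assoc[OF g f(1) h] f(2) by simp
      then show ?thesis using \<chi>1[OF cmp_Hom[OF g f(1)]] \<chi>1[OF f(1)] TeqD(2)[OF \<psi>(1) i f(1) g] f(2) by simp
    next
      case False
      \<comment> \<open>The image of postcomposition with \<open>h\<close> is stable under
        precomposition with G_i, hence so is its complement.\<close>
      have "f' \<bullet> g \<notin> (\<lambda>f. h \<bullet> f) ` Hom C (cs i) d"
      proof
        assume "f' \<bullet> g \<in> (\<lambda>f. h \<bullet> f) ` Hom C (cs i) d"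
        then obtain f where f: "f \<in> Hom C (cs i) d" "f' \<bullet> g = h \<bullet> f" by blast
        have "f' = h \<bullet> (f \<bullet> inv_mor C (cs i) g)"
          using inv_mor_cancel(1)[OF g f'] cmp_assoc[OF inv_mor(1)[OF g] f(1) h] f(2) by simp
        then show False using False cmp_Hom[OF inv_mor(1)[OF g] f(1)] by blast
      qed
      then show ?thesis using \<chi>2 False lin_on_0[OF repD(3)[OF i g] repD(1)[OF i]] by simp
    qed
  qed
  have "P e \<chi> = mp M h m"
  proof -
    have "(\<Sum>f'\<in>Hom C (cs i) e. mp M f' (\<iota> i (\<chi> i f'))) = (\<Sum>f\<in>Hom C (cs i) d. mp M h (mp M f (\<iota> i (\<psi> i f))))"
      if i: "i < n" for i
    proof -
      have "(\<Sum>f'\<in>Hom C (cs i) e. mp M f' (\<iota> i (\<chi> i f')))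
          = (\<Sum>f'\<in>(\<lambda>f. h \<bullet> f) ` Hom C (cs i) d. mp M f' (\<iota> i (\<chi> i f')))"
        using finite_Hom cmp_Hom[OF _ h] \<chi>2[of _ i] lin_on_0[OF gen_map_lin[OF i] repD(1)[OF i]]
        by (intro sum.mono_neutral_right) auto
      also have "\<dots> = (\<Sum>f\<in>Hom C (cs i) d. mp M (h \<bullet> f) (\<iota> i (\<chi> i (h \<bullet> f))))"
        using mono[OF h] by (subst sum.reindex) (auto simp: inj_on_def)
      also have "\<dots> = (\<Sum>f\<in>Hom C (cs i) d. mp M h (mp M f (\<iota> i (\<psi> i f))))"
        using \<chi>1[of _ i] modD(4)[OF _ h] lin_onD(1)[OF gen_lin[OF i] TD(1)[OF \<psi>(3) i]]
        by (intro sum.cong refl) simp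
      finally show ?thesis .
    qed
    then have "P e \<chi> = (\<Sum>i<n. \<Sum>f\<in>Hom C (cs i) d. mp M h (mp M f (\<iota> i (\<psi> i f))))"
      by (simp add: Phi_def)
    also have "\<dots> = mp M h (P d \<psi>)"
    proof -
      note L = modD(2)[OF h] and S = modD(1)[OF de(1)]
      have m1: "mp M f (\<iota> i (\<psi> i f)) \<in> sp M d" if "i < n" "f \<in> Hom C (cs i) d" for i f
        using lin_onD(1)[OF gen_map_lin[OF that] TD(1)[OF \<psi>(3) that]] .
      have "mp M h (P d \<psi>) = (\<Sum>i<n. mp M h (\<Sum>f\<in>Hom C (cs i) d. mp M f (\<iota> i (\<psi> i f))))"
        unfolding Phi_def by (rule lin_on_sum[OF L S]) (auto intro!: subspD(5)[OF S] m1)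
      also have "\<dots> = (\<Sum>i<n. \<Sum>f\<in>Hom C (cs i) d. mp M h (mp M f (\<iota> i (\<psi> i f))))"
        by (intro sum.cong refl lin_on_sum[OF L S]) (use m1 in simp)
      finally show ?thesis by simp
    qed
    finally show ?thesis using \<psi>(2) by simp
  qed
  then have c: "coef e (mp M h m) = \<chi>" using coef_eqI[OF de(2) \<chi>] by blast
  show "f \<in> Hom C (cs i) d \<Longrightarrow> coef e (mp M h m) i (h \<bullet> f) = coef d m i f"
    using \<chi>1 c by (simp add: \<psi>_def)
  show "f' \<notin> (\<lambda>f. h \<bullet> f) ` Hom C (cs i) d \<Longrightarrow> coef e (mp M h m) i f' = 0"
    using \<chi>2 c by simp
qed

text \<open>Indices outside the image of \<open>h\<close> carry the coefficient 0, on which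
  \<open>F\<close> vanishes. Both \<open>total\<close> and the pairing with the dual are sums of
  this shape.\<close>

lemma coef_map_sum:
  assumes h: "h \<in> Hom C d e" and m: "m \<in> sp M d" and i: "i < n"
    and F: "\<And>f'. f' \<in> Hom C (cs i) e \<Longrightarrow> F f' 0 = (0::'b::comm_monoid_add)"
  shows "(\<Sum>f'\<in>Hom C (cs i) e. F f' (coef e (mp M h m) i f')) = (\<Sum>f\<in>Hom C (cs i) d. F (h \<bullet> f) (coef d m i f))"
proof -
  have "(\<Sum>f'\<in>Hom C (cs i) e. F f' (coef e (mp M h m) i f'))
      = (\<Sum>f'\<in>(\<lambda>f. h \<bullet> f) ` Hom C (cs i) d. F f' (coef e (mp M h m) i f'))"
    using finite_Hom cmp_Hom[OF _ h] coef_map(2)[OF h m i] F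
    by (intro sum.mono_neutral_right) auto
  also have "\<dots> = (\<Sum>f\<in>Hom C (cs i) d. F (h \<bullet> f) (coef e (mp M h m) i (h \<bullet> f)))"
    using mono[OF h] by (subst sum.reindex) (auto simp: inj_on_def)
  also have "\<dots> = (\<Sum>f\<in>Hom C (cs i) d. F (h \<bullet> f) (coef d m i f))"
    by (intro sum.cong refl) (simp add: coef_map(1)[OF h m i])
  finally show ?thesis .
qed

text \<open>The coefficients are the average of a single delta, and averaging spreads it over the
  G_i-orbit of \<open>f\<close> only.\<close>

lemma coef_gen_support:
  assumes "i < n" "f \<in> Hom C (cs i) d" "v \<in> Vs i" "j < n" "f' \<in> Hom C (cs j) d"
    "coef d (mp M f (\<iota> i v)) j f' \<noteq> 0"
  shows "j = i" "\<exists>g\<in>G i. f' = f \<bullet> g"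
proof -
  have "coef d (mp M f (\<iota> i v)) = av d (delta i f v)"
    using coef_P[OF Hom_Ob(2)[OF assms(2)] delta_T[OF assms(1-3)]] P_delta[OF assms(1-3)] by simp
  then have "\<exists>g\<in>G j. \<rho>s j g (delta i f v j (f' \<bullet> g)) \<noteq> 0"
    using assms(4-6) by (auto simp: av_def intro: sum.neutral)
  then obtain g where g: "g \<in> G j" "\<rho>s j g (delta i f v j (f' \<bullet> g)) \<noteq> 0" by blast
  have "delta i f v j (f' \<bullet> g) \<noteq> 0"
    using g lin_on_0[OF repD(3)[OF assms(4) g(1)] repD(1)[OF assms(4)]] by metis
  then have j: "j = i" "f' \<bullet> g = f" by (auto simp: delta_def split: if_splits)
  show "j = i" by (rule j(1))
  have "f' = f \<bullet> inv_mor C (cs i) g" using inv_mor_cancel(1)[OF g(1) assms(5)] j by simp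
  then show "\<exists>g\<in>G i. f' = f \<bullet> g" using inv_mor(1)[OF g(1)] j(1) by blast
qed

end

section \<open>Transport of presentations to coordinate spaces\<close>

context free_module
begin

lemma P_0: "P d 0 = 0"
  using P_add[OF T_0 T_0, of d] by simp

text \<open>Each \<open>Vs i\<close> is replaced by its image \<open>W i\<close> under an injective
  coordinate map, with action and generator map conjugated. That zero representations stay zero is
  recorded for the degree bounds.\<close>

lemma free_pres_nat:
  obtains Vs' :: "nat \<Rightarrow> (nat \<Rightarrow> complex) set" and \<rho>s' \<iota>'
  where "free_pres C M n cs Vs' \<rho>s' \<iota>'" "\<And>i. i < n \<Longrightarrow> Vs i = {0} \<Longrightarrow> Vs' i = {0}"
proof -
  \<comment> \<open>The properties are bundled into one predicate so that a coordinate map can be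
    chosen for all \<open>i\<close> at once.\<close>
  define Q where "Q i L \<longleftrightarrow> (\<forall>u v. L (u + v) = L u + L v) \<and> (\<forall>c v. L (sc c v) = sc c (L v)) \<and> inj_on L (Vs i)"
    for i and L :: "('y \<Rightarrow> complex) \<Rightarrow> nat \<Rightarrow> complex"
  have "\<exists>L. Q i L" if i: "i < n" for i
  proof -
    obtain L :: "('y \<Rightarrow> complex) \<Rightarrow> nat \<Rightarrow> complex" where
      "\<And>u v. L (u + v) = L u + L v" "\<And>c v. L (sc c v) = sc c (L v)" "inj_on L (Vs i)"
      by (rule nat_coordinates[OF repD(1,2)[OF i]]) (rule that)
    then have "Q i L" unfolding Q_def by simp
    then show ?thesis by (intro exI)
  qed
  then obtain L where L: "\<And>i. i < n \<Longrightarrow> Q i (L i)" by metis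
  have Ladd: "L i (u + v) = L i u + L i v" and Lsc: "L i (sc c v) = sc c (L i v)"
    and Linj: "inj_on (L i) (Vs i)" if "i < n" for i u v c
    using L[OF that] unfolding Q_def by simp_all
  have Llin: "lin_on UNIV UNIV (L i)" if "i < n" for i using Ladd[OF that] Lsc[OF that] by (simp add: lin_on_def)
  have sU: "subsp (UNIV :: ('y \<Rightarrow> complex) set)" by (simp add: subsp_def)
  define W where "W i = L i ` Vs i" for i
  define K where "K i = inv_into (Vs i) (L i)" for i
  have KL: "K i (L i v) = v" if "i < n" "v \<in> Vs i" for i v
    unfolding K_def using inv_into_f_f[OF Linj[OF that(1)] that(2)] .
  have LK: "L i (K i w) = w" and KV: "K i w \<in> Vs i" if "w \<in> W i" for i w
    using that f_inv_into_f[of w "L i" "Vs i"] inv_into_into[of w "L i" "Vs i"] unfolding K_def W_def by blast+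
  have LW: "L i v \<in> W i" if "v \<in> Vs i" for i v using that by (simp add: W_def)
  have L0: "L i 0 = 0" if "i < n" for i using lin_on_0[OF Llin[OF that] sU] .
  have Wsub: "subsp (W i)" if i: "i < n" for i
    unfolding subsp_def W_def
    using subspD[OF repD(1)[OF i]] L0[OF i] Ladd[OF i, symmetric] Lsc[OF i, symmetric]
    by (auto intro: rev_image_eqI)
  have Klin: "lin_on (W i) (Vs i) (K i)" if i: "i < n" for i
    unfolding lin_on_def
  proof (intro conjI ballI allI KV)
    fix u v assume uv: "u \<in> W i" "v \<in> W i"
    have "K i (L i (K i u + K i v)) = K i u + K i v"
      by (rule KL[OF i subspD(2)[OF repD(1)[OF i] KV[OF uv(1)] KV[OF uv(2)]]])
    then show "K i (u + v) = K i u + K i v" by (simp add: Ladd[OF i] LK uv)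
  next
    fix c v assume v: "v \<in> W i"
    have "K i (L i (sc c (K i v))) = sc c (K i v)" by (rule KL[OF i subspD(3)[OF repD(1)[OF i] KV[OF v]]])
    then show "K i (sc c v) = sc c (K i v)" by (simp add: Lsc[OF i] LK v)
  qed
  have LlinV: "lin_on (Vs i) (W i) (L i)" if i: "i < n" for i
    using Ladd[OF i] Lsc[OF i] LW by (simp add: lin_on_def)
  define r where "r i g w = L i (\<rho>s i g (K i w))" for i g w
  define j where "j i w = \<iota> i (K i w)" for i w
  interpret N: gen_module C n cs W r M j
  proof
    fix i assume i: "i < n"
    show "cs i \<in> Ob C" by (rule cs_Ob[OF i])
    show "lin_on (W i) (sp M (cs i)) (j i)" unfolding j_def by (rule lin_on_comp[OF Klin gen_lin]) (rule i)+
    show "is_rep C (cs i) (W i) (r i)" unfolding is_rep_def Aut_eq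
    proof (intro conjI ballI Wsub[OF i])
      obtain B where B: "finite B" "B \<subseteq> Vs i" "Vs i \<subseteq> cf.span B" 
        by (rule fdim_sp_span_finite[OF repD(2)[OF i]]) (rule that)
      have "L i v \<in> cf.span (L i ` B)" if "v \<in> Vs i" for v
        using that B(3) by (intro lin_on_span[OF Llin[OF i] sU, where S = B]) (auto intro: cf.span_base)
      then show "fdim_sp (W i)" using B(1) by (intro fdim_spI[OF Wsub[OF i], of "L i ` B"]) (auto simp: W_def)
      fix g assume g: "g \<in> G i"
      show "lin_on (W i) (W i) (r i g)" unfolding r_def
        by (rule lin_on_comp[OF lin_on_comp[OF Klin repD(3)] LlinV]) (rule i g)+
    next
      fix w assume w: "w \<in> W i"
      show "r i (idm C (cs i)) w = w" using repD(4)[OF i KV[OF w]] LK[OF w] by (simp add: r_def)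
    next
      fix g h w assume g: "g \<in> G i" "h \<in> G i" and w: "w \<in> W i"
      show "r i (g \<bullet> h) w = r i g (r i h w)"
        using repD(5)[OF i g KV[OF w]] KL[OF i lin_onD(1)[OF repD(3)[OF i g(2)] KV[OF w]]] by (simp add: r_def)
    qed
  next
    fix i g w assume i: "i < n" and g: "g \<in> G i" and w: "w \<in> W i"
    show "j i (r i g w) = mp M g (j i w)"
      using KL[OF i lin_onD(1)[OF repD(3)[OF i g] KV[OF w]]] gen_equiv[OF i g KV[OF w]] by (simp add: r_def j_def)
  qed (rule module)
  have "free_pres C M n cs W r j"
  proof (rule N.free_presI)
    fix d assume d: "d \<in> Ob C"
    let ?S = "{mp M f (j i v) | i f v. i < n \<and> f \<in> Hom C (cs i) d \<and> v \<in> W i}"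
    show "sp M d \<subseteq> cf.span ?S"
    proof
      fix m assume m: "m \<in> sp M d"
      have "(\<Sum>i<n. \<Sum>f\<in>Hom C (cs i) d. mp M f (\<iota> i (coef d m i f))) \<in> cf.span ?S"
      proof (intro cf.span_sum cf.span_base)
        fix i f assume "i \<in> {..<n}" and f: "f \<in> Hom C (cs i) d"
        then have i: "i < n" by simp
        have c: "coef d m i f \<in> Vs i" by (rule coef_mem[OF d m i f])
        have "mp M f (\<iota> i (coef d m i f)) = mp M f (j i (L i (coef d m i f)))" by (simp add: j_def KL[OF i c])
        then show "mp M f (\<iota> i (coef d m i f)) \<in> ?S" using i f LW[OF c] by blast
      qed
      then show "m \<in> cf.span ?S" using expand[OF d m] by simp
    qed
    fix \<psi>' assume \<psi>': "\<psi>' \<in> N.Teq d" "Phi C M n cs j d \<psi>' = 0"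
    note T' = N.TeqD(1)[OF \<psi>'(1)]
    \<comment> \<open>Pulled back by \<open>K\<close>, the family becomes equivariant for the old
      presentation and has the same value.\<close>
    define \<psi> where "\<psi> = (\<lambda>i f. if i < n \<and> f \<in> Hom C (cs i) d then K i (\<psi>' i f) else 0)"
    have "\<psi> \<in> Teq d" unfolding Teq_def
    proof (intro CollectI conjI allI impI ballI)
      show "\<psi> \<in> T d" using KV[OF N.TD(1)[OF T']] by (intro TI) (auto simp: \<psi>_def)
      fix i f g assume i: "i < n" and f: "f \<in> Hom C (cs i) d" and g: "g \<in> G i"
      note fg = cmp_Hom[OF g f]
      have "r i g (\<psi>' i (f \<bullet> g)) = \<psi>' i f" by (rule N.TeqD(2)[OF \<psi>'(1) i f g])
      then have "K i (r i g (\<psi>' i (f \<bullet> g))) = K i (\<psi>' i f)" by simp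
      then show "\<rho>s i g (\<psi> i (f \<bullet> g)) = \<psi> i f"
        using i f fg KL[OF i lin_onD(1)[OF repD(3)[OF i g] KV[OF N.TD(1)[OF T' i fg]]]] by (simp add: \<psi>_def r_def)
    qed
    moreover have "P d \<psi> = 0" using \<psi>'(2) by (simp add: Phi_def \<psi>_def j_def)
    ultimately have \<psi>0: "\<psi> = 0" using P_inj[OF d _ Teq_0] P_0 by simp
    show "\<psi>' = 0"
    proof (intro ext)
      fix i f x
      have "\<psi>' i f = 0"
      proof (cases "i < n \<and> f \<in> Hom C (cs i) d")
        case True
        then have "K i (\<psi>' i f) = 0" using fun_cong[OF fun_cong[OF \<psi>0, of i], of f] by (simp add: \<psi>_def zero_fun_apply)
        then show ?thesis using LK[OF N.TD(1)[OF T', of i f]] L0[of i] True by simp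
      qed (use N.TD(2)[OF T'] in blast)
      then show "\<psi>' i f x = 0 i f x" by (simp add: zero_fun_apply)
    qed
  qed
  moreover have "W i = {0}" if "i < n" "Vs i = {0}" for i using that L0 by (simp add: W_def)
  ultimately show ?thesis using that by blast
qed

end

lemma (in FI_category) free_deg_leI:
  assumes "free_pres C M n cs Vs \<rho>s \<iota>"
  shows "is_free C M" "pres_deg_le C n cs Vs d \<Longrightarrow> free_deg_le C M d"
proof -
  interpret free_module C M n cs Vs \<rho>s \<iota> using assms by unfold_locales
  obtain Vs' :: "nat \<Rightarrow> (nat \<Rightarrow> complex) set" and \<rho>s' \<iota>' where
    *: "free_pres C M n cs Vs' \<rho>s' \<iota>'" "\<And>i. i < n \<Longrightarrow> Vs i = {0} \<Longrightarrow> Vs' i = {0}"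
    using free_pres_nat by blast
  show "is_free C M" using *(1) unfolding is_free_def by blast
  assume "pres_deg_le C n cs Vs d"
  then have "pres_deg_le C n cs Vs' d" using *(2) unfolding pres_deg_le_def by blast
  then show "free_deg_le C M d" using *(1) unfolding free_deg_le_def by blast
qed

section \<open>Coinvariants\<close>

lemma coset_eq_iff:
  assumes "cf.subspace R"
  shows "{v + r | r. r \<in> R} = {v' + r | r. r \<in> R} \<longleftrightarrow> v - v' \<in> R"
proof
  assume "{v + r | r. r \<in> R} = {v' + r | r. r \<in> R}"
  moreover have "v + 0 \<in> {v + r | r. r \<in> R}" using cf.subspace_0[OF assms] by blast
  ultimately obtain r where "v + 0 = v' + r" "r \<in> R" by blast
  then show "v - v' \<in> R" by (simp add: diff_eq_eq add.commute)
next
  assume R: "v - v' \<in> R"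
  have "v + r = v' + ((v - v') + r)" "v' + r = v + (r - (v - v'))" for r by (simp_all add: algebra_simps)
  then show "{v + r | r. r \<in> R} = {v' + r | r. r \<in> R}"
    using cf.subspace_add[OF assms R] cf.subspace_diff[OF assms _ R] by blast
qed

lemma coinv_rel_sumI:
  assumes "finite A" "\<And>a. a \<in> A \<Longrightarrow> vs a \<in> sp M d" "\<And>a. a \<in> A \<Longrightarrow> gs a \<in> Aut C d"
  shows "(\<Sum>a\<in>A. vs a - mp M (gs a) (vs a)) \<in> coinv_rel C M d"
proof -
  obtain h where h: "bij_betw h {0..<card A} A" using ex_bij_betw_nat_finite[OF assms(1)] by blast
  have "(\<Sum>a\<in>A. vs a - mp M (gs a) (vs a)) = (\<Sum>j<card A. vs (h j) - mp M (gs (h j)) (vs (h j)))"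
    by (subst sum.reindex_bij_betw[OF h, symmetric]) (simp add: atLeast0LessThan)
  then show ?thesis unfolding coinv_rel_def
    by (intro CollectI exI[of _ "card A"] exI[of _ "\<lambda>j. vs (h j)"] exI[of _ "\<lambda>j. gs (h j)"] conjI)
       (use bij_betwE[OF h] assms in auto)
qed

context free_module
begin

text \<open>For \<open>Ind V\<close> the coinvariants at any object above c are the coinvariants of
  V; in characteristic 0 these are the invariants, and by equivariance of the coefficients this sum
  is invariant.\<close>

definition total :: "'o \<Rightarrow> ('x \<Rightarrow> complex) \<Rightarrow> nat \<Rightarrow> 'y \<Rightarrow> complex" where
  "total d m i = (\<Sum>f\<in>Hom C (cs i) d. coef d m i f)"

lemma total_map:
  assumes "h \<in> Hom C d e" "m \<in> sp M d" "i < n" shows "total e (mp M h m) i = total d m i"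
  unfolding total_def using coef_map_sum[OF assms, of "\<lambda>_ v. v"] by simp

lemma total_mem: "d \<in> Ob C \<Longrightarrow> m \<in> sp M d \<Longrightarrow> i < n \<Longrightarrow> total d m i \<in> Vs i"
  unfolding total_def by (intro subspD(5)[OF repD(1)] coef_mem)

lemma total_lin:
  assumes "d \<in> Ob C" "i < n" shows "lin_on (sp M d) (Vs i) (\<lambda>m. total d m i)"
  using coef_lin[OF assms] total_mem[OF assms(1) _ assms(2)]
  by (simp add: total_def lin_on_def sum.distrib cf.scale_sum_right)

text \<open>G_d acts transitively on \<open>Hom C (cs i) d\<close>, so modulo v - g v every term can
  be moved to one chosen morphism \<open>F i\<close>, where the coefficients add up.\<close>

lemma coinv_normal_form:
  assumes d: "d \<in> Ob C" and m: "m \<in> sp M d"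
    and F: "\<And>i. i < n \<Longrightarrow> Hom C (cs i) d \<noteq> {} \<Longrightarrow> F i \<in> Hom C (cs i) d"
  shows "m - (\<Sum>i<n. if Hom C (cs i) d = {} then 0 else mp M (F i) (\<iota> i (total d m i))) \<in> coinv_rel C M d"
proof -
  define x where "x i f = mp M f (\<iota> i (coef d m i f))" for i f
  have gm: "\<iota> i (coef d m i f) \<in> sp M (cs i)" if "i < n" "f \<in> Hom C (cs i) d" for i f
    using lin_onD(1)[OF gen_lin[OF that(1)] coef_mem[OF d m that]] .
  have x: "x i f \<in> sp M d" if "i < n" "f \<in> Hom C (cs i) d" for i f
    unfolding x_def using lin_onD(1)[OF modD(2)[OF that(2)] gm[OF that]] .
  have "\<forall>i f. \<exists>g. i < n \<longrightarrow> f \<in> Hom C (cs i) d \<longrightarrow> g \<in> Hom C d d \<and> g \<bullet> f = F i"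
    using transitive F by blast
  then obtain \<gamma> where \<gamma>: "\<And>i f. i < n \<Longrightarrow> f \<in> Hom C (cs i) d \<Longrightarrow> \<gamma> i f \<in> Hom C d d \<and> \<gamma> i f \<bullet> f = F i"
    by metis
  define A where "A = (SIGMA i:{..<n}. Hom C (cs i) d)"
  have "(\<Sum>a\<in>A. (case a of (i, f) \<Rightarrow> x i f) - mp M (case a of (i, f) \<Rightarrow> \<gamma> i f) (case a of (i, f) \<Rightarrow> x i f)) \<in> coinv_rel C M d"
    by (rule coinv_rel_sumI) (use x \<gamma> finite_Hom in \<open>auto simp: A_def Aut_eq\<close>)
  also have "(\<Sum>a\<in>A. (case a of (i, f) \<Rightarrow> x i f) - mp M (case a of (i, f) \<Rightarrow> \<gamma> i f) (case a of (i, f) \<Rightarrow> x i f))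
      = (\<Sum>i<n. \<Sum>f\<in>Hom C (cs i) d. x i f - mp M (\<gamma> i f) (x i f))"
    unfolding A_def using finite_Hom by (subst sum.Sigma) (auto intro: sum.cong)
  also have "\<dots> = (\<Sum>i<n. \<Sum>f\<in>Hom C (cs i) d. x i f) - (\<Sum>i<n. \<Sum>f\<in>Hom C (cs i) d. mp M (F i) (\<iota> i (coef d m i f)))"
  proof -
    have "mp M (\<gamma> i f) (x i f) = mp M (F i) (\<iota> i (coef d m i f))" if "i < n" "f \<in> Hom C (cs i) d" for i f
      using modD(4)[OF that(2) conjunct1[OF \<gamma>[OF that]] gm[OF that]] conjunct2[OF \<gamma>[OF that]] by (simp add: x_def)
    then show ?thesis by (simp add: sum_subtractf)
  qed
  also have "(\<Sum>i<n. \<Sum>f\<in>Hom C (cs i) d. x i f) = m" using expand[OF d m] by (simp add: x_def)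
  also have "(\<Sum>i<n. \<Sum>f\<in>Hom C (cs i) d. mp M (F i) (\<iota> i (coef d m i f)))
      = (\<Sum>i<n. if Hom C (cs i) d = {} then 0 else mp M (F i) (\<iota> i (total d m i)))"
  proof (rule sum.cong[OF refl])
    fix i assume "i \<in> {..<n}"
    then have i: "i < n" by simp
    show "(\<Sum>f\<in>Hom C (cs i) d. mp M (F i) (\<iota> i (coef d m i f)))
      = (if Hom C (cs i) d = {} then 0 else mp M (F i) (\<iota> i (total d m i)))"
    proof (cases "Hom C (cs i) d = {}")
      case False
      then show ?thesis unfolding total_def
        by (subst lin_on_sum[OF gen_map_lin[OF i F[OF i False]] repD(1)[OF i]]) (simp_all add: coef_mem[OF d m i])
    qed simp
  qed
  finally show ?thesis .
qed

text \<open>An automorphism of \<open>d\<close> only permutes the coefficients, so totals vanish on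
  v - g v; conversely, the normal form of an element with zero totals is 0.\<close>

lemma coinv_rel_eq:
  assumes d: "d \<in> Ob C"
  shows "coinv_rel C M d = {m \<in> sp M d. \<forall>i<n. total d m i = 0}"
proof (intro equalityI subsetI)
  fix m assume "m \<in> coinv_rel C M d"
  then obtain k vs gs where m: "m = (\<Sum>j<(k::nat). vs j - mp M (gs j) (vs j))"
    and c: "\<forall>j<k. vs j \<in> sp M d \<and> gs j \<in> Hom C d d"
    unfolding coinv_rel_def Aut_eq mem_Collect_eq by (elim exE conjE) (rule that)
  have 1: "mp M (gs j) (vs j) \<in> sp M d" if "j < k" for j using c that lin_onD(1)[OF modD(2)] by blast
  have 2: "vs j - mp M (gs j) (vs j) \<in> sp M d" if "j < k" for j
    using subspD(4)[OF modD(1)[OF d]] c 1 that by blast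
  have "total d m i = 0" if i: "i < n" for i
  proof -
    have "total d m i = (\<Sum>j<k. total d (vs j - mp M (gs j) (vs j)) i)"
      unfolding m by (rule lin_on_sum[OF total_lin[OF d i] modD(1)[OF d]]) (use 2 in simp)
    also have "\<dots> = 0"
      using lin_on_diff[OF total_lin[OF d i] modD(1)[OF d]] c 1 total_map[OF _ _ i, of _ d d]
      by (intro sum.neutral) simp
    finally show ?thesis .
  qed
  moreover have "m \<in> sp M d" unfolding m using 2 by (intro subspD(5)[OF modD(1)[OF d]]) simp
  ultimately show "m \<in> {m \<in> sp M d. \<forall>i<n. total d m i = 0}" by blast
next
  fix m assume m: "m \<in> {m \<in> sp M d. \<forall>i<n. total d m i = 0}"
  define F where "F i = (SOME f. f \<in> Hom C (cs i) d)" for i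
  have F: "F i \<in> Hom C (cs i) d" if "Hom C (cs i) d \<noteq> {}" for i
    using that unfolding F_def by (simp add: some_in_eq)
  have "(\<Sum>i<n. if Hom C (cs i) d = {} then 0 else mp M (F i) (\<iota> i (total d m i))) = 0"
    using m lin_on_0[OF gen_map_lin[OF _ F] repD(1)] by (intro sum.neutral) simp
  then show "m \<in> coinv_rel C M d" using coinv_normal_form[OF d, of m F] F m by simp
qed

lemma subspace_coinv_rel:
  assumes d: "d \<in> Ob C" shows "cf.subspace (coinv_rel C M d)"
  using subspD(1-3)[OF modD(1)[OF d]] lin_onD(2,3)[OF total_lin[OF d]] lin_on_0[OF total_lin[OF d] modD(1)[OF d]]
  by (auto simp: coinv_rel_eq[OF d] cf.subspace_def)

lemma coinv_map_coset:
  assumes f: "f \<in> Hom C d e" and v: "v \<in> sp M d"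
  shows "coinv_map C M e f {v + r | r. r \<in> coinv_rel C M d} = {mp M f v + r | r. r \<in> coinv_rel C M e}"
    (is "?L = ?R")
proof (intro equalityI subsetI)
  note de = Hom_Ob[OF f]
  note S = subspace_coinv_rel[OF de(1)] subspace_coinv_rel[OF de(2)]
  fix x assume "x \<in> ?L"
  then obtain r s where x: "x = mp M f (v + r) + s" "r \<in> coinv_rel C M d" "s \<in> coinv_rel C M e"
    unfolding coinv_map_def by blast
  have r: "r \<in> sp M d" "\<forall>i<n. total d r i = 0" using x(2) coinv_rel_eq[OF de(1)] by auto
  have "mp M f r \<in> coinv_rel C M e"
    using r total_map[OF f r(1)] lin_onD(1)[OF modD(2)[OF f] r(1)] by (simp add: coinv_rel_eq[OF de(2)])
  then have "mp M f r + s \<in> coinv_rel C M e" using cf.subspace_add[OF S(2)] x(3) by blast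
  moreover have "x = mp M f v + (mp M f r + s)"
    using lin_onD(2)[OF modD(2)[OF f] v r(1)] x(1) by (simp add: add.assoc)
  ultimately show "x \<in> ?R" by blast
next
  note S = subspace_coinv_rel[OF Hom_Ob(1)[OF f]]
  fix x assume "x \<in> ?R"
  then obtain s where s: "x = mp M f v + s" "s \<in> coinv_rel C M e" by blast
  have "v + 0 \<in> {v + r | r. r \<in> coinv_rel C M d}" using cf.subspace_0[OF S] by blast
  then show "x \<in> ?L" unfolding coinv_map_def using s by fastforce
qed

text \<open>Injectivity: totals detect the coinvariants and are unchanged by \<open>f\<close>.
  Surjectivity: by the degree bound every nonzero \<open>Vs i\<close> has a morphism to
  \<open>d\<close>, so the base morphisms of the normal form at \<open>e\<close> can be taken to
  factor through \<open>f\<close>.\<close>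

lemma coinv_map_bij:
  assumes deg: "pres_deg_le C n cs Vs c" and le: "obj_le C c d" and f: "f \<in> Hom C d e"
  shows "bij_betw (coinv_map C M e f) (coinv C M d) (coinv C M e)"
proof -
  note de = Hom_Ob[OF f]
  note S = subspace_coinv_rel[OF de(1)] subspace_coinv_rel[OF de(2)]
  have "inj_on (coinv_map C M e f) (coinv C M d)"
  proof (rule inj_onI)
    fix X Y assume "X \<in> coinv C M d" "Y \<in> coinv C M d" and eq: "coinv_map C M e f X = coinv_map C M e f Y"
    then obtain v w where v: "v \<in> sp M d" "X = {v + r | r. r \<in> coinv_rel C M d}"
      and w: "w \<in> sp M d" "Y = {w + r | r. r \<in> coinv_rel C M d}" unfolding coinv_def by blast
    note vw = subspD(4)[OF modD(1)[OF de(1)] v(1) w(1)]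
    have "mp M f v - mp M f w \<in> coinv_rel C M e"
      using eq unfolding v w coinv_map_coset[OF f v(1)] coinv_map_coset[OF f w(1)] coset_eq_iff[OF S(2)] .
    then have "mp M f (v - w) \<in> coinv_rel C M e"
      using lin_on_diff[OF modD(2)[OF f] modD(1)[OF de(1)] v(1) w(1)] by simp
    then have "v - w \<in> coinv_rel C M d"
      using vw total_map[OF f vw] by (simp add: coinv_rel_eq[OF de(1)] coinv_rel_eq[OF de(2)])
    then show "X = Y" unfolding v w coset_eq_iff[OF S(1)] .
  qed
  moreover have "coinv_map C M e f ` coinv C M d = coinv C M e"
  proof (intro equalityI subsetI)
    fix Y assume "Y \<in> coinv_map C M e f ` coinv C M d"
    then obtain v where v: "v \<in> sp M d" "Y = coinv_map C M e f {v + r | r. r \<in> coinv_rel C M d}"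
      unfolding coinv_def by blast
    then show "Y \<in> coinv C M e" unfolding v coinv_map_coset[OF f v(1)] coinv_def
      using lin_onD(1)[OF modD(2)[OF f] v(1)] by blast
  next
    fix Y assume "Y \<in> coinv C M e"
    then obtain m where m: "m \<in> sp M e" "Y = {m + r | r. r \<in> coinv_rel C M e}" unfolding coinv_def by blast
    have ne: "Hom C (cs i) d \<noteq> {}" if "i < n" "Vs i \<noteq> {0}" for i
      using deg le that cmp_Hom unfolding pres_deg_le_def obj_le_def by blast
    define F0 where "F0 i = (SOME k. k \<in> Hom C (cs i) d)" for i
    have F0: "F0 i \<in> Hom C (cs i) d" if "i < n" "Vs i \<noteq> {0}" for i
      using ne[OF that] unfolding F0_def by (simp add: some_in_eq)
    \<comment> \<open>Where \<open>Vs i\<close> is zero there may be no morphism to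
      \<open>d\<close>; any morphism to \<open>e\<close> then serves, since the total is 0.\<close>
    define F where "F i = (if Vs i = {0} then SOME k. k \<in> Hom C (cs i) e else f \<bullet> F0 i)" for i
    have F: "F i \<in> Hom C (cs i) e" if "i < n" "Hom C (cs i) e \<noteq> {}" for i
      using that F0[OF that(1)] cmp_Hom[OF _ f] unfolding F_def by (auto simp: some_in_eq)
    \<comment> \<open>A preimage in \<open>sp M d\<close> of each term of the normal form.\<close>
    define y where "y i = (if Vs i = {0} then 0 else mp M (F0 i) (\<iota> i (total e m i)))" for i
    have tm: "total e m i \<in> Vs i" if "i < n" for i using total_mem[OF de(2) m(1) that] .
    have y: "y i \<in> sp M d" if "i < n" for i
      using lin_onD(1)[OF gen_map_lin[OF that F0[OF that]] tm[OF that]] subspD(1)[OF modD(1)[OF de(1)]]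
      by (simp add: y_def)
    have yt: "(if Hom C (cs i) e = {} then 0 else mp M (F i) (\<iota> i (total e m i))) = mp M f (y i)" if i: "i < n" for i
    proof (cases "Vs i = {0}")
      case True
      then have t0: "total e m i = 0" using tm[OF i] by simp
      have "mp M (F i) (\<iota> i 0) = 0" if "Hom C (cs i) e \<noteq> {}"
        using lin_on_0[OF gen_map_lin[OF i F[OF i that]] repD(1)[OF i]] .
      then show ?thesis using True t0 lin_on_0[OF modD(2)[OF f] modD(1)[OF de(1)]] by (simp add: y_def)
    next
      case False
      have "f \<bullet> F0 i \<in> Hom C (cs i) e" using cmp_Hom[OF F0[OF i False] f] .
      then show ?thesis
        using False modD(4)[OF F0[OF i False] f lin_onD(1)[OF gen_lin[OF i] tm[OF i]]] by (auto simp: y_def F_def)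
    qed
    define z where "z = (\<Sum>i<n. y i)"
    have z: "z \<in> sp M d" unfolding z_def using y by (intro subspD(5)[OF modD(1)[OF de(1)]]) simp
    have "mp M f z = (\<Sum>i<n. mp M f (y i))" unfolding z_def
      by (rule lin_on_sum[OF modD(2)[OF f] modD(1)[OF de(1)]]) (use y in simp)
    also have "\<dots> = (\<Sum>i<n. if Hom C (cs i) e = {} then 0 else mp M (F i) (\<iota> i (total e m i)))"
      using yt by (intro sum.cong refl) simp
    finally have "m - mp M f z \<in> coinv_rel C M e" using coinv_normal_form[OF de(2) m(1), of F] F by simp
    then have "Y = {mp M f z + r | r. r \<in> coinv_rel C M e}" unfolding m coset_eq_iff[OF S(2)] .
    then have "Y = coinv_map C M e f {z + r | r. r \<in> coinv_rel C M d}" using coinv_map_coset[OF f z] by simp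
    then show "Y \<in> coinv_map C M e f ` coinv C M d" unfolding coinv_def using z by blast
  qed
  ultimately show ?thesis by (simp add: bij_betw_def)
qed

end

section \<open>Tensor products of modules\<close>

context FI_category
begin

lemma sp_tensor: "sp (tensor C M N) d = tens (sp M d) (sp N d)"
  by (simp add: tensor_def tens_def)

text \<open>The choice in \<open>tensor\<close> ranges over decompositions and over source and
  target objects. Disjointness of Hom-sets fixes the source, and bilinearity makes all
  decompositions give the same value.\<close>

lemma mp_tensor:
  assumes M: "is_module C M" and N: "is_module C N" and h: "h \<in> Hom C c d"
    and w: "w \<in> tens (sp M c) (sp N c)"
  shows "mp (tensor C M N) h w = Tlift (sp M c) (sp N c) (\<lambda>u v. pt (mp M h u) (mp N h v)) w"
proof -
  note S = moduleD(1)[OF M Hom_Ob(1)[OF h]] moduleD(1)[OF N Hom_Ob(1)[OF h]]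
  have b: "bilin (sp M c) (sp N c) (\<lambda>u v. pt (mp M h u) (mp N h v) x)" for x
    by (rule bilin_pt[OF moduleD(2)[OF M h] moduleD(2)[OF N h]])
  let ?R = "\<lambda>w'. \<exists>c d k us vs. h \<in> Hom C c d \<and> (\<forall>i<k. us i \<in> sp M c \<and> vs i \<in> sp N c) \<and>
      w = (\<Sum>i<(k::nat). pt (us i) (vs i)) \<and> w' = (\<Sum>i<(k::nat). pt (mp M h (us i)) (mp N h (vs i)))"
  obtain k :: nat and us vs where 1: "w = (\<Sum>i<k. pt (us i) (vs i))"
    "\<And>i. i < k \<Longrightarrow> us i \<in> sp M c" "\<And>i. i < k \<Longrightarrow> vs i \<in> sp N c" by (rule tensE[OF w]) (rule that)
  have "?R (\<Sum>i<k. pt (mp M h (us i)) (mp N h (vs i)))"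
    by (intro exI[of _ c] exI[of _ d] exI[of _ k] exI[of _ us] exI[of _ vs] conjI) (use h 1 in auto)
  then have "(SOME w'. ?R w') = Tlift (sp M c) (sp N c) (\<lambda>u v. pt (mp M h u) (mp N h v)) w"
  proof (rule someI2[where P = ?R and Q = "\<lambda>w'. w' = Tlift (sp M c) (sp N c) (\<lambda>u v. pt (mp M h u) (mp N h v)) w"])
    fix w' assume "?R w'"
    then obtain c' d' l us' vs' where 2: "h \<in> Hom C c' d'" "\<forall>i<(l::nat). us' i \<in> sp M c' \<and> vs' i \<in> sp N c'"
      "w = (\<Sum>i<l. pt (us' i) (vs' i))" "w' = (\<Sum>i<l. pt (mp M h (us' i)) (mp N h (vs' i)))"
      by (elim exE conjE) (rule that)
    have "c' = c" using Hom_disjoint[OF 2(1) h] by blast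
    then have m: "\<And>i. i \<in> {..<l} \<Longrightarrow> us' i \<in> sp M c" "\<And>i. i \<in> {..<l} \<Longrightarrow> vs' i \<in> sp N c" using 2(2) by simp_all
    show "w' = Tlift (sp M c) (sp N c) (\<lambda>u v. pt (mp M h u) (mp N h v)) w"
      unfolding 2(3,4) Tlift_def
      by (rule ext) (simp only: tlift_sum[OF finite_lessThan b S m] sum_fun_apply)
  qed
  then show ?thesis by (simp add: tensor_def)
qed

lemma mp_tensor_pt:
  assumes M: "is_module C M" and N: "is_module C N" and h: "h \<in> Hom C c d" and "u \<in> sp M c" "v \<in> sp N c"
  shows "mp (tensor C M N) h (pt u v) = pt (mp M h u) (mp N h v)"
  unfolding mp_tensor[OF M N h pt_in_tens[OF assms(4,5)]]
  using moduleD(1)[OF M Hom_Ob(1)[OF h]] moduleD(1)[OF N Hom_Ob(1)[OF h]] assms(4,5)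
  by (intro Tlift_pt bilin_pt[OF moduleD(2)[OF M h] moduleD(2)[OF N h]])

lemma tensor_module:
  assumes M: "is_module C M" and N: "is_module C N"
  shows "is_module C (tensor C M N)"
proof -
  let ?T = "tensor C M N"
  have sub: "subsp (tens (sp M d) (sp N d))" if "d \<in> Ob C" for d by (rule subsp_tens[OF moduleD(1)[OF M that]])
  have lin: "lin_on (tens (sp M c) (sp N c)) (tens (sp M d) (sp N d)) (mp ?T h)" if h: "h \<in> Hom C c d" for h c d
  proof -
    note S = moduleD(1)[OF M Hom_Ob(1)[OF h]] moduleD(1)[OF N Hom_Ob(1)[OF h]]
    let ?L = "Tlift (sp M c) (sp N c) (\<lambda>u v. pt (mp M h u) (mp N h v))"
    have b: "bilin (sp M c) (sp N c) (\<lambda>u v. pt (mp M h u) (mp N h v) x)" for x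
      by (rule bilin_pt[OF moduleD(2)[OF M h] moduleD(2)[OF N h]])
    have L: "lin_on (tens (sp M c) (sp N c)) UNIV ?L" by (rule lin_on_Tlift[OF b S])
    \<comment> \<open>The codomain of \<open>Tlift\<close> is unrestricted, so membership is checked
      on elementary tensors and extended by additivity.\<close>
    have mem: "mp ?T h t \<in> tens (sp M d) (sp N d)" if "t \<in> tens (sp M c) (sp N c)" for t
      using that
    proof (induction rule: tens_induct)
      case zero
      have "mp ?T h 0 = 0"
        using mp_tensor[OF M N h subspD(1)[OF sub[OF Hom_Ob(1)[OF h]]]]
          lin_on_0[OF L sub[OF Hom_Ob(1)[OF h]]] by simp
      then show "mp ?T h 0 \<in> tens (sp M d) (sp N d)" using subspD(1)[OF sub[OF Hom_Ob(2)[OF h]]] by simp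
    next
      case (pt u v)
      then show "mp ?T h (pt u v) \<in> tens (sp M d) (sp N d)"
        unfolding mp_tensor_pt[OF M N h pt]
        by (intro pt_in_tens lin_onD(1)[OF moduleD(2)[OF M h]] lin_onD(1)[OF moduleD(2)[OF N h]])
    next
      case (add s t)
      have "mp ?T h (s + t) = mp ?T h s + mp ?T h t"
        using mp_tensor[OF M N h] add(1,2) tens_add[OF add(1,2)] lin_onD(2)[OF L add(1,2)] by simp
      then show "mp ?T h (s + t) \<in> tens (sp M d) (sp N d)" using tens_add[OF add(3,4)] by simp
    qed
    show ?thesis
      unfolding lin_on_def
      using mem mp_tensor[OF M N h] lin_onD(2,3)[OF L] subspD(2,3)[OF sub[OF Hom_Ob(1)[OF h]]] by simp
  qed
  have id: "mp ?T (idm C c) t = t" if c: "c \<in> Ob C" and t: "t \<in> tens (sp M c) (sp N c)" for c t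
    using t
  proof (induction rule: tens_induct)
    case zero
    show "mp ?T (idm C c) 0 = 0" by (rule lin_on_0[OF lin[OF id_Hom[OF c]] sub[OF c]])
  next
    case (pt u v)
    show "mp ?T (idm C c) (pt u v) = pt u v"
      using mp_tensor_pt[OF M N id_Hom[OF c] pt] moduleD(3)[OF M c pt(1)] moduleD(3)[OF N c pt(2)] by simp
  next
    case (add s t)
    show "mp ?T (idm C c) (s + t) = s + t" using lin_onD(2)[OF lin[OF id_Hom[OF c]] add(1,2)] add(3,4) by simp
  qed
  have comp: "mp ?T (g \<bullet> f) t = mp ?T g (mp ?T f t)"
    if f: "f \<in> Hom C c d" and g: "g \<in> Hom C d e" and t: "t \<in> tens (sp M c) (sp N c)" for c d e f g t
    using t
  proof (induction rule: tens_induct)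
    case zero
    note c = Hom_Ob[OF f]
    show "mp ?T (g \<bullet> f) 0 = mp ?T g (mp ?T f 0)"
      using lin_on_0[OF lin[OF cmp_Hom[OF f g]] sub[OF c(1)]] lin_on_0[OF lin[OF f] sub[OF c(1)]]
        lin_on_0[OF lin[OF g] sub[OF c(2)]] by simp
  next
    case (pt u v)
    note m = lin_onD(1)[OF moduleD(2)[OF M f] pt(1)] lin_onD(1)[OF moduleD(2)[OF N f] pt(2)]
    show "mp ?T (g \<bullet> f) (pt u v) = mp ?T g (mp ?T f (pt u v))"
      using mp_tensor_pt[OF M N cmp_Hom[OF f g] pt] mp_tensor_pt[OF M N f pt] mp_tensor_pt[OF M N g m]
        moduleD(4)[OF M f g pt(1)] moduleD(4)[OF N f g pt(2)] by simp
  next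
    case (add s t)
    show "mp ?T (g \<bullet> f) (s + t) = mp ?T g (mp ?T f (s + t))"
      using lin_onD(2)[OF lin[OF cmp_Hom[OF f g]] add(1,2)] lin_onD(2)[OF lin[OF f] add(1,2)]
        lin_onD(2)[OF lin[OF g] lin_onD(1)[OF lin[OF f] add(1)] lin_onD(1)[OF lin[OF f] add(2)]] add(3,4) by simp
  qed
  show ?thesis unfolding is_module_def sp_tensor using sub lin id comp by blast
qed

end

section \<open>The pairing with the dual module\<close>

lemma dualV_lin_fun: "\<phi> \<in> dualV V \<Longrightarrow> lin_fun V \<phi>"
  by (simp add: dualV_def)

text \<open>Evaluation at a point is cut off outside \<open>V\<close>, as \<open>dualV\<close>
  demands. These functionals separate vectors and serve as test functionals for
  non-degeneracy.\<close>

lemma evaluation_in_dualV: "subsp V \<Longrightarrow> (\<lambda>v. if v \<in> V then v x else 0) \<in> dualV V"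
  using subspD(2,3)[of V] by (simp add: dualV_def lin_fun_def plus_fun_apply sc_apply)

text \<open>Degree bounds ignore zero representations, so they pass to the dual module once zero has
  zero dual.\<close>

lemma dualV_zero: "dualV {0} = {0}"
proof -
  have "\<phi> = 0" if "\<phi> \<in> dualV {0}" for \<phi>
  proof
    fix v
    have "\<phi> 0 = 0" using lin_fun_0[OF dualV_lin_fun[OF that]] by (simp add: subsp_def)
    then show "\<phi> v = 0 v" using that by (cases "v = 0") (auto simp: dualV_def zero_fun_apply)
  qed
  moreover have "(0 :: ('a \<Rightarrow> complex) \<Rightarrow> complex) \<in> dualV {0}"
    by (simp add: dualV_def lin_fun_def zero_fun_apply)
  ultimately show ?thesis by blast
qed

locale dual_modules =
  M: free_module C M n cs Vs \<rho>s \<iota> +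
  D: free_module C M' n cs "\<lambda>i. dualV (Vs i)" "\<lambda>i. dual_act C (cs i) (Vs i) (\<rho>s i)" \<iota>'
  for C :: "('o, 'm) cat" and M :: "('m, 'o, 'x) cmod" and n cs
    and Vs :: "nat \<Rightarrow> ('y \<Rightarrow> complex) set" and \<rho>s \<iota> and M' :: "('m, 'o, 'w) cmod" and \<iota>'
begin

text \<open>Each orbit of G_i on \<open>Hom C (cs i) d\<close> contributes |G_i| equal terms. The
  factor affects neither invariance nor perfectness and is not divided out.\<close>

definition \<beta> :: "'o \<Rightarrow> ('w \<Rightarrow> complex) \<Rightarrow> ('x \<Rightarrow> complex) \<Rightarrow> complex" where
  "\<beta> d x y = (\<Sum>i<n. \<Sum>f\<in>Hom C (cs i) d. D.coef d x i f (M.coef d y i f))"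

lemma coef_lin_fun: "d \<in> Ob C \<Longrightarrow> x \<in> sp M' d \<Longrightarrow> i < n \<Longrightarrow> f \<in> Hom C (cs i) d \<Longrightarrow> lin_fun (Vs i) (D.coef d x i f)"
  by (rule dualV_lin_fun[OF D.coef_mem])

lemma bilin_\<beta>:
  assumes d: "d \<in> Ob C" shows "bilin (sp M' d) (sp M d) (\<beta> d)"
  unfolding bilin_def
proof (intro conjI ballI)
  fix x assume x: "x \<in> sp M' d"
  have "D.coef d x i f (M.coef d (u + v) i f) = D.coef d x i f (M.coef d u i f) + D.coef d x i f (M.coef d v i f)"
    and "D.coef d x i f (M.coef d (sc a u) i f) = a * D.coef d x i f (M.coef d u i f)"
    if "i < n" "f \<in> Hom C (cs i) d" "u \<in> sp M d" "v \<in> sp M d" for i f u v a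
    using coef_lin_fun[OF d x that(1,2)] lin_onD(2,3)[OF M.coef_lin[OF d that(1,2)]] M.coef_mem[OF d _ that(1,2)] that(3,4)
    by (simp_all add: lin_fun_def)
  then show "lin_fun (sp M d) (\<beta> d x)" by (simp add: lin_fun_def \<beta>_def sum.distrib sum_distrib_left)
next
  fix y assume y: "y \<in> sp M d"
  have "D.coef d (u + v) i f (M.coef d y i f) = D.coef d u i f (M.coef d y i f) + D.coef d v i f (M.coef d y i f)"
    and "D.coef d (sc a u) i f (M.coef d y i f) = a * D.coef d u i f (M.coef d y i f)"
    if "i < n" "f \<in> Hom C (cs i) d" "u \<in> sp M' d" "v \<in> sp M' d" for i f u v a
    using lin_onD(2,3)[OF D.coef_lin[OF d that(1,2)]] that(3,4) by (simp_all add: plus_fun_apply sc_apply)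
  then show "lin_fun (sp M' d) (\<lambda>x. \<beta> d x y)" by (simp add: lin_fun_def \<beta>_def sum.distrib sum_distrib_left)
qed

lemma \<beta>_invariant:
  assumes h: "h \<in> Hom C d e" and x: "x \<in> sp M' d" and y: "y \<in> sp M d"
  shows "\<beta> e (mp M' h x) (mp M h y) = \<beta> d x y"
  unfolding \<beta>_def
proof (rule sum.cong[OF refl])
  fix i assume "i \<in> {..<n}"
  then have i: "i < n" by simp
  have x': "mp M' h x \<in> sp M' e" using lin_onD(1)[OF D.modD(2)[OF h] x] .
  have "(\<Sum>f'\<in>Hom C (cs i) e. D.coef e (mp M' h x) i f' (M.coef e (mp M h y) i f'))
      = (\<Sum>f\<in>Hom C (cs i) d. D.coef e (mp M' h x) i (cmp C h f) (M.coef d y i f))"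
    by (rule M.coef_map_sum[OF h y i])
       (rule lin_fun_0[OF coef_lin_fun[OF M.Hom_Ob(2)[OF h] x' i] M.repD(1)[OF i]])
  also have "\<dots> = (\<Sum>f\<in>Hom C (cs i) d. D.coef d x i f (M.coef d y i f))"
    by (rule sum.cong[OF refl]) (simp add: D.coef_map(1)[OF h x i])
  finally show "(\<Sum>f'\<in>Hom C (cs i) e. D.coef e (mp M' h x) i f' (M.coef e (mp M h y) i f'))
      = (\<Sum>f\<in>Hom C (cs i) d. D.coef d x i f (M.coef d y i f))" .
qed

text \<open>Averaging one argument changes nothing once the other is equivariant, because each g can
  be moved across the pairing. The right argument may therefore be given by any family, in
  particular by a single delta.\<close>

lemma \<beta>_P_right:
  assumes d: "d \<in> Ob C" and x: "x \<in> sp M' d" and \<psi>: "\<psi> \<in> M.T d"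
  shows "\<beta> d x (M.P d \<psi>) = (\<Sum>i<n. \<Sum>f\<in>Hom C (cs i) d. D.coef d x i f (\<psi> i f))"
  unfolding \<beta>_def M.coef_P[OF d \<psi>]
proof (rule sum.cong[OF refl])
  fix i assume "i \<in> {..<n}"
  then have i: "i < n" by simp
  let ?H = "Hom C (cs i) d" and ?G = "Hom C (cs i) (cs i)" and ?c = "D.coef d x i"
  let ?a = "1 / of_nat (card ?G) :: complex"
  note V = M.repD[OF i]
  have mem: "\<psi> i f \<in> Vs i" if "f \<in> ?H" for f using M.TD(1)[OF \<psi> i that] .
  have rm: "\<rho>s i g (\<psi> i (cmp C f g)) \<in> Vs i" if "f \<in> ?H" "g \<in> ?G" for f g
    using lin_onD(1)[OF V(3)[OF that(2)] mem[OF M.cmp_Hom[OF that(2,1)]]] .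
  \<comment> \<open>The dual action contains the inverse of g, which cancels the g applied to the
    vector.\<close>
  have eq: "?c f (\<rho>s i g (\<psi> i (cmp C f g))) = ?c (cmp C f g) (\<psi> i (cmp C f g))" if f: "f \<in> ?H" and g: "g \<in> ?G" for f g
  proof -
    let ?v = "\<psi> i (cmp C f g)"
    note m = mem[OF M.cmp_Hom[OF g f]]
    have "?c f (\<rho>s i g ?v) = dual_act C (cs i) (Vs i) (\<rho>s i) g (?c (cmp C f g)) (\<rho>s i g ?v)"
      using D.TeqD(2)[OF D.coef(1)[OF d x] i f g] by simp
    also have "\<dots> = ?c (cmp C f g) (\<rho>s i (inv_mor C (cs i) g) (\<rho>s i g ?v))"
      using rm[OF f g] by (simp add: dual_act_def)
    also have "\<rho>s i (inv_mor C (cs i) g) (\<rho>s i g ?v) = ?v"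
      using V(5)[OF M.inv_mor(1)[OF g] g m] M.inv_mor(2)[OF g] V(4)[OF m] by simp
    finally show ?thesis .
  qed
  have "(\<Sum>f\<in>?H. ?c f (M.av d \<psi> i f)) = (\<Sum>f\<in>?H. \<Sum>g\<in>?G. ?a * ?c (cmp C f g) (\<psi> i (cmp C f g)))"
  proof (rule sum.cong[OF refl])
    fix f assume f: "f \<in> ?H"
    note l = coef_lin_fun[OF d x i f]
    have s: "(\<Sum>g\<in>?G. \<rho>s i g (\<psi> i (cmp C f g))) \<in> Vs i" by (rule subspD(5)[OF V(1) rm[OF f]])
    have "?c f (M.av d \<psi> i f) = ?a * ?c f (\<Sum>g\<in>?G. \<rho>s i g (\<psi> i (cmp C f g)))"
      using l i f s by (simp add: M.av_def lin_fun_def)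
    also have "?c f (\<Sum>g\<in>?G. \<rho>s i g (\<psi> i (cmp C f g))) = (\<Sum>g\<in>?G. ?c f (\<rho>s i g (\<psi> i (cmp C f g))))"
      by (rule lin_fun_sum[OF l V(1) rm[OF f]])
    also have "\<dots> = (\<Sum>g\<in>?G. ?c (cmp C f g) (\<psi> i (cmp C f g)))"
      by (rule sum.cong[OF refl eq[OF f]])
    finally show "?c f (M.av d \<psi> i f) = (\<Sum>g\<in>?G. ?a * ?c (cmp C f g) (\<psi> i (cmp C f g)))"
      by (simp add: sum_distrib_left)
  qed
  also have "\<dots> = (\<Sum>g\<in>?G. \<Sum>f\<in>?H. ?a * ?c (cmp C f g) (\<psi> i (cmp C f g)))" by (rule sum.swap)
  also have "\<dots> = (\<Sum>g\<in>?G. \<Sum>f\<in>?H. ?a * ?c f (\<psi> i f))"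
    by (intro sum.cong refl sum.reindex_bij_betw[OF M.bij_precomp])
  also have "\<dots> = (\<Sum>f\<in>?H. ?c f (\<psi> i f))" using M.card_G[OF i] by (simp add: sum_divide_distrib[symmetric])
  finally show "(\<Sum>f\<in>?H. ?c f (M.av d \<psi> i f)) = (\<Sum>f\<in>?H. ?c f (\<psi> i f))" .
qed

text \<open>The mirror image of \<open>\<beta>_P_right\<close>: here the family on the dual side is
  averaged and the coefficients of \<open>y\<close> are equivariant.\<close>

lemma \<beta>_P_left:
  assumes d: "d \<in> Ob C" and y: "y \<in> sp M d" and \<phi>: "\<phi> \<in> D.T d"
  shows "\<beta> d (D.P d \<phi>) y = (\<Sum>i<n. \<Sum>f\<in>Hom C (cs i) d. \<phi> i f (M.coef d y i f))"
  unfolding \<beta>_def D.coef_P[OF d \<phi>]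
proof (rule sum.cong[OF refl])
  fix i assume "i \<in> {..<n}"
  then have i: "i < n" by simp
  let ?H = "Hom C (cs i) d" and ?G = "Hom C (cs i) (cs i)" and ?c = "M.coef d y i"
  let ?a = "1 / of_nat (card ?G) :: complex"
  note V = M.repD[OF i]
  have "(\<Sum>f\<in>?H. D.av d \<phi> i f (?c f)) = (\<Sum>f\<in>?H. \<Sum>g\<in>?G. ?a * \<phi> i (cmp C f g) (?c (cmp C f g)))"
  proof (rule sum.cong[OF refl])
    fix f assume f: "f \<in> ?H"
    have "dual_act C (cs i) (Vs i) (\<rho>s i) g (\<phi> i (cmp C f g)) (?c f) = \<phi> i (cmp C f g) (?c (cmp C f g))"
      if g: "g \<in> ?G" for g
    proof -
      note m = M.coef_mem[OF d y i M.cmp_Hom[OF g f]]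
      have "\<rho>s i (inv_mor C (cs i) g) (?c f) = \<rho>s i (inv_mor C (cs i) g) (\<rho>s i g (?c (cmp C f g)))"
        using M.TeqD(2)[OF M.coef(1)[OF d y] i f g] by simp
      also have "\<dots> = ?c (cmp C f g)"
        using V(5)[OF M.inv_mor(1)[OF g] g m] M.inv_mor(2)[OF g] V(4)[OF m] by simp
      finally show ?thesis using M.coef_mem[OF d y i f] by (simp add: dual_act_def)
    qed
    then show "D.av d \<phi> i f (?c f) = (\<Sum>g\<in>?G. ?a * \<phi> i (cmp C f g) (?c (cmp C f g)))"
      using i f by (simp add: D.av_def sc_apply sum_fun_apply sum_distrib_left)
  qed
  also have "\<dots> = (\<Sum>g\<in>?G. \<Sum>f\<in>?H. ?a * \<phi> i (cmp C f g) (?c (cmp C f g)))" by (rule sum.swap)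
  also have "\<dots> = (\<Sum>g\<in>?G. \<Sum>f\<in>?H. ?a * \<phi> i f (?c f))"
    by (intro sum.cong refl sum.reindex_bij_betw[OF M.bij_precomp])
  also have "\<dots> = (\<Sum>f\<in>?H. \<phi> i f (?c f))" using M.card_G[OF i] by (simp add: sum_divide_distrib[symmetric])
  finally show "(\<Sum>f\<in>?H. D.av d \<phi> i f (?c f)) = (\<Sum>f\<in>?H. \<phi> i f (?c f))" .
qed

lemma sum_delta_apply:
  assumes "i < n" "f \<in> Hom C (cs i) d" "\<And>j h. j < n \<Longrightarrow> h \<in> Hom C (cs j) d \<Longrightarrow> F j h 0 = (0::complex)"
  shows "(\<Sum>j<n. \<Sum>h\<in>Hom C (cs j) d. F j h (delta i f v j h)) = F i f v"
proof -
  have "(\<Sum>j<n. \<Sum>h\<in>Hom C (cs j) d. F j h (delta i f v j h))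
      = (\<Sum>j<n. \<Sum>h\<in>Hom C (cs j) d. if j = i then if h = f then F i f v else 0 else 0)"
    using assms(3) by (intro sum.cong refl) (auto simp: delta_def)
  also have "\<dots> = (\<Sum>j<n. if j = i then \<Sum>h\<in>Hom C (cs j) d. if h = f then F i f v else 0 else 0)"
    by (intro sum.cong refl) simp
  also have "\<dots> = F i f v" using assms(1,2) M.finite_Hom by simp
  finally show ?thesis .
qed

lemma \<beta>_nondegenerate_left:
  assumes d: "d \<in> Ob C" and x: "x \<in> sp M' d" and 0: "\<And>y. y \<in> sp M d \<Longrightarrow> \<beta> d x y = 0"
  shows "x = 0"
proof -
  have "D.coef d x i f = 0" if i: "i < n" and f: "f \<in> Hom C (cs i) d" for i f
  proof
    fix v
    show "D.coef d x i f v = 0 v"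
    proof (cases "v \<in> Vs i")
      case True
      note \<delta> = M.delta_T[OF i f True]
      \<comment> \<open>Pairing with the element represented by a single delta reads off the value
        of the coefficient at \<open>v\<close>.\<close>
      have "D.coef d x i f v = \<beta> d x (M.P d (delta i f v))"
        unfolding \<beta>_P_right[OF d x \<delta>]
        by (rule sum_delta_apply[OF i f, symmetric]) (rule lin_fun_0[OF coef_lin_fun[OF d x] M.repD(1)])
      then show ?thesis using 0[OF M.P_in[OF d \<delta>]] by (simp add: zero_fun_apply)
    next
      case False
      then show ?thesis using D.coef_mem[OF d x i f] by (simp add: dualV_def zero_fun_apply)
    qed
  qed
  then have "D.P d (D.coef d x) = 0"
    using lin_on_0[OF D.gen_map_lin D.repD(1)] by (simp add: Phi_def)
  then show ?thesis using D.coef(2)[OF d x] by simp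
qed

lemma \<beta>_nondegenerate_right:
  assumes d: "d \<in> Ob C" and y: "y \<in> sp M d" and 0: "\<And>x. x \<in> sp M' d \<Longrightarrow> \<beta> d x y = 0"
  shows "y = 0"
proof -
  have "M.coef d y i f = 0" if i: "i < n" and f: "f \<in> Hom C (cs i) d" for i f
  proof
    fix z
    \<comment> \<open>Evaluation at \<open>z\<close> as test functional makes the pairing read off
      one coordinate of the coefficient.\<close>
    let ?\<phi> = "\<lambda>v. if v \<in> Vs i then v z else 0"
    note \<delta> = D.delta_T[OF i f evaluation_in_dualV[OF M.repD(1)[OF i], of z]]
    have "?\<phi> (M.coef d y i f) = \<beta> d (D.P d (delta i f ?\<phi>)) y"
      unfolding \<beta>_P_left[OF d y \<delta>]
      by (rule sum_delta_apply[OF i f, symmetric, where F = "\<lambda>j h \<phi>. \<phi> (M.coef d y j h)"])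
         (simp add: zero_fun_apply)
    then show "M.coef d y i f z = 0 z"
      using 0[OF D.P_in[OF d \<delta>]] M.coef_mem[OF d y i f] by (simp add: zero_fun_apply)
  qed
  then have "M.P d (M.coef d y) = 0"
    using lin_on_0[OF M.gen_map_lin M.repD(1)] by (simp add: Phi_def)
  then show ?thesis using M.coef(2)[OF d y] by simp
qed

lemma \<beta>_dual_bij:
  assumes d: "d \<in> Ob C"
  shows "bij_betw (\<lambda>x y. if y \<in> sp M d then \<beta> d x y else 0) (sp M' d) (dualV (sp M d))"
proof -
  note B = bilin_\<beta>[OF d, unfolded bilin_def]
  have "inj_on (\<lambda>x y. if y \<in> sp M d then \<beta> d x y else 0) (sp M' d)"
  proof (rule inj_onI)
    fix x x' assume x: "x \<in> sp M' d" "x' \<in> sp M' d"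
      and eq: "(\<lambda>y. if y \<in> sp M d then \<beta> d x y else 0) = (\<lambda>y. if y \<in> sp M d then \<beta> d x' y else 0)"
    note S = D.modD(1)[OF d]
    have "\<beta> d (x - x') y = 0" if y: "y \<in> sp M d" for y
    proof -
      have l: "lin_fun (sp M' d) (\<lambda>x. \<beta> d x y)" using B y by blast
      have "\<beta> d (x - x' + x') y = \<beta> d (x - x') y + \<beta> d x' y"
        using l subspD(4)[OF S x] x(2) unfolding lin_fun_def by blast
      moreover have "\<beta> d x y = \<beta> d x' y" using fun_cong[OF eq, of y] y by simp
      ultimately show ?thesis by simp
    qed
    then have "x - x' = 0" by (rule \<beta>_nondegenerate_left[OF d subspD(4)[OF S x]])
    then show "x = x'" by simp
  qed
  moreover have "(\<lambda>x y. if y \<in> sp M d then \<beta> d x y else 0) ` sp M' d = dualV (sp M d)"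
  proof (intro equalityI subsetI)
    fix l assume "l \<in> (\<lambda>x y. if y \<in> sp M d then \<beta> d x y else 0) ` sp M' d"
    then obtain x where x: "x \<in> sp M' d" "l = (\<lambda>y. if y \<in> sp M d then \<beta> d x y else 0)" by blast
    have "lin_fun (sp M d) (\<beta> d x)" using B x(1) by blast
    then show "l \<in> dualV (sp M d)" unfolding x(2)
      using subspD(2,3)[OF M.modD(1)[OF d]] by (simp add: dualV_def lin_fun_def)
  next
    fix l assume l: "l \<in> dualV (sp M d)"
    note ll = dualV_lin_fun[OF l]
    \<comment> \<open>The functional \<open>l\<close> is pulled back along the generators;
      \<open>\<beta>_P_left\<close> pairs this family with \<open>y\<close> directly, and
      \<open>expand\<close> for \<open>y\<close> returns \<open>l y\<close>.\<close>
    define \<phi> where "\<phi> = (\<lambda>i f. if i < n \<and> f \<in> Hom C (cs i) d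
      then (\<lambda>v. if v \<in> Vs i then l (mp M f (\<iota> i v)) else 0) else 0)"
    have \<phi>: "\<phi> \<in> D.T d"
    proof (rule D.TI)
      fix i f assume i: "i < n" and f: "f \<in> Hom C (cs i) d"
      show "\<phi> i f \<in> dualV (Vs i)"
        using i f ll lin_onD[OF M.gen_map_lin[OF i f]] subspD(2,3)[OF M.repD(1)[OF i]]
        by (simp add: \<phi>_def dualV_def lin_fun_def)
    qed (auto simp: \<phi>_def)
    have "\<beta> d (D.P d \<phi>) y = l y" if y: "y \<in> sp M d" for y
    proof -
      note S = M.modD(1)[OF d]
      have m: "mp M f (\<iota> i (M.coef d y i f)) \<in> sp M d" if "i < n" "f \<in> Hom C (cs i) d" for i f
        using lin_onD(1)[OF M.gen_map_lin[OF that] M.coef_mem[OF d y that]] .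
      have "\<beta> d (D.P d \<phi>) y = (\<Sum>i<n. \<Sum>f\<in>Hom C (cs i) d. l (mp M f (\<iota> i (M.coef d y i f))))"
        unfolding \<beta>_P_left[OF d y \<phi>] using M.coef_mem[OF d y] by (intro sum.cong refl) (simp add: \<phi>_def)
      also have "\<dots> = (\<Sum>i<n. l (\<Sum>f\<in>Hom C (cs i) d. mp M f (\<iota> i (M.coef d y i f))))"
        using m by (intro sum.cong refl lin_fun_sum[OF ll S, symmetric]) simp
      also have "\<dots> = l (\<Sum>i<n. \<Sum>f\<in>Hom C (cs i) d. mp M f (\<iota> i (M.coef d y i f)))"
        using m by (intro lin_fun_sum[OF ll S, symmetric] subspD(5)[OF S]) simp
      finally show ?thesis using M.expand[OF d y] by simp
    qed
    then have "l = (\<lambda>y. if y \<in> sp M d then \<beta> d (D.P d \<phi>) y else 0)" using l by (auto simp: dualV_def)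
    then show "l \<in> (\<lambda>x y. if y \<in> sp M d then \<beta> d x y else 0) ` sp M' d"
      by (rule image_eqI[OF _ D.P_in[OF d \<phi>]])
  qed
  ultimately show ?thesis by (simp add: bij_betw_def)
qed

definition B :: "'o \<Rightarrow> ('w \<times> 'x \<Rightarrow> complex) \<Rightarrow> complex" where
  "B d = tlift (sp M' d) (sp M d) (\<beta> d)"

lemma B_pt: "d \<in> Ob C \<Longrightarrow> x \<in> sp M' d \<Longrightarrow> y \<in> sp M d \<Longrightarrow> B d (pt x y) = \<beta> d x y"
  unfolding B_def by (intro tlift_pt bilin_\<beta> M.modD(1) D.modD(1))

lemma B_lin: "d \<in> Ob C \<Longrightarrow> lin_fun (sp (tensor C M' M) d) (B d)"
  unfolding B_def M.sp_tensor by (intro lin_fun_tlift bilin_\<beta> M.modD(1) D.modD(1))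

lemma B_invariant:
  assumes h: "h \<in> Hom C d e" and t: "t \<in> sp (tensor C M' M) d"
  shows "B e (mp (tensor C M' M) h t) = B d t"
proof -
  note T = M.moduleD[OF M.tensor_module[OF D.module M.module]] and de = M.Hom_Ob[OF h]
  have "t \<in> tens (sp M' d) (sp M d)" using t by (simp add: M.sp_tensor)
  then show ?thesis
  proof (induction rule: tens_induct)
    case zero
    show "B e (mp (tensor C M' M) h 0) = B d 0"
      using lin_on_0[OF T(2)[OF h] T(1)[OF de(1)]] lin_fun_0[OF B_lin[OF de(1)] T(1)[OF de(1)]]
        lin_fun_0[OF B_lin[OF de(2)] T(1)[OF de(2)]] by simp
  next
    case (pt x y)
    note m = lin_onD(1)[OF D.modD(2)[OF h] pt(1)] lin_onD(1)[OF M.modD(2)[OF h] pt(2)]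
    show "B e (mp (tensor C M' M) h (pt x y)) = B d (pt x y)"
      using M.mp_tensor_pt[OF D.module M.module h pt] B_pt[OF de(2) m] B_pt[OF de(1) pt] \<beta>_invariant[OF h pt] by simp
  next
    case (add s t)
    then have st: "s \<in> sp (tensor C M' M) d" "t \<in> sp (tensor C M' M) d" by (simp_all add: M.sp_tensor)
    note m = lin_onD(1)[OF T(2)[OF h] st(1)] lin_onD(1)[OF T(2)[OF h] st(2)]
    show "B e (mp (tensor C M' M) h (s + t)) = B d (s + t)"
      using lin_onD(2)[OF T(2)[OF h] st] B_lin[OF de(1)] B_lin[OF de(2)] st m add(3,4) by (simp add: lin_fun_def)
  qed
qed

lemma pairing:
  "(\<forall>d\<in>Ob C. lin_fun (sp (tensor C M' M) d) (B d)) \<and>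
   (\<forall>d e h. h \<in> Hom C d e \<longrightarrow>
      (\<forall>t\<in>sp (tensor C M' M) d. B e (mp (tensor C M' M) h t) = B d t)) \<and>
   (\<forall>d\<in>Ob C.
      (\<forall>x\<in>sp M' d. (\<forall>y\<in>sp M d. B d (pt x y) = 0) \<longrightarrow> x = 0) \<and>
      (\<forall>y\<in>sp M d. (\<forall>x\<in>sp M' d. B d (pt x y) = 0) \<longrightarrow> y = 0) \<and>
      bij_betw (\<lambda>x y. if y \<in> sp M d then B d (pt x y) else 0) (sp M' d) (dualV (sp M d)) \<and>
      (\<forall>g\<in>Aut C d. \<forall>x\<in>sp M' d. \<forall>y\<in>sp M d. B d (pt (mp M' g x) (mp M g y)) = B d (pt x y)))"
proof (intro conjI allI impI ballI)
  fix d assume d: "d \<in> Ob C"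
  show "lin_fun (sp (tensor C M' M) d) (B d)" by (rule B_lin[OF d])
next
  fix d e h t assume "h \<in> Hom C d e" "t \<in> sp (tensor C M' M) d"
  then show "B e (mp (tensor C M' M) h t) = B d t" by (rule B_invariant)
next
  fix d x assume "d \<in> Ob C" "x \<in> sp M' d" "\<forall>y\<in>sp M d. B d (pt x y) = 0"
  then show "x = 0" using \<beta>_nondegenerate_left B_pt by simp
next
  fix d y assume "d \<in> Ob C" "y \<in> sp M d" "\<forall>x\<in>sp M' d. B d (pt x y) = 0"
  then show "y = 0" using \<beta>_nondegenerate_right B_pt by simp
next
  fix d assume d: "d \<in> Ob C"
  have eq: "(\<lambda>y. if y \<in> sp M d then B d (pt x y) else 0) = (\<lambda>y. if y \<in> sp M d then \<beta> d x y else 0)"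
    if "x \<in> sp M' d" for x using B_pt[OF d that] by auto
  show "bij_betw (\<lambda>x y. if y \<in> sp M d then B d (pt x y) else 0) (sp M' d) (dualV (sp M d))"
    by (rule iffD2[OF bij_betw_cong \<beta>_dual_bij[OF d]]) (rule eq)
next
  fix d g x y assume "d \<in> Ob C" "g \<in> Aut C d" and xy: "x \<in> sp M' d" "y \<in> sp M d"
  then have g: "g \<in> Hom C d d" by (simp add: M.Aut_eq)
  show "B d (pt (mp M' g x) (mp M g y)) = B d (pt x y)"
    using B_pt[OF \<open>d \<in> Ob C\<close> lin_onD(1)[OF D.modD(2)[OF g] xy(1)] lin_onD(1)[OF M.modD(2)[OF g] xy(2)]]
      B_pt[OF \<open>d \<in> Ob C\<close> xy] \<beta>_invariant[OF g xy] by simp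
qed

end

section \<open>Freeness of the tensor product\<close>

lemma (in free_module) sp_span_finite:
  assumes d: "d \<in> Ob C" shows "\<exists>X. finite X \<and> sp M d \<subseteq> cf.span X"
proof -
  have "\<exists>B. finite B \<and> B \<subseteq> Vs i \<and> Vs i \<subseteq> cf.span B" if "i < n" for i
    using fdim_sp_span_finite[OF repD(2)[OF that]] by metis
  then obtain B where B: "\<And>i. i < n \<Longrightarrow> finite (B i) \<and> B i \<subseteq> Vs i \<and> Vs i \<subseteq> cf.span (B i)" by metis
  define X where "X = (\<Union>i<n. \<Union>f\<in>Hom C (cs i) d. (\<lambda>b. mp M f (\<iota> i b)) ` B i)"
  have "finite X" unfolding X_def using B finite_Hom by auto
  moreover have "m \<in> cf.span X" if m: "m \<in> sp M d" for m
  proof -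
    have "mp M f (\<iota> i (coef d m i f)) \<in> cf.span X" if i: "i < n" and f: "f \<in> Hom C (cs i) d" for i f
    proof (rule lin_on_span[OF gen_map_lin[OF i f] repD(1)[OF i]])
      show "B i \<subseteq> Vs i" "coef d m i f \<in> cf.span (B i)" using B[OF i] coef_mem[OF d m i f] by blast+
      show "(\<lambda>v. mp M f (\<iota> i v)) ` B i \<subseteq> cf.span X"
        unfolding X_def using i f by (auto intro!: cf.span_base)
    qed simp
    then have "(\<Sum>i<n. \<Sum>f\<in>Hom C (cs i) d. mp M f (\<iota> i (coef d m i f))) \<in> cf.span X"
      by (intro cf.span_sum) simp
    then show ?thesis using expand[OF d m] by simp
  qed
  ultimately show ?thesis by blast
qed

locale tensor_modules =
  M: free_module C M n cs Vs \<rho>s \<iota> + N: free_module C N n' cs' Vs' \<rho>s' \<iota>'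
  for C :: "('o, 'm) cat" and M :: "('m, 'o, 'x) cmod" and n cs
    and Vs :: "nat \<Rightarrow> ('y \<Rightarrow> complex) set" and \<rho>s \<iota> and N :: "('m, 'o, 'z) cmod" and n' cs'
    and Vs' :: "nat \<Rightarrow> ('v \<Rightarrow> complex) set" and \<rho>s' \<iota>'
begin

abbreviation MN :: "('m, 'o, 'x \<times> 'z) cmod" where "MN \<equiv> tensor C M N"

lemmas mod_MN = M.tensor_module[OF M.module N.module]
lemmas modD = M.moduleD[OF mod_MN]
lemmas mp_pt = M.mp_tensor_pt[OF M.module N.module]

text \<open>The component of a tensor at the pair (f, g), a vector in the tensor product of
  \<open>Vs i\<close> and \<open>Vs' j\<close>.\<close>

definition \<pi> :: "'o \<Rightarrow> nat \<Rightarrow> 'm \<Rightarrow> nat \<Rightarrow> 'm \<Rightarrow> ('x \<times> 'z \<Rightarrow> complex) \<Rightarrow> ('y \<times> 'v \<Rightarrow> complex)" where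
  "\<pi> d i f j g = Tlift (sp M d) (sp N d) (\<lambda>m k. pt (M.coef d m i f) (N.coef d k j g))"

context
  fixes d i f j g
  assumes i: "i < n" and f: "f \<in> Hom C (cs i) d" and j: "j < n'" and g: "g \<in> Hom C (cs' j) d"
begin

lemma \<pi>_bilin: "bilin (sp M d) (sp N d) (\<lambda>m k. pt (M.coef d m i f) (N.coef d k j g) x)"
  using M.Hom_Ob(2)[OF f] i f j g by (intro bilin_pt[OF M.coef_lin N.coef_lin])

lemma \<pi>_pt: "m \<in> sp M d \<Longrightarrow> k \<in> sp N d \<Longrightarrow> \<pi> d i f j g (pt m k) = pt (M.coef d m i f) (N.coef d k j g)"
  unfolding \<pi>_def using M.Hom_Ob(2)[OF f] by (intro Tlift_pt \<pi>_bilin M.modD(1) N.modD(1))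

lemma \<pi>_lin: "lin_on (tens (sp M d) (sp N d)) (tens (Vs i) (Vs' j)) (\<pi> d i f j g)"
proof (rule lin_on_tens_range)
  note d = M.Hom_Ob(2)[OF f]
  show "lin_on (tens (sp M d) (sp N d)) UNIV (\<pi> d i f j g)"
    unfolding \<pi>_def using d by (intro lin_on_Tlift \<pi>_bilin M.modD(1) N.modD(1))
  show "subsp (sp M d)" by (rule M.modD(1)[OF d])
  show "subsp (tens (Vs i) (Vs' j))" by (rule subsp_tens[OF M.repD(1)[OF i]])
  fix m k assume "m \<in> sp M d" "k \<in> sp N d"
  then show "\<pi> d i f j g (pt m k) \<in> tens (Vs i) (Vs' j)"
    using \<pi>_pt M.coef_mem[OF d _ i f] N.coef_mem[OF d _ j g] by (simp add: pt_in_tens)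
qed

end

text \<open>Inherited from \<open>coef_map\<close> on both factors: a component survives only at
  pairs whose two legs both pass through \<open>h\<close>.\<close>

lemma \<pi>_map:
  assumes h: "h \<in> Hom C w d" and t: "t \<in> tens (sp M w) (sp N w)" and i: "i < n" and j: "j < n'"
  shows "f \<in> Hom C (cs i) w \<Longrightarrow> g \<in> Hom C (cs' j) w \<Longrightarrow> \<pi> d i (h \<bullet> f) j (h \<bullet> g) (mp MN h t) = \<pi> w i f j g t"
    and "f' \<in> Hom C (cs i) d \<Longrightarrow> g' \<in> Hom C (cs' j) d \<Longrightarrow>
      f' \<notin> (\<lambda>f. h \<bullet> f) ` Hom C (cs i) w \<or> g' \<notin> (\<lambda>g. h \<bullet> g) ` Hom C (cs' j) w \<Longrightarrow> \<pi> d i f' j g' (mp MN h t) = 0"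
proof -
  note w = M.Hom_Ob(1)[OF h]
  note L = modD(2)[OF h, unfolded M.sp_tensor]
  have m: "mp M h u \<in> sp M d" if "u \<in> sp M w" for u using lin_onD(1)[OF M.modD(2)[OF h] that] .
  have k: "mp N h v \<in> sp N d" if "v \<in> sp N w" for v using lin_onD(1)[OF N.modD(2)[OF h] that] .
  {
    assume f: "f \<in> Hom C (cs i) w" and g: "g \<in> Hom C (cs' j) w"
    note hf = M.cmp_Hom[OF f h] and hg = M.cmp_Hom[OF g h]
    show "\<pi> d i (h \<bullet> f) j (h \<bullet> g) (mp MN h t) = \<pi> w i f j g t"
    proof (rule lin_on_tens_eq[OF lin_on_comp[OF L \<pi>_lin[OF i hf j hg]] \<pi>_lin[OF i f j g] M.modD(1)[OF w] _ t])
      fix u v assume uv: "u \<in> sp M w" "v \<in> sp N w"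
      show "\<pi> d i (h \<bullet> f) j (h \<bullet> g) (mp MN h (pt u v)) = \<pi> w i f j g (pt u v)"
        using mp_pt[OF h uv] \<pi>_pt[OF i hf j hg m[OF uv(1)] k[OF uv(2)]] \<pi>_pt[OF i f j g uv]
          M.coef_map(1)[OF h uv(1) i f] N.coef_map(1)[OF h uv(2) j g] by simp
    qed
  next
    assume f: "f' \<in> Hom C (cs i) d" and g: "g' \<in> Hom C (cs' j) d"
      and *: "f' \<notin> (\<lambda>f. h \<bullet> f) ` Hom C (cs i) w \<or> g' \<notin> (\<lambda>g. h \<bullet> g) ` Hom C (cs' j) w"
    have z: "lin_on (tens (sp M w) (sp N w)) UNIV (\<lambda>_. 0 :: 'y \<times> 'v \<Rightarrow> complex)" by (simp add: lin_on_def)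
    show "\<pi> d i f' j g' (mp MN h t) = 0"
    proof (rule lin_on_tens_eq[OF lin_on_comp[OF L \<pi>_lin[OF i f j g]] z M.modD(1)[OF w] _ t])
      fix u v assume uv: "u \<in> sp M w" "v \<in> sp N w"
      show "\<pi> d i f' j g' (mp MN h (pt u v)) = 0"
        using mp_pt[OF h uv] \<pi>_pt[OF i f j g m[OF uv(1)] k[OF uv(2)]]
          M.coef_map(2)[OF h uv(1) i, of f'] N.coef_map(2)[OF h uv(2) j, of g'] * by auto
    qed
  }
qed

text \<open>A tensor can be rebuilt from its components: \<open>\<Lambda>\<close> puts a component
  back at (f, g), and the sum over all pairs is the identity, by \<open>expand\<close> in each
  factor.\<close>

lemma \<pi>_jointly_injective:
  assumes d: "d \<in> Ob C" and t: "t \<in> tens (sp M d) (sp N d)"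
    and 0: "\<And>i f j g. i < n \<Longrightarrow> f \<in> Hom C (cs i) d \<Longrightarrow> j < n' \<Longrightarrow> g \<in> Hom C (cs' j) d \<Longrightarrow> \<pi> d i f j g t = 0"
  shows "t = 0"
proof -
  define \<Lambda> where "\<Lambda> i f j g = Tlift (Vs i) (Vs' j) (\<lambda>v v'. pt (mp M f (\<iota> i v)) (mp N g (\<iota>' j v')))" for i f j g
  have b: "bilin (Vs i) (Vs' j) (\<lambda>v v'. pt (mp M f (\<iota> i v)) (mp N g (\<iota>' j v')) x)"
    if "i < n" "f \<in> Hom C (cs i) d" "j < n'" "g \<in> Hom C (cs' j) d" for i f j g x
    using that by (intro bilin_pt[OF M.gen_map_lin N.gen_map_lin])
  have \<Lambda>: "lin_on (tens (Vs i) (Vs' j)) UNIV (\<Lambda> i f j g)"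
    if "i < n" "f \<in> Hom C (cs i) d" "j < n'" "g \<in> Hom C (cs' j) d" for i f j g
    unfolding \<Lambda>_def by (rule lin_on_Tlift[OF b[OF that] M.repD(1)[OF that(1)] N.repD(1)[OF that(3)]])
  have \<Lambda>_pt: "\<Lambda> i f j g (pt v v') = pt (mp M f (\<iota> i v)) (mp N g (\<iota>' j v'))"
    if "i < n" "f \<in> Hom C (cs i) d" "j < n'" "g \<in> Hom C (cs' j) d" "v \<in> Vs i" "v' \<in> Vs' j" for i f j g v v'
    unfolding \<Lambda>_def using Tlift_pt[OF b[OF that(1-4)] M.repD(1)[OF that(1)] N.repD(1)[OF that(3)] that(5,6)] .
  let ?F = "\<lambda>t. \<Sum>i<n. \<Sum>f\<in>Hom C (cs i) d. \<Sum>j<n'. \<Sum>g\<in>Hom C (cs' j) d. \<Lambda> i f j g (\<pi> d i f j g t)"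
  have F: "lin_on (tens (sp M d) (sp N d)) UNIV ?F"
    by (intro lin_on_sum_fun) (use lin_on_comp[OF \<pi>_lin \<Lambda>] in simp)
  have I: "lin_on (tens (sp M d) (sp N d)) UNIV (\<lambda>t. t)" by (simp add: lin_on_def)
  have "t = ?F t"
  proof (rule lin_on_tens_eq[OF I F M.modD(1)[OF d] _ t])
    fix m k assume m: "m \<in> sp M d" and k: "k \<in> sp N d"
    have "?F (pt m k) = (\<Sum>i<n. \<Sum>f\<in>Hom C (cs i) d. \<Sum>j<n'. \<Sum>g\<in>Hom C (cs' j) d.
        pt (mp M f (\<iota> i (M.coef d m i f))) (mp N g (\<iota>' j (N.coef d k j g))))"
      using M.coef_mem[OF d m] N.coef_mem[OF d k] by (intro sum.cong refl) (simp add: \<pi>_pt m k \<Lambda>_pt)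
    also have "\<dots> = pt (\<Sum>i<n. \<Sum>f\<in>Hom C (cs i) d. mp M f (\<iota> i (M.coef d m i f)))
        (\<Sum>j<n'. \<Sum>g\<in>Hom C (cs' j) d. mp N g (\<iota>' j (N.coef d k j g)))"
      unfolding pt_sum_left unfolding pt_sum_right ..
    also have "\<dots> = pt m k" using M.expand[OF d m] N.expand[OF d k] by simp
    finally show "pt m k = ?F (pt m k)" by simp
  qed
  also have "\<dots> = 0" using 0 lin_on_0[OF \<Lambda> subsp_tens[OF M.repD(1)]] by (intro sum.neutral ballI) simp
  finally show ?thesis .
qed

section \<open>The representations of G_w spanned by minimal pairs\<close>

definition gens :: "'o \<Rightarrow> ('x \<times> 'z \<Rightarrow> complex) set" where
  "gens w = {pt (mp M f (\<iota> i v)) (mp N g (\<iota>' j v')) | i f v j g v'. i < n \<and> j < n' \<and> v \<in> Vs i \<and> v' \<in> Vs' j \<and>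
      M.minpair (cs i) (cs' j) w f g}"

text \<open>Realised inside the tensor product at \<open>w\<close>, so that G_w acts by restriction
  and the generator map of the later presentation is the inclusion.\<close>

definition U :: "'o \<Rightarrow> ('x \<times> 'z \<Rightarrow> complex) set" where
  "U w = cf.span (gens w)"

lemma gensI:
  "i < n \<Longrightarrow> j < n' \<Longrightarrow> v \<in> Vs i \<Longrightarrow> v' \<in> Vs' j \<Longrightarrow> M.minpair (cs i) (cs' j) w f g \<Longrightarrow>
    pt (mp M f (\<iota> i v)) (mp N g (\<iota>' j v')) \<in> gens w"
  unfolding gens_def by blast

lemma gensE:
  assumes "t \<in> gens w"
  obtains i f v j g v' where "t = pt (mp M f (\<iota> i v)) (mp N g (\<iota>' j v'))" "i < n" "j < n'" "v \<in> Vs i" "v' \<in> Vs' j"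
    "M.minpair (cs i) (cs' j) w f g"
  using assms unfolding gens_def mem_Collect_eq by (elim exE conjE) (rule that)

lemma gen_map_tens:
  assumes "i < n" "j < n'" "v \<in> Vs i" "v' \<in> Vs' j" "f \<in> Hom C (cs i) d" "g \<in> Hom C (cs' j) d"
  shows "mp M f (\<iota> i v) \<in> sp M d" "mp N g (\<iota>' j v') \<in> sp N d"
  using lin_onD(1)[OF M.gen_map_lin[OF assms(1,5)] assms(3)] lin_onD(1)[OF N.gen_map_lin[OF assms(2,6)] assms(4)] .

lemma mp_gen:
  assumes "i < n" "j < n'" "v \<in> Vs i" "v' \<in> Vs' j" "f \<in> Hom C (cs i) w" "g \<in> Hom C (cs' j) w" "h \<in> Hom C w d"
  shows "mp MN h (pt (mp M f (\<iota> i v)) (mp N g (\<iota>' j v'))) = pt (mp M (h \<bullet> f) (\<iota> i v)) (mp N (h \<bullet> g) (\<iota>' j v'))"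
  using mp_pt[OF assms(7) gen_map_tens[OF assms(1-6)]]
    M.modD(4)[OF assms(5,7) lin_onD(1)[OF M.gen_lin[OF assms(1)] assms(3)]]
    N.modD(4)[OF assms(6,7) lin_onD(1)[OF N.gen_lin[OF assms(2)] assms(4)]] by simp

lemma gens_tens: "gens w \<subseteq> tens (sp M w) (sp N w)"
proof
  fix t assume "t \<in> gens w"
  then show "t \<in> tens (sp M w) (sp N w)"
  proof (rule gensE)
    fix i f v j g v' assume t: "t = pt (mp M f (\<iota> i v)) (mp N g (\<iota>' j v'))"
      and *: "i < n" "j < n'" "v \<in> Vs i" "v' \<in> Vs' j" "M.minpair (cs i) (cs' j) w f g"
    show ?thesis unfolding t using gen_map_tens[OF *(1-4) M.minpair_Hom[OF *(5)]] by (rule pt_in_tens)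
  qed
qed

lemma U_tens: "w \<in> Ob C \<Longrightarrow> U w \<subseteq> tens (sp M w) (sp N w)"
  unfolding U_def
  by (rule cf.span_minimal[OF gens_tens]) (use subsp_tens[OF M.modD(1)] subsp_iff_subspace in blast)

lemma subsp_U: "subsp (U w)"
  unfolding U_def subsp_iff_subspace by simp

lemma fdim_U: assumes w: "w \<in> Ob C" shows "fdim_sp (U w)"
proof -
  obtain X where X: "finite X" "sp M w \<subseteq> cf.span X" using M.sp_span_finite[OF w] by blast
  obtain Y where Y: "finite Y" "sp N w \<subseteq> cf.span Y" using N.sp_span_finite[OF w] by blast
  let ?S = "(\<lambda>(x, y). pt x y) ` (X \<times> Y)"
  have "t \<in> cf.span ?S" if "t \<in> tens (sp M w) (sp N w)" for t
    using that
  proof (induction rule: tens_induct)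
    case zero
    show "0 \<in> cf.span ?S" by (rule cf.span_zero)
  next
    case (pt u v)
    then show "pt u v \<in> cf.span ?S" using X(2) Y(2) by (intro span_pt) blast+
  next
    case (add s t)
    show "s + t \<in> cf.span ?S" by (rule cf.span_add[OF add(3,4)])
  qed
  then show ?thesis using U_tens[OF w] X(1) Y(1) by (intro fdim_spI[OF subsp_U, of ?S]) blast+
qed

text \<open>Postcomposition with an automorphism keeps a pair minimal, so generators go to
  generators.\<close>

lemma U_invariant:
  assumes "w \<in> Ob C" "u \<in> Hom C w w" shows "lin_on (U w) (U w) (mp MN u)"
proof -
  note L = modD(2)[OF assms(2), unfolded M.sp_tensor]
  have "mp MN u t \<in> U w" if t: "t \<in> U w" for t
  proof (rule lin_on_span[OF L subsp_tens[OF M.modD(1)[OF assms(1)]] gens_tens])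
    show "t \<in> cf.span (gens w)" using t by (simp add: U_def)
    show "cf.subspace (U w)" using subsp_U subsp_iff_subspace by blast
    show "mp MN u ` gens w \<subseteq> U w"
    proof clarify
      fix s assume "s \<in> gens w"
      then show "mp MN u s \<in> U w"
      proof (rule gensE)
        fix i f v j g v' assume s: "s = pt (mp M f (\<iota> i v)) (mp N g (\<iota>' j v'))"
          and *: "i < n" "j < n'" "v \<in> Vs i" "v' \<in> Vs' j" "M.minpair (cs i) (cs' j) w f g"
        show ?thesis unfolding s mp_gen[OF *(1-4) M.minpair_Hom[OF *(5)] assms(2)] U_def
          by (intro cf.span_base gensI *(1-4) M.minpair_iso[OF *(5) M.endo_iso[OF assms(2)]])
      qed
    qed
  qed
  then show ?thesis using lin_on_subset[OF L U_tens[OF assms(1)]] by (simp add: lin_on_def)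
qed

text \<open>A generator at the minimal pair (f', g') has components only at pairs (f' a, g' b) with
  automorphisms a and b, and these are minimal by \<open>minpair_precomp\<close>.\<close>

lemma \<pi>_support:
  assumes w: "w \<in> Ob C" and t: "t \<in> U w" and i: "i < n" and j: "j < n'"
    and f: "f \<in> Hom C (cs i) w" and g: "g \<in> Hom C (cs' j) w" and not: "\<not> M.minpair (cs i) (cs' j) w f g"
  shows "\<pi> w i f j g t = 0"
proof -
  have "\<pi> w i f j g t \<in> {0}"
  proof (rule lin_on_span[OF \<pi>_lin[OF i f j g] subsp_tens[OF M.modD(1)[OF w]] gens_tens])
    show "t \<in> cf.span (gens w)" using t by (simp add: U_def)
    show "\<pi> w i f j g ` gens w \<subseteq> {0}"
    proof clarify
      fix s assume "s \<in> gens w"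
      then show "\<pi> w i f j g s = 0"
      proof (rule gensE)
        fix i' f' v j' g' v' assume s: "s = pt (mp M f' (\<iota> i' v)) (mp N g' (\<iota>' j' v'))"
          and *: "i' < n" "j' < n'" "v \<in> Vs i'" "v' \<in> Vs' j'" "M.minpair (cs i') (cs' j') w f' g'"
        note H = M.minpair_Hom[OF *(5)]
        have p: "\<pi> w i f j g s = pt (M.coef w (mp M f' (\<iota> i' v)) i f) (N.coef w (mp N g' (\<iota>' j' v')) j g)"
          unfolding s using gen_map_tens[OF *(1-4) H] by (rule \<pi>_pt[OF i f j g])
        have "M.coef w (mp M f' (\<iota> i' v)) i f = 0 \<or> N.coef w (mp N g' (\<iota>' j' v')) j g = 0"
        proof (rule ccontr)
          assume "\<not> ?thesis"
          then have "i = i'" "\<exists>a\<in>M.G i'. f = f' \<bullet> a" "j = j'" "\<exists>b\<in>N.G j'. g = g' \<bullet> b"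
            using M.coef_gen_support[OF *(1) H(1) *(3) i f] N.coef_gen_support[OF *(2) H(2) *(4) j g] by blast+
          then show False using M.minpair_precomp[OF *(5)] not by blast
        qed
        then show ?thesis unfolding p by auto
      qed
    qed
  qed (simp add: cf.subspace_def)
  then show ?thesis by simp
qed

text \<open>A nonzero span has a nonzero generator, whose two vectors are then nonzero. This passes
  the degree bounds of M and N on to \<open>U w\<close>.\<close>

lemma U_nonzero:
  assumes "U w \<noteq> {0}"
  obtains i j f g where "i < n" "j < n'" "Vs i \<noteq> {0}" "Vs' j \<noteq> {0}" "M.minpair (cs i) (cs' j) w f g"
proof -
  have "\<not> gens w \<subseteq> {0}"
  proof
    assume "gens w \<subseteq> {0}"
    then have "U w \<subseteq> {0}" unfolding U_def by (rule cf.span_minimal) (simp add: cf.subspace_def)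
    then show False using assms subspD(1)[OF subsp_U] by blast
  qed
  then obtain t where t: "t \<in> gens w" "t \<noteq> 0" by blast
  from t(1) show ?thesis
  proof (rule gensE)
    fix i f v j g v' assume s: "t = pt (mp M f (\<iota> i v)) (mp N g (\<iota>' j v'))"
      and *: "i < n" "j < n'" "v \<in> Vs i" "v' \<in> Vs' j" "M.minpair (cs i) (cs' j) w f g"
    note H = M.minpair_Hom[OF *(5)]
    have "v \<noteq> 0"
      using t(2) lin_on_0[OF M.gen_map_lin[OF *(1) H(1)] M.repD(1)[OF *(1)]] by (auto simp: s)
    moreover have "v' \<noteq> 0"
      using t(2) lin_on_0[OF N.gen_map_lin[OF *(2) H(2)] N.repD(1)[OF *(2)]] by (auto simp: s)
    ultimately show ?thesis using *(3,4) that[OF *(1,2) _ _ *(5)] by blast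
  qed
qed

text \<open>Covering all targets serves the spanning half of freeness, being pairwise non-isomorphic
  the injectivity half.\<close>

lemma target_representatives:
  obtains ws where "set ws \<subseteq> Ob C"
    "\<And>k l u. k < length ws \<Longrightarrow> l < length ws \<Longrightarrow> iso_mor C (ws ! k) (ws ! l) u \<Longrightarrow> k = l"
    "\<And>i j w f g. i < n \<Longrightarrow> j < n' \<Longrightarrow> M.minpair (cs i) (cs' j) w f g \<Longrightarrow> \<exists>k<length ws. \<exists>u. iso_mor C w (ws ! k) u"
proof -
  have "\<exists>S. finite S \<and> S \<subseteq> Ob C \<and> (\<forall>w f g. M.minpair (cs i) (cs' j) w f g \<longrightarrow> (\<exists>s\<in>S. \<exists>u. iso_mor C w s u))"
    if "i < n" for i j using M.finite_minpair_targets[OF M.cs_Ob[OF that]] .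
  then obtain S where S: "\<And>i j. i < n \<Longrightarrow> finite (S i j) \<and> S i j \<subseteq> Ob C \<and>
      (\<forall>w f g. M.minpair (cs i) (cs' j) w f g \<longrightarrow> (\<exists>s\<in>S i j. \<exists>u. iso_mor C w s u))" by metis
  define isoc where "isoc w = {x. \<exists>u. iso_mor C w x u}" for w
  \<comment> \<open>The representative is picked from the isomorphism class as a set, so isomorphic
    objects receive the same one.\<close>
  define r where "r w = (SOME x. x \<in> isoc w)" for w
  have isoc_eq: "isoc w = isoc w'" if "iso_mor C w w' u" for w w' u
    unfolding isoc_def using M.iso_mor_trans[OF that] M.iso_mor_sym[OF that] M.iso_mor_trans by blast
  have r: "r w \<in> isoc w" if "w \<in> Ob C" for w
    unfolding r_def by (rule someI[of _ w]) (use M.iso_mor_id[OF that] in \<open>auto simp: isoc_def\<close>)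
  define A where "A = (\<Union>i<n. \<Union>j<n'. S i j)"
  have A: "finite A" "A \<subseteq> Ob C" unfolding A_def using S by blast+
  obtain ws where ws: "set ws = r ` A" "distinct ws" using finite_distinct_list[of "r ` A"] A(1) by blast
  have Ob: "set ws \<subseteq> Ob C"
  proof
    fix x assume "x \<in> set ws"
    then obtain w where "w \<in> A" "x = r w" using ws(1) by blast
    then obtain u where "iso_mor C w x u" using r[of w] A(2) by (auto simp: isoc_def)
    then show "x \<in> Ob C" using M.Hom_Ob(2) unfolding iso_mor_def by blast
  qed
  have uniq: "x = y" if xy: "x \<in> set ws" "y \<in> set ws" "iso_mor C x y u" for x y u
  proof -
    obtain w w' where w: "w \<in> A" "x = r w" "w' \<in> A" "y = r w'" using xy(1,2) ws(1) by blast
    have "isoc w = isoc x" "isoc w' = isoc y"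
      using r[of w] r[of w'] w A(2) isoc_eq unfolding isoc_def by blast+
    moreover have "isoc x = isoc y" by (rule isoc_eq[OF xy(3)])
    ultimately show ?thesis unfolding w(2,4) r_def by simp
  qed
  have cov: "\<exists>k<length ws. \<exists>u. iso_mor C w (ws ! k) u" if ij: "i < n" "j < n'" and m: "M.minpair (cs i) (cs' j) w f g" for i j w f g
  proof -
    obtain s u where s: "s \<in> S i j" "iso_mor C w s u" using S[OF ij(1)] m by blast
    have sA: "s \<in> A" unfolding A_def using ij s(1) by blast
    then obtain u' where "iso_mor C s (r s) u'" using r[of s] A(2) unfolding isoc_def by blast
    then have "\<exists>u. iso_mor C w (r s) u" using M.iso_mor_trans[OF s(2)] by blast
    moreover have "r s \<in> set ws" using ws(1) sA by blast
    ultimately show ?thesis by (metis in_set_conv_nth)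
  qed
  show ?thesis
  proof (rule that[OF Ob])
    fix k l u assume kl: "k < length ws" "l < length ws" "iso_mor C (ws ! k) (ws ! l) u"
    have "ws ! k = ws ! l" by (rule uniq[OF nth_mem[OF kl(1)] nth_mem[OF kl(2)] kl(3)])
    then show "k = l" using nth_eq_iff_index_eq[OF ws(2) kl(1,2)] by blast
  qed (rule cov)
qed

lemma gen_module_MN:
  assumes "set ws \<subseteq> Ob C"
  shows "gen_module C (length ws) (\<lambda>k. ws ! k) (\<lambda>k. U (ws ! k)) (\<lambda>k. mp MN) MN (\<lambda>k x. x)"
proof
  fix k assume k: "k < length ws"
  show Ob: "ws ! k \<in> Ob C" using assms nth_mem[OF k] by blast
  have sub: "U (ws ! k) \<subseteq> sp MN (ws ! k)" using U_tens[OF Ob] by (simp add: M.sp_tensor)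
  then show "lin_on (U (ws ! k)) (sp MN (ws ! k)) (\<lambda>x. x)" by (auto simp: lin_on_def)
  show "is_rep C (ws ! k) (U (ws ! k)) (mp MN)"
    unfolding is_rep_def M.Aut_eq
  proof (intro conjI ballI subsp_U fdim_U[OF Ob])
    show "\<And>g. g \<in> Hom C (ws ! k) (ws ! k) \<Longrightarrow> lin_on (U (ws ! k)) (U (ws ! k)) (mp MN g)" by (rule U_invariant[OF Ob])
    fix v assume v: "v \<in> U (ws ! k)"
    then show "mp MN (idm C (ws ! k)) v = v" using modD(3)[OF Ob] sub by blast
    fix g h assume "g \<in> Hom C (ws ! k) (ws ! k)" "h \<in> Hom C (ws ! k) (ws ! k)"
    then show "mp MN (g \<bullet> h) v = mp MN g (mp MN h v)" using modD(4) sub v by blast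
  qed
qed (use mod_MN in auto)

text \<open>Spanning: every pair factors through a minimal one, which is moved to a representative.
  Injectivity: for (f, g) minimal over w = \<open>ws ! k0\<close>, the component at (h0 f, h0 g) of
  the element given by an equivariant family \<psi> is |G_w| times the component of
  \<open>\<psi> k0 h0\<close> at (f, g).\<close>

lemma free_pres_MN:
  assumes ws: "set ws \<subseteq> Ob C"
    and uniq: "\<And>k l u. k < length ws \<Longrightarrow> l < length ws \<Longrightarrow> iso_mor C (ws ! k) (ws ! l) u \<Longrightarrow> k = l"
    and cov: "\<And>i j w f g. i < n \<Longrightarrow> j < n' \<Longrightarrow> M.minpair (cs i) (cs' j) w f g \<Longrightarrow> \<exists>k<length ws. \<exists>u. iso_mor C w (ws ! k) u"
  shows "free_pres C MN (length ws) (\<lambda>k. ws ! k) (\<lambda>k. U (ws ! k)) (\<lambda>k. mp MN) (\<lambda>k x. x)"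
proof -
  interpret Q: gen_module C "length ws" "\<lambda>k. ws ! k" "\<lambda>k. U (ws ! k)" "\<lambda>k. mp MN" MN "\<lambda>k x. x"
    by (rule gen_module_MN[OF ws])
  show ?thesis
  proof (rule Q.free_presI)
    fix d assume d: "d \<in> Ob C"
    let ?S = "{mp MN h u | k h u. k < length ws \<and> h \<in> Hom C (ws ! k) d \<and> u \<in> U (ws ! k)}"
    have gen: "pt (mp M f (\<iota> i v)) (mp N g (\<iota>' j v')) \<in> cf.span ?S"
      if i: "i < n" and j: "j < n'" and v: "v \<in> Vs i" "v' \<in> Vs' j"
        and f: "f \<in> Hom C (cs i) d" and g: "g \<in> Hom C (cs' j) d" for i j v v' f g
    proof -
      obtain w f0 g0 h where m: "M.minpair (cs i) (cs' j) w f0 g0" and h: "h \<in> Hom C w d" "f = h \<bullet> f0" "g = h \<bullet> g0"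
        by (rule M.minpair_factor[OF f g])
      note H = M.minpair_Hom[OF m]
      obtain k u where k: "k < length ws" and u: "iso_mor C w (ws ! k) u" using cov[OF i j m] by blast
      obtain u' where u': "u \<in> Hom C w (ws ! k)" "u' \<in> Hom C (ws ! k) w" "u' \<bullet> u = idm C w"
        using u unfolding iso_mor_def by blast
      note m' = M.minpair_iso[OF m u]
      note H' = M.minpair_Hom[OF m'] and hu = M.cmp_Hom[OF u'(2) h(1)]
      \<comment> \<open>Inserting \<open>u\<close> together with its inverse moves the minimal pair
        to the representative \<open>ws ! k\<close>.\<close>
      have huu: "h \<bullet> u' \<bullet> u = h" using M.cmp_assoc[OF u'(1,2) h(1)] u'(3) M.cmp_id(1)[OF h(1)] by simp
      have "h \<bullet> u' \<bullet> (u \<bullet> f0) = f" "h \<bullet> u' \<bullet> (u \<bullet> g0) = g"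
        using M.cmp_assoc[OF H(1) u'(1) hu] M.cmp_assoc[OF H(2) u'(1) hu] huu h(2,3) by simp_all
      then have "pt (mp M f (\<iota> i v)) (mp N g (\<iota>' j v'))
          = mp MN (h \<bullet> u') (pt (mp M (u \<bullet> f0) (\<iota> i v)) (mp N (u \<bullet> g0) (\<iota>' j v')))"
        using mp_gen[OF i j v H' hu] by simp
      moreover have "pt (mp M (u \<bullet> f0) (\<iota> i v)) (mp N (u \<bullet> g0) (\<iota>' j v')) \<in> U (ws ! k)"
        unfolding U_def by (intro cf.span_base gensI i j v m')
      ultimately have "pt (mp M f (\<iota> i v)) (mp N g (\<iota>' j v')) \<in> ?S" using k hu by blast
      then show ?thesis by (rule cf.span_base)
    qed
    have "t \<in> cf.span ?S" if "t \<in> tens (sp M d) (sp N d)" for t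
      using that
    proof (induction rule: tens_induct)
      case zero
      show "0 \<in> cf.span ?S" by (rule cf.span_zero)
    next
      case (pt x y)
      have "pt (\<Sum>i<n. \<Sum>f\<in>Hom C (cs i) d. mp M f (\<iota> i (M.coef d x i f)))
          (\<Sum>j<n'. \<Sum>g\<in>Hom C (cs' j) d. mp N g (\<iota>' j (N.coef d y j g))) \<in> cf.span ?S"
        unfolding pt_sum_left unfolding pt_sum_right
        using M.coef_mem[OF d pt(1)] N.coef_mem[OF d pt(2)] by (intro cf.span_sum gen) simp_all
      then show "pt x y \<in> cf.span ?S" using M.expand[OF d pt(1)] N.expand[OF d pt(2)] by simp
    next
      case (add s t)
      show "s + t \<in> cf.span ?S" by (rule cf.span_add[OF add(3,4)])
    qed
    then show "sp MN d \<subseteq> cf.span ?S" by (auto simp: M.sp_tensor)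
    fix \<psi> assume \<psi>: "\<psi> \<in> Q.Teq d" "Phi C MN (length ws) (\<lambda>k. ws ! k) (\<lambda>k x. x) d \<psi> = 0"
    note T = Q.TeqD(1)[OF \<psi>(1)]
    have \<psi>m: "\<psi> k h \<in> U (ws ! k)" "\<psi> k h \<in> tens (sp M (ws ! k)) (sp N (ws ! k))" "ws ! k \<in> Ob C"
      if "k < length ws" "h \<in> Hom C (ws ! k) d" for k h
      using Q.TD(1)[OF T that] U_tens Q.cs_Ob[OF that(1)] by blast+
    have vanish: "\<psi> k0 h0 = 0" if k0: "k0 < length ws" and h0: "h0 \<in> Hom C (ws ! k0) d" for k0 h0
    proof -
      define w where "w = ws ! k0"
      note h0w = h0[folded w_def]
      note x = \<psi>m[OF k0 h0, folded w_def]
      show ?thesis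
      proof (rule \<pi>_jointly_injective[OF x(3,2)])
        fix i f j g assume i: "i < n" and f: "f \<in> Hom C (cs i) w" and j: "j < n'" and g: "g \<in> Hom C (cs' j) w"
        show "\<pi> w i f j g (\<psi> k0 h0) = 0"
        proof (cases "M.minpair (cs i) (cs' j) w f g")
          case False
          then show ?thesis by (rule \<pi>_support[OF x(3,1) i j f g])
        next
          case True
          note hf = M.cmp_Hom[OF f h0w] and hg = M.cmp_Hom[OF g h0w]
          let ?p = "\<pi> d i (h0 \<bullet> f) j (h0 \<bullet> g)"
          \<comment> \<open>Only morphisms \<open>h0 \<bullet> u\<close> with \<open>u\<close> in
            G_w contribute, and by equivariance of \<psi> each contributes the same vector.\<close>
          have summand: "?p (mp MN h (\<psi> k h)) = (if k = k0 \<and> h \<in> (\<lambda>u. h0 \<bullet> u) ` Hom C w w then \<pi> w i f j g (\<psi> k0 h0) else 0)"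
            if k: "k < length ws" and h: "h \<in> Hom C (ws ! k) d" for k h
          proof (cases "k = k0 \<and> h \<in> (\<lambda>u. h0 \<bullet> u) ` Hom C w w")
            case True
            then obtain u where u: "u \<in> Hom C w w" "h = h0 \<bullet> u" "k = k0" by blast
            have hu: "h0 \<bullet> u \<in> Hom C (ws ! k0) d" using h u(2,3) by simp
            have "mp MN h (\<psi> k h) = mp MN h0 (mp MN u (\<psi> k0 (h0 \<bullet> u)))"
              using modD(4)[OF u(1) h0w] \<psi>m(2)[OF k0 hu] unfolding u(2,3) M.sp_tensor w_def by blast
            also have "mp MN u (\<psi> k0 (h0 \<bullet> u)) = \<psi> k0 h0"
              using Q.TeqD(2)[OF \<psi>(1) k0 h0 u(1)[unfolded w_def]] .
            finally show ?thesis using \<pi>_map(1)[OF h0w x(2) i j f g] True by simp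
          next
            case False
            have "?p (mp MN h (\<psi> k h)) = 0"
            \<comment> \<open>A nonzero component would come from a minimal pair over
              \<open>ws ! k\<close> with the same composites into \<open>d\<close>. Uniqueness of
              minimal factorisations then makes \<open>ws ! k\<close> isomorphic to
              \<open>w\<close>, and \<open>h\<close> differs from \<open>h0\<close> by that
              isomorphism.\<close>
            proof (rule ccontr)
              assume ne: "?p (mp MN h (\<psi> k h)) \<noteq> 0"
              then obtain f' g' where f': "f' \<in> Hom C (cs i) (ws ! k)" "h0 \<bullet> f = h \<bullet> f'"
                and g': "g' \<in> Hom C (cs' j) (ws ! k)" "h0 \<bullet> g = h \<bullet> g'"
                using \<pi>_map(2)[OF h \<psi>m(2)[OF k h] i j hf hg] by blast
              have "\<pi> (ws ! k) i f' j g' (\<psi> k h) \<noteq> 0"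
                using ne \<pi>_map(1)[OF h \<psi>m(2)[OF k h] i j f'(1) g'(1)] f'(2) g'(2) by simp
              then have m': "M.minpair (cs i) (cs' j) (ws ! k) f' g'"
                using \<pi>_support[OF \<psi>m(3,1)[OF k h] i j f'(1) g'(1)] by blast
              obtain u where u: "iso_mor C (ws ! k) w u" "h = h0 \<bullet> u"
                by (rule M.minpair_unique[OF \<open>M.minpair (cs i) (cs' j) w f g\<close> m' h0w h f'(2) g'(2)])
              have "k = k0" using uniq[OF k k0] u(1) unfolding w_def by blast
              moreover have "u \<in> Hom C w w" using u(1) \<open>k = k0\<close> unfolding iso_mor_def w_def by blast
              ultimately show False using False u(2) by blast
            qed
            then show ?thesis using False by auto
          qed
          note L = \<pi>_lin[OF i hf j hg] and S = subsp_tens[OF M.modD(1)[OF d], of "sp N d"]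
          have mem: "mp MN h (\<psi> k h) \<in> tens (sp M d) (sp N d)" if "k < length ws" "h \<in> Hom C (ws ! k) d" for k h
            using lin_onD(1)[OF modD(2)[OF that(2)]] \<psi>m(2)[OF that] unfolding M.sp_tensor by blast
          have "0 = ?p (\<Sum>k<length ws. \<Sum>h\<in>Hom C (ws ! k) d. mp MN h (\<psi> k h))"
            using \<psi>(2) lin_on_0[OF L S] by (simp add: Phi_def)
          also have "\<dots> = (\<Sum>k<length ws. ?p (\<Sum>h\<in>Hom C (ws ! k) d. mp MN h (\<psi> k h)))"
            by (rule lin_on_sum[OF L S]) (use mem in \<open>auto intro: subspD(5)[OF S]\<close>)
          also have "\<dots> = (\<Sum>k<length ws. \<Sum>h\<in>Hom C (ws ! k) d. ?p (mp MN h (\<psi> k h)))"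
            by (intro sum.cong refl lin_on_sum[OF L S]) (use mem in simp)
          also have "\<dots> = (\<Sum>k<length ws. \<Sum>h\<in>Hom C (ws ! k) d.
              if k = k0 \<and> h \<in> (\<lambda>u. h0 \<bullet> u) ` Hom C w w then \<pi> w i f j g (\<psi> k0 h0) else 0)"
            by (intro sum.cong refl) (simp add: summand)
          also have "\<dots> = (\<Sum>k<length ws. if k = k0 then \<Sum>h\<in>Hom C (ws ! k) d.
              if h \<in> (\<lambda>u. h0 \<bullet> u) ` Hom C w w then \<pi> w i f j g (\<psi> k0 h0) else 0 else 0)"
            by (intro sum.cong refl) simp
          also have "\<dots> = (\<Sum>h\<in>Hom C w d. if h \<in> (\<lambda>u. h0 \<bullet> u) ` Hom C w w then \<pi> w i f j g (\<psi> k0 h0) else 0)"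
            using k0 by (simp add: w_def)
          also have "\<dots> = (\<Sum>h\<in>(\<lambda>u. h0 \<bullet> u) ` Hom C w w. \<pi> w i f j g (\<psi> k0 h0))"
            using M.finite_Hom M.cmp_Hom[OF _ h0w] by (intro sum.mono_neutral_cong_right) auto
          also have "\<dots> = sc (of_nat (card ((\<lambda>u. h0 \<bullet> u) ` Hom C w w))) (\<pi> w i f j g (\<psi> k0 h0))"
            by (rule sum_const_sc)
          \<comment> \<open>Cancelling the mono \<open>h0\<close> shows that the number of
            contributing morphisms is |G_w|, which is nonzero.\<close>
          also have "card ((\<lambda>u. h0 \<bullet> u) ` Hom C w w) = card (Hom C w w)"
            using M.mono[OF h0w] by (intro card_image) (auto simp: inj_on_def)
          finally show ?thesis using M.card_Aut[OF x(3)] by simp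
        qed
      qed
    qed
    show "\<psi> = 0"
    proof (intro ext)
      fix k h z
      have "\<psi> k h = 0" using vanish[of k h] Q.TD(2)[OF T, of k h] by blast
      then show "\<psi> k h z = 0 k h z" by (simp add: zero_fun_apply)
    qed
  qed
qed

lemma tensor_free:
  shows "is_free C MN"
    and "pres_deg_le C n cs Vs c1 \<Longrightarrow> pres_deg_le C n' cs' Vs' c2 \<Longrightarrow> geq_sum C c1 c2 d \<Longrightarrow> free_deg_le C MN d"
proof -
  obtain ws where ws: "set ws \<subseteq> Ob C"
    "\<And>k l u. k < length ws \<Longrightarrow> l < length ws \<Longrightarrow> iso_mor C (ws ! k) (ws ! l) u \<Longrightarrow> k = l"
    "\<And>i j w f g. i < n \<Longrightarrow> j < n' \<Longrightarrow> M.minpair (cs i) (cs' j) w f g \<Longrightarrow> \<exists>k<length ws. \<exists>u. iso_mor C w (ws ! k) u"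
    by (rule target_representatives) (rule that)
  have pres: "free_pres C MN (length ws) (\<lambda>k. ws ! k) (\<lambda>k. U (ws ! k)) (\<lambda>k. mp MN) (\<lambda>k x. x)"
    by (rule free_pres_MN[OF ws(1)]) (fact ws(2), fact ws(3))
  note F = M.free_deg_leI[OF pres]
  show "is_free C MN" by (rule F(1))
  assume deg: "pres_deg_le C n cs Vs c1" "pres_deg_le C n' cs' Vs' c2" "geq_sum C c1 c2 d"
  have "pres_deg_le C (length ws) (\<lambda>k. ws ! k) (\<lambda>k. U (ws ! k)) d"
    unfolding pres_deg_le_def
  proof (intro allI impI)
    \<comment> \<open>A nonzero \<open>U (ws ! k)\<close> comes from a minimal pair between nonzero
      summands, whose objects lie below \<open>c1\<close> and \<open>c2\<close>.\<close>
    fix k assume "U (ws ! k) \<noteq> {0}"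
    then obtain i j f g where ij: "i < n" "j < n'" "Vs i \<noteq> {0}" "Vs' j \<noteq> {0}" "M.minpair (cs i) (cs' j) (ws ! k) f g"
      by (rule U_nonzero)
    then show "obj_le C (ws ! k) d"
      using M.minpair_target_le[OF ij(5) _ _ deg(3)] deg(1,2) unfolding pres_deg_le_def by blast
  qed
  then show "free_deg_le C MN d" by (rule F(2))
qed

end

theorem theoremB:
  fixes C :: "('o, 'm) cat"
    and M :: "('m, 'o, 'x) cmod"
    and N :: "('m, 'o, 'z) cmod"
  assumes "FI_type C"
  shows
   "(is_free C M \<and> is_free C N \<longrightarrow> is_free C (tensor C M N)) \<and>
    (\<forall>c1\<in>Ob C. \<forall>c2\<in>Ob C. free_deg_le C M c1 \<and> free_deg_le C N c2 \<longrightarrow>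
        free_deg_le_sum C (tensor C M N) c1 c2) \<and>
    (\<forall>n cs (Vs :: nat \<Rightarrow> (nat \<Rightarrow> complex) set) \<rho>s \<iota> (M' :: ('m, 'o, 'w) cmod) \<iota>'.
        free_pres C M n cs Vs \<rho>s \<iota> \<and>
        free_pres C M' n cs (\<lambda>i. dualV (Vs i)) (\<lambda>i. dual_act C (cs i) (Vs i) (\<rho>s i)) \<iota>'
      \<longrightarrow> is_free C M' \<and>
          (\<forall>d\<in>Ob C. pres_deg_le C n cs Vs d \<longrightarrow> free_deg_le C M' d) \<and>
          (\<exists>B :: 'o \<Rightarrow> ('w \<times> 'x \<Rightarrow> complex) \<Rightarrow> complex.
             (\<forall>d\<in>Ob C. lin_fun (sp (tensor C M' M) d) (B d)) \<and>
             (\<forall>d e h. h \<in> Hom C d e \<longrightarrow>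
                (\<forall>t\<in>sp (tensor C M' M) d. B e (mp (tensor C M' M) h t) = B d t)) \<and>
             (\<forall>d\<in>Ob C.
                (\<forall>x\<in>sp M' d. (\<forall>y\<in>sp M d. B d (pt x y) = 0) \<longrightarrow> x = 0) \<and>
                (\<forall>y\<in>sp M d. (\<forall>x\<in>sp M' d. B d (pt x y) = 0) \<longrightarrow> y = 0) \<and>
                bij_betw (\<lambda>x y. if y \<in> sp M d then B d (pt x y) else 0)
                         (sp M' d) (dualV (sp M d)) \<and>
                (\<forall>g\<in>Aut C d. \<forall>x\<in>sp M' d. \<forall>y\<in>sp M d.
                    B d (pt (mp M' g x) (mp M g y)) = B d (pt x y))))) \<and>
    (\<forall>c d e f. c \<in> Ob C \<and> d \<in> Ob C \<and> e \<in> Ob C \<and> free_deg_le C M c \<and>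
        obj_le C c d \<and> obj_le C d e \<and> f \<in> Hom C d e \<longrightarrow>
        bij_betw (coinv_map C M e f) (coinv C M d) (coinv C M e))"
proof -
  interpret FI_category C by unfold_locales (rule assms)
  have tens: "tensor_modules C M n cs Vs \<rho>s \<iota> N n' cs' Vs' \<rho>s' \<iota>'"
    if "free_pres C M n cs Vs \<rho>s \<iota>" "free_pres C N n' cs' Vs' \<rho>s' \<iota>'"
    for n cs and Vs :: "nat \<Rightarrow> (nat \<Rightarrow> complex) set" and \<rho>s \<iota> n' cs' and Vs' :: "nat \<Rightarrow> (nat \<Rightarrow> complex) set" and \<rho>s' \<iota>'
    using that by unfold_locales
  have free: "is_free C (tensor C M N)" if "is_free C M" "is_free C N"
    using that tensor_modules.tensor_free(1)[OF tens] unfolding is_free_def[of C M] is_free_def[of C N] by blast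
  have deg: "free_deg_le_sum C (tensor C M N) c1 c2" if MN: "free_deg_le C M c1" "free_deg_le C N c2" for c1 c2
    unfolding free_deg_le_sum_def
  proof (intro conjI ballI impI)
    obtain n cs and Vs :: "nat \<Rightarrow> (nat \<Rightarrow> complex) set" and \<rho>s \<iota> where
      1: "free_pres C M n cs Vs \<rho>s \<iota>" "pres_deg_le C n cs Vs c1" using MN(1) unfolding free_deg_le_def by blast
    obtain n' cs' and Vs' :: "nat \<Rightarrow> (nat \<Rightarrow> complex) set" and \<rho>s' \<iota>' where
      2: "free_pres C N n' cs' Vs' \<rho>s' \<iota>'" "pres_deg_le C n' cs' Vs' c2" using MN(2) unfolding free_deg_le_def by blast
    interpret tensor_modules C M n cs Vs \<rho>s \<iota> N n' cs' Vs' \<rho>s' \<iota>' by (rule tens[OF 1(1) 2(1)])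
    show "is_free C (tensor C M N)" by (rule tensor_free(1))
    show "free_deg_le C (tensor C M N) d" if "geq_sum C c1 c2 d" for d
      by (rule tensor_free(2)[OF 1(2) 2(2) that])
  qed
  have coinv: "bij_betw (coinv_map C M e f) (coinv C M d) (coinv C M e)"
    if A: "free_deg_le C M c" "obj_le C c d" "f \<in> Hom C d e" for c d e f
  proof -
    obtain n cs and Vs :: "nat \<Rightarrow> (nat \<Rightarrow> complex) set" and \<rho>s \<iota> where
      1: "free_pres C M n cs Vs \<rho>s \<iota>" "pres_deg_le C n cs Vs c" using A(1) unfolding free_deg_le_def by blast
    interpret free_module C M n cs Vs \<rho>s \<iota> by unfold_locales (rule 1(1))
    show ?thesis by (rule coinv_map_bij[OF 1(2) A(2,3)])
  qed
  show ?thesis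
  proof (intro conjI allI impI ballI, goal_cases)
    case 1
    then show ?case using free by blast
  next
    case 2
    then show ?case using deg by blast
  next
    case (3 n cs Vs \<rho>s \<iota> M' \<iota>')
    then show ?case using free_deg_leI(1) by blast
  next
    case (4 n cs Vs \<rho>s \<iota> M' \<iota>' d)
    then have "pres_deg_le C n cs (\<lambda>i. dualV (Vs i)) d" unfolding pres_deg_le_def using dualV_zero by metis
    then show ?case using free_deg_leI(2) 4 by blast
  next
    case (5 n cs Vs \<rho>s \<iota> M' \<iota>')
    then interpret dual_modules C M n cs Vs \<rho>s \<iota> M' \<iota>' by unfold_locales blast+
    show ?case by (rule exI[of _ B]) (rule pairing)
  next
    case (6 c d e f)
    then show ?case using coinv by blast
  qed
qed

end
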